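(* Let a group $G$ act without inversion on a CAT(0) cube complex $X$. Let $g\in G$ be hyperbolic and suppose $\langle g\rangle$ acts non-transversely on $X^{\mathrm{ess}}_g$. Let $C$ be a cube in $X^{\mathrm{ess}}_g$ of dimension $d=\dim(X^{\mathrm{ess}}_g)$ and let $A$ be the set of elements of $A_g^+$ dual to the edges of $C$. Then there exist an action of $\langle g\rangle$ on $\mathbb R^d$ (preserving its standard integer cubing) and a $\langle g\rangle$-equivariant isometric embedding of cube complexes $\phi\colon X^{\mathrm{ess}}_g\hookrightarrow\mathbb R^d$ such that: (1) $\phi(C)=[0,1]^d\subset\mathbb R^d$. (2) The induced map $\phi_*\colon A_g\to\mathcal H(\mathbb R^d)$ is a bijection, with $\phi_*(A_g^+)=\mathcal H^+(\mathbb R^d)$. (3) The set $[A,gA]\cap\phi_*^{-1}(\mathcal H^1)$ is tightly nested in $X^{\mathrm{ess}}_g$. (4) $[A,gA)=[o,go]$, where $o$ is the minimal vertex of $C$.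
   Context: Distances in cube complexes are combinatorial (minimal edge-path length between vertices), and "isometric" refers to this metric on vertices. A half-space $H$ of $X$ is the closure of a component of the complement of a hyperplane, and $\overline H$ is the complementary half-space. $\mathcal H(X)$ is the set of half-spaces ordered by inclusion; $\subset$ is strict. $H,H'$ are transverse ($H\pitchfork H'$) if $H\cap H'$, $H\cap\overline{H'}$, $\overline H\cap H'$, $\overline H\cap\overline{H'}$ are all nonempty. They are nested if one strictly contains the other, and tightly nested if moreover no third half-space lies properly between them; a chain of half-spaces is called tightly nested if consecutive elements are tightly nested. A half-space is dual to an edge if its bounding hyperplane crosses the edge; for an oriented edge $(x,y)$ the dual half-space is the one containing $y$ and not $x$. For vertices $x,y$, $[x,y]=\{H: y\in H,\ x\in\overline H\}$. An action is without inversion if $gH\ne\overline H$ for all $g\in G$ and $H\in\mathcal H(X)$. $g$ is hyperbolic if $\ell_g=\min_x d(x,gx)>0$ ($x$ ranging over vertices). Then $g$ preserves a bi-infinite combinatorial geodesic on which it translates by $\ell_g$ (a combinatorial axis, oriented so that $g$ translates forward). $A_g^+$ is the set of half-spaces dual to positively oriented edges of a combinatorial axis (independent of the choice of axis); $A_g^-=\{\overline H: H\in A_g^+\}$; $A_g=A_g^+\sqcup A_g^-$, ordered by inclusion in $X$. The essential characteristic set $X^{\mathrm{ess}}_g=X(A_g)$ is the CAT(0) cube complex obtained from the Sageev construction on $A_g$: vertices are subsets $\sigma\subseteq A_g$ containing exactly one of each pair $\{H,\overline H\}$, no two elements of which are disjoint, satisfying the descending chain condition; two vertices are joined by an edge if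 they differ on exactly one pair $\{H,\overline H\}$; a cube is attached whenever its $1$-skeleton is present. Its half-spaces are identified with $A_g$ as a poset with involution, and $\langle g\rangle$ acts on it. $\langle g\rangle$ acts non-transversely on $X^{\mathrm{ess}}_g$ if for every $H\in A_g$, $H$ and $gH$ are not transverse (equivalently in $X^{\mathrm{ess}}_g$ or in $X$). If $C$ is a cube of $X_g^{\mathrm{ess}}$ and $A$ the set of elements of $A_g^+$ dual to its edges, the minimal vertex $o$ and maximal vertex $o^+$ of $C$ are the vertices of $C$ with $A=[o,o^+]$. Put $[A,gA]=\{K\in A_g^+ : H\supseteq K\supseteq H'\text{ for some }H,H'\in A\cup gA\}$ and $[A,gA)=[A,gA]-gA$. In $\mathbb R^d$ with its standard integer cubing, $H^i_n=\{x: x_i\ge n+1/2\}$ for $n \in \mathbb{Z}$, $\mathcal H^i=\{H^i_n:n\in\mathbb Z\}$, $\mathcal H^+(\mathbb R^d)=\mathcal H^1\sqcup\dots\sqcup\mathcal H^d$, $\mathcal H^-(\mathbb R^d)=\{\overline H:H\in\mathcal H^+(\mathbb R^d)\}$, $\mathcal H(\mathbb R^d)=\mathcal H^+(\mathbb R^d)\sqcup\mathcal H^-(\mathbb R^d)$. The induced map $\phi_*$ sends a half-space $K$ of $X^{\mathrm{ess}}_g$ to the half-space of $\mathbb R^d$ dual to the $\phi$-images of the edges dual to $K$ and containing the $\phi$-image of $K$. *)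

theory Defs
  imports
    Complex_Main
    "HOL-Library.Extended_Nat"
    "HOL-Algebra.Group_Action"
    "HOL-Algebra.Elementary_Groups"
begin

section \<open>CAT(0) cube complexes\<close>

text \<open>
  Cube complexes are represented combinatorially: a cube is identified with its set of vertices.
  In a CAT(0) cube complex cubes are embedded, are determined by their vertices, and two cubes
  that meet do so in a common face, so no CAT(0) cube complex is lost in this way, and cellular
  automorphisms are the vertex bijections that preserve cubes.
\<close>

record 'v cubical =
  verts :: "'v set"
  cubes :: "'v set set"

text \<open>
  The vertices of \<open>[0,1]\<^sup>n\<close> are the subsets of \<open>{..<n}\<close>; its faces are the order intervals
  \<open>{L..U}\<close>.
\<close>

definition cube_complex :: "'v cubical \<Rightarrow> bool" where
  "cube_complex X \<longleftrightarrow>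
     \<Union> (cubes X) = verts X \<and>
     (\<forall>v\<in>verts X. {v} \<in> cubes X) \<and>
     (\<forall>C\<in>cubes X. \<forall>D\<in>cubes X. C \<inter> D \<noteq> {} \<longrightarrow> C \<inter> D \<in> cubes X) \<and>
     (\<forall>C\<in>cubes X. \<exists>(n::nat) f. bij_betw f (Pow {..<n}) C \<and>
        {D \<in> cubes X. D \<subseteq> C} = {f ` {L..U} |L U. L \<subseteq> U \<and> U \<subseteq> {..<n}})"

definition cube_dim :: "'v set \<Rightarrow> nat" where
  "cube_dim C = (THE n. card C = 2 ^ n)"

definition complex_dim :: "'v cubical \<Rightarrow> enat" where
  "complex_dim X = (SUP C\<in>cubes X. enat (cube_dim C))"

definition edges :: "'v cubical \<Rightarrow> 'v set set" where
  "edges X = {e \<in> cubes X. card e = 2}"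

definition adj :: "'v cubical \<Rightarrow> 'v \<Rightarrow> 'v \<Rightarrow> bool" where
  "adj X x y \<longleftrightarrow> {x, y} \<in> edges X"

definition cdist :: "'v cubical \<Rightarrow> 'v \<Rightarrow> 'v \<Rightarrow> nat" where
  "cdist X x y = (LEAST n. (adj X ^^ n) x y)"

text \<open>
  The link of a vertex, as an abstract simplicial complex on the neighbours of the vertex
  (including the empty simplex).
\<close>

definition link :: "'v cubical \<Rightarrow> 'v \<Rightarrow> 'v set set" where
  "link X v = {{w \<in> C. adj X v w} |C. C \<in> cubes X \<and> v \<in> C}"

definition flag :: "'v set set \<Rightarrow> bool" where
  "flag L \<longleftrightarrow> (\<forall>S. finite S \<and> (\<forall>x\<in>S. \<forall>y\<in>S. {x, y} \<in> L) \<longrightarrow> S \<in> L)"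

text \<open>
  Simple connectedness is expressed through the edge-path groupoid of the 2-skeleton: edge paths
  (as lists of vertices) are homotopic if they differ by backtracks and by moves across squares.
\<close>

inductive homotopic_edge_paths :: "'v cubical \<Rightarrow> 'v list \<Rightarrow> 'v list \<Rightarrow> bool" for X where
  refl: "homotopic_edge_paths X p p"
| sym: "homotopic_edge_paths X p q \<Longrightarrow> homotopic_edge_paths X q p"
| trans: "homotopic_edge_paths X p q \<Longrightarrow> homotopic_edge_paths X q r \<Longrightarrow> homotopic_edge_paths X p r"
| backtrack: "adj X x y \<Longrightarrow> homotopic_edge_paths X (p @ [x, y, x] @ q) (p @ [x] @ q)"
| square: "distinct [x, y, z, w] \<Longrightarrow> {x, y, z, w} \<in> cubes X \<Longrightarrow>
     adj X x y \<Longrightarrow> adj X y z \<Longrightarrow> adj X z w \<Longrightarrow> adj X w x \<Longrightarrow>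
     homotopic_edge_paths X (p @ [x, y, z] @ q) (p @ [x, w, z] @ q)"

definition simply_connected_complex :: "'v cubical \<Rightarrow> bool" where
  "simply_connected_complex X \<longleftrightarrow>
     verts X \<noteq> {} \<and>
     (\<forall>x\<in>verts X. \<forall>y\<in>verts X. (adj X)\<^sup>*\<^sup>* x y) \<and>
     (\<forall>p. p \<noteq> [] \<and> set p \<subseteq> verts X \<and> successively (adj X) p \<and> hd p = last p \<longrightarrow>
        homotopic_edge_paths X p [hd p])"

definition CAT0_cube_complex :: "'v cubical \<Rightarrow> bool" where
  "CAT0_cube_complex X \<longleftrightarrow>
     cube_complex X \<and> simply_connected_complex X \<and> (\<forall>v\<in>verts X. flag (link X v))"

section \<open>Hyperplanes and half-spaces\<close>

definition opposite_edges :: "'v cubical \<Rightarrow> 'v set \<Rightarrow> 'v set \<Rightarrow> bool" where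
  "opposite_edges X e f \<longleftrightarrow>
     e \<in> edges X \<and> f \<in> edges X \<and> e \<inter> f = {} \<and> e \<union> f \<in> cubes X"

text \<open>A hyperplane is given by the set of edges that it crosses.\<close>

definition hyperplanes :: "'v cubical \<Rightarrow> 'v set set set" where
  "hyperplanes X = {{f. (opposite_edges X)\<^sup>*\<^sup>* e f} |e. e \<in> edges X}"

text \<open>
  A half-space is given by its set of vertices. This determines it, and preserves inclusions
  and emptiness of intersections for half-spaces with distinct bounding hyperplanes.
\<close>

definition halfspaces :: "'v cubical \<Rightarrow> 'v set set" where
  "halfspaces X =
     {{w. (\<lambda>x y. adj X x y \<and> {x, y} \<notin> h)\<^sup>*\<^sup>* v w} |h v. h \<in> hyperplanes X \<and> v \<in> verts X}"

definition opp :: "'v cubical \<Rightarrow> 'v set \<Rightarrow> 'v set" where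
  "opp X H = verts X - H"

definition transverse :: "'v cubical \<Rightarrow> 'v set \<Rightarrow> 'v set \<Rightarrow> bool" where
  "transverse X H K \<longleftrightarrow>
     H \<inter> K \<noteq> {} \<and> H \<inter> opp X K \<noteq> {} \<and> opp X H \<inter> K \<noteq> {} \<and> opp X H \<inter> opp X K \<noteq> {}"

definition nested :: "'v set \<Rightarrow> 'v set \<Rightarrow> bool" where
  "nested H K \<longleftrightarrow> H \<subset> K \<or> K \<subset> H"

text \<open>Tightness is relative to the ambient set \<open>\<H>\<close> of half-spaces.\<close>

definition tightly_nested :: "'v set set \<Rightarrow> 'v set \<Rightarrow> 'v set \<Rightarrow> bool" where
  "tightly_nested \<H> H K \<longleftrightarrow>
     nested H K \<and> \<not> (\<exists>L\<in>\<H>. H \<subset> L \<and> L \<subset> K \<or> K \<subset> L \<and> L \<subset> H)"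

definition tightly_nested_chain :: "'v set set \<Rightarrow> 'v set set \<Rightarrow> bool" where
  "tightly_nested_chain \<H> S \<longleftrightarrow>
     S \<subseteq> \<H> \<and>
     (\<forall>H\<in>S. \<forall>K\<in>S. H \<noteq> K \<longrightarrow> nested H K) \<and>
     (\<forall>H\<in>S. \<forall>K\<in>S. H \<subset> K \<and> \<not> (\<exists>L\<in>S. H \<subset> L \<and> L \<subset> K) \<longrightarrow> tightly_nested \<H> H K)"

section \<open>Actions and axes\<close>

definition cubical_action ::
  "('g, 'b) monoid_scheme \<Rightarrow> 'v cubical \<Rightarrow> ('g \<Rightarrow> 'v \<Rightarrow> 'v) \<Rightarrow> bool" where
  "cubical_action G X act \<longleftrightarrow>
     group_action G (verts X) act \<and> (\<forall>g\<in>carrier G. \<forall>C\<in>cubes X. act g ` C \<in> cubes X)"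

definition without_inversion ::
  "('g, 'b) monoid_scheme \<Rightarrow> 'v cubical \<Rightarrow> ('g \<Rightarrow> 'v \<Rightarrow> 'v) \<Rightarrow> bool" where
  "without_inversion G X act \<longleftrightarrow>
     (\<forall>g\<in>carrier G. \<forall>H\<in>halfspaces X. act g ` H \<noteq> opp X H)"

text \<open>In the following, \<open>t\<close> is the automorphism by which the group element \<open>g\<close> acts.\<close>

definition translation_length :: "'v cubical \<Rightarrow> ('v \<Rightarrow> 'v) \<Rightarrow> nat" where
  "translation_length X t = (LEAST n. \<exists>x\<in>verts X. cdist X x (t x) = n)"

definition hyperbolic :: "'v cubical \<Rightarrow> ('v \<Rightarrow> 'v) \<Rightarrow> bool" where
  "hyperbolic X t \<longleftrightarrow> translation_length X t > 0"

definition combinatorial_axis :: "'v cubical \<Rightarrow> ('v \<Rightarrow> 'v) \<Rightarrow> (int \<Rightarrow> 'v) \<Rightarrow> bool" where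
  "combinatorial_axis X t \<gamma> \<longleftrightarrow>
     (\<forall>n. \<gamma> n \<in> verts X) \<and>
     (\<forall>m n. int (cdist X (\<gamma> m) (\<gamma> n)) = \<bar>m - n\<bar>) \<and>
     (\<forall>n. t (\<gamma> n) = \<gamma> (n + int (translation_length X t)))"

definition A_pos :: "'v cubical \<Rightarrow> ('v \<Rightarrow> 'v) \<Rightarrow> 'v set set" where
  "A_pos X t = {H \<in> halfspaces X.
     \<exists>\<gamma> n. combinatorial_axis X t \<gamma> \<and> \<gamma> n \<notin> H \<and> \<gamma> (n + 1) \<in> H}"

definition A_neg :: "'v cubical \<Rightarrow> ('v \<Rightarrow> 'v) \<Rightarrow> 'v set set" where
  "A_neg X t = opp X ` A_pos X t"

definition A_all :: "'v cubical \<Rightarrow> ('v \<Rightarrow> 'v) \<Rightarrow> 'v set set" where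
  "A_all X t = A_pos X t \<union> A_neg X t"

section \<open>The Sageev construction and the essential characteristic set\<close>

text \<open>\<open>\<A>\<close> is a set of half-spaces of \<open>X\<close> closed under \<open>opp X\<close>.\<close>

definition sageev_verts :: "'v cubical \<Rightarrow> 'v set set \<Rightarrow> 'v set set set" where
  "sageev_verts X \<A> = {\<sigma>. \<sigma> \<subseteq> \<A> \<and>
     (\<forall>H\<in>\<A>. (H \<in> \<sigma>) \<noteq> (opp X H \<in> \<sigma>)) \<and>
     (\<forall>H\<in>\<sigma>. \<forall>K\<in>\<sigma>. H \<inter> K \<noteq> {}) \<and>
     \<not> (\<exists>f :: nat \<Rightarrow> 'v set. \<forall>n. f n \<in> \<sigma> \<and> f (Suc n) \<subset> f n)}"

definition sageev_adj :: "'v cubical \<Rightarrow> 'v set set \<Rightarrow> 'v set set \<Rightarrow> 'v set set \<Rightarrow> bool" where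
  "sageev_adj X \<A> \<sigma> \<tau> \<longleftrightarrow>
     \<sigma> \<in> sageev_verts X \<A> \<and> \<tau> \<in> sageev_verts X \<A> \<and>
     (\<exists>H\<in>\<A>. (\<sigma> - \<tau>) \<union> (\<tau> - \<sigma>) = {H, opp X H})"

text \<open>
  A cube for every subgraph that is the 1-skeleton of some \<open>[0,1]\<^sup>n\<close>; the case \<open>n = 0\<close> gives
  the vertices and the case \<open>n = 1\<close> the edges.
\<close>

definition sageev_complex :: "'v cubical \<Rightarrow> 'v set set \<Rightarrow> 'v set set cubical" where
  "sageev_complex X \<A> = \<lparr>
     verts = sageev_verts X \<A>,
     cubes = {C. C \<subseteq> sageev_verts X \<A> \<and>
       (\<exists>(n::nat) f. bij_betw f (Pow {..<n}) C \<and>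
          (\<forall>S\<in>Pow {..<n}. \<forall>T\<in>Pow {..<n}. card ((S - T) \<union> (T - S)) = 1 \<longrightarrow>
             sageev_adj X \<A> (f S) (f T)))}\<rparr>"

definition X_ess :: "'v cubical \<Rightarrow> ('v \<Rightarrow> 'v) \<Rightarrow> 'v set set cubical" where
  "X_ess X t = sageev_complex X (A_all X t)"

text \<open>The action on half-spaces, and on sets of half-spaces, induced by an automorphism.\<close>

definition image_hs :: "('v \<Rightarrow> 'v) \<Rightarrow> 'v set set \<Rightarrow> 'v set set" where
  "image_hs s \<A> = (\<lambda>H. s ` H) ` \<A>"

text \<open>The half-space of \<open>X_ess X t\<close> that is identified with \<open>K \<in> A_all X t\<close>.\<close>

definition ess_halfspace :: "'v cubical \<Rightarrow> ('v \<Rightarrow> 'v) \<Rightarrow> 'v set \<Rightarrow> 'v set set set" where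
  "ess_halfspace X t K = {\<sigma> \<in> verts (X_ess X t). K \<in> \<sigma>}"

definition non_transverse_on_ess :: "'v cubical \<Rightarrow> ('v \<Rightarrow> 'v) \<Rightarrow> bool" where
  "non_transverse_on_ess X t \<longleftrightarrow> (\<forall>H\<in>A_all X t. \<not> transverse X H (t ` H))"

text \<open>The interval \<open>[\<sigma>,\<tau>]\<close> of half-spaces between two vertices of \<open>X_ess X t\<close>.\<close>

definition ess_interval ::
  "'v cubical \<Rightarrow> ('v \<Rightarrow> 'v) \<Rightarrow> 'v set set \<Rightarrow> 'v set set \<Rightarrow> 'v set set" where
  "ess_interval X t \<sigma> \<tau> =
     {K \<in> A_all X t. \<tau> \<in> ess_halfspace X t K \<and> \<sigma> \<in> ess_halfspace X t (opp X K)}"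

definition dual_pos :: "'v cubical \<Rightarrow> ('v \<Rightarrow> 'v) \<Rightarrow> 'v set set set \<Rightarrow> 'v set set" where
  "dual_pos X t C = {K \<in> A_pos X t. \<exists>\<sigma>\<in>C. \<exists>\<tau>\<in>C. adj (X_ess X t) \<sigma> \<tau> \<and>
     \<sigma> \<notin> ess_halfspace X t K \<and> \<tau> \<in> ess_halfspace X t K}"

definition min_vertex :: "'v cubical \<Rightarrow> ('v \<Rightarrow> 'v) \<Rightarrow> 'v set set set \<Rightarrow> 'v set set" where
  "min_vertex X t C =
     (THE z. z \<in> C \<and> (\<exists>z'\<in>C. dual_pos X t C = ess_interval X t z z'))"

definition hull_closed :: "'v cubical \<Rightarrow> ('v \<Rightarrow> 'v) \<Rightarrow> 'v set set \<Rightarrow> 'v set set" where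
  "hull_closed X t A = {K \<in> A_pos X t.
     \<exists>H \<in> A \<union> image_hs t A. \<exists>H' \<in> A \<union> image_hs t A. K \<subseteq> H \<and> H' \<subseteq> K}"

definition hull_half_open :: "'v cubical \<Rightarrow> ('v \<Rightarrow> 'v) \<Rightarrow> 'v set set \<Rightarrow> 'v set set" where
  "hull_half_open X t A = hull_closed X t A - image_hs t A"

section \<open>The integer cubing of Euclidean space\<close>

text \<open>
  Vertices are the points of \<open>\<int>\<^sup>d\<close>, with coordinates indexed by \<open>{..<d}\<close> and padded by \<open>0\<close>.
  Half-spaces are again given by the vertices that they contain.
\<close>

definition int_cubing :: "nat \<Rightarrow> (nat \<Rightarrow> int) cubical" where
  "int_cubing d = \<lparr>
     verts = {x. \<forall>i\<ge>d. x i = 0},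
     cubes = {{x. \<forall>i. x i = a i \<or> i \<in> S \<and> x i = a i + 1} |a S.
                (\<forall>i\<ge>d. a i = 0) \<and> S \<subseteq> {..<d}}\<rparr>"

definition unit_cube :: "nat \<Rightarrow> (nat \<Rightarrow> int) set" where
  "unit_cube d = {x \<in> verts (int_cubing d). \<forall>i<d. 0 \<le> x i \<and> x i \<le> 1}"

definition coord_halfspace :: "nat \<Rightarrow> nat \<Rightarrow> int \<Rightarrow> (nat \<Rightarrow> int) set" where
  "coord_halfspace d i n = {x \<in> verts (int_cubing d). real_of_int (x i) \<ge> real_of_int n + 1/2}"

definition coord_halfspaces :: "nat \<Rightarrow> nat \<Rightarrow> (nat \<Rightarrow> int) set set" where
  "coord_halfspaces d i = range (coord_halfspace d i)"

definition int_halfspaces_pos :: "nat \<Rightarrow> (nat \<Rightarrow> int) set set" where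
  "int_halfspaces_pos d = (\<Union>i<d. coord_halfspaces d i)"

definition int_halfspaces_neg :: "nat \<Rightarrow> (nat \<Rightarrow> int) set set" where
  "int_halfspaces_neg d = opp (int_cubing d) ` int_halfspaces_pos d"

definition int_halfspaces :: "nat \<Rightarrow> (nat \<Rightarrow> int) set set" where
  "int_halfspaces d = int_halfspaces_pos d \<union> int_halfspaces_neg d"

section \<open>Isometric embeddings\<close>

definition isometric_embedding :: "'v cubical \<Rightarrow> 'w cubical \<Rightarrow> ('v \<Rightarrow> 'w) \<Rightarrow> bool" where
  "isometric_embedding X Y \<phi> \<longleftrightarrow>
     \<phi> ` verts X \<subseteq> verts Y \<and> inj_on \<phi> (verts X) \<and>
     (\<forall>C\<in>cubes X. \<phi> ` C \<in> cubes Y) \<and>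
     (\<forall>x\<in>verts X. \<forall>y\<in>verts X. cdist Y (\<phi> x) (\<phi> y) = cdist X x y)"

definition induced_map :: "'v cubical \<Rightarrow> 'w cubical \<Rightarrow> ('v \<Rightarrow> 'w) \<Rightarrow> 'v set \<Rightarrow> 'w set" where
  "induced_map X Y \<phi> K = (THE H. H \<in> halfspaces Y \<and>
     (\<forall>x y. adj X x y \<and> x \<notin> K \<and> y \<in> K \<longrightarrow> \<phi> x \<notin> H \<and> \<phi> y \<in> H) \<and> \<phi> ` K \<subseteq> H)"

text \<open>The map \<open>\<phi>\<^sub>*\<close>, on half-spaces of \<open>X_ess X t\<close> given as elements of \<open>A_all X t\<close>.\<close>

definition ess_induced ::
  "'v cubical \<Rightarrow> ('v \<Rightarrow> 'v) \<Rightarrow> nat \<Rightarrow> ('v set set \<Rightarrow> nat \<Rightarrow> int) \<Rightarrow> 'v set \<Rightarrow> (nat \<Rightarrow> int) set" where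
  "ess_induced X t d \<phi> K = induced_map (X_ess X t) (int_cubing d) \<phi> (ess_halfspace X t K)"

end

theory Submission
  imports Defs
begin

text \<open>
  Two edge paths of a CAT(0) cube complex are swap equivalent if they differ by moves across squares.
  The flag condition shows that the reduced paths up to swaps are acted on by the edge-path groupoid,
  so by simple connectedness all geodesics between two vertices are swap equivalent. This gives the
  quadrangle condition, hence all edges of a hyperplane are oriented consistently by the distance from
  any vertex, and no geodesic crosses a hyperplane twice. Therefore the half-spaces in \<open>A_pos\<close> are
  enumerated by the integers along any axis, all axes give the same ones, and inclusion becomes a
  periodic partial order on the integers that refines \<open>\<ge>\<close>.

  The elements dual to a cube of maximal dimension form a maximum antichain \<open>A\<close>. Dilworth's theorem
  divides the finite interval between \<open>A\<close> and its translate into \<open>d\<close> chains; translating and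
  concatenating them gives \<open>d\<close> bi-infinite chains permuted by \<open>g\<close>, which are the coordinate
  directions. A chain becomes tightly nested if it is taken as large as possible. If there is no axis
  at all, the essential complex is a single vertex, so the existence of axes is not required.
\<close>


section \<open>Squares in cubes\<close>

text \<open>The obstacle in the second half is that the chain decomposition has to be compatible
  with \<open>g\<close>, which in general permutes the chains. It is therefore chosen on one period
  only. A colour class of the interval between \<open>A\<close> and its translate meets each end
  exactly once, because both ends are antichains with as many elements as there are colours. So a
  class that arrives at a point of the translate has exactly one continuation, the translate of the
  class that starts there. In this way a decomposition of one period becomes an equivariant one, at
  the price of a permutation of the colours. Non-transversality enters as comparability of every
  index with its translate, which also bounds the size of antichains. A vertex of the essential
  complex is a bounded down-closed set of indices; it cuts each chain at one place, and these places
  are its coordinates. The embedding is isometric because one edge changes one coordinate by one,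
  and a vertex can always be moved towards another one along such an edge.\<close>

lemma adj_sym: "adj X x y \<Longrightarrow> adj X y x"
  by (simp add: adj_def insert_commute)

lemma adj_sym_iff: "adj X x y \<longleftrightarrow> adj X y x"
  by (simp add: adj_def insert_commute)

lemma adj_neq: "adj X x y \<Longrightarrow> x \<noteq> y"
  by (auto simp: adj_def edges_def)

text \<open>Symmetric difference with a singleton. It serves as the step in direction
  \<open>i\<close> in the cube \<open>Pow {..<n}\<close>, and later as the crossing of one
  hyperplane by the index set of a vertex.\<close>

definition toggle :: "'a \<Rightarrow> 'a set \<Rightarrow> 'a set" where
  "toggle i S = (if i \<in> S then S - {i} else insert i S)"

lemma toggle_toggle [simp]: "toggle i (toggle i S) = S"
  by (auto simp: toggle_def)

lemma toggle_commute: "toggle i (toggle j S) = toggle j (toggle i S)"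
  by (auto simp: toggle_def)

lemma toggle_neq [simp]: "toggle i S \<noteq> S" "S \<noteq> toggle i S"
  by (auto simp: toggle_def)

lemma toggle_eq_iff [simp]: "toggle i S = toggle j S \<longleftrightarrow> i = j"
  by (auto simp: toggle_def split: if_splits)

lemma toggle_inj [simp]: "toggle i S = toggle i T \<longleftrightarrow> S = T"
  by (metis toggle_toggle)

lemma toggle_subset: "i \<in> U \<Longrightarrow> S \<subseteq> U \<Longrightarrow> toggle i S \<subseteq> U"
  by (auto simp: toggle_def)

lemma toggle_toggle_neq [simp]: "i \<noteq> j \<Longrightarrow> toggle i (toggle j S) \<noteq> S"
    "i \<noteq> j \<Longrightarrow> S \<noteq> toggle i (toggle j S)"
  by (metis toggle_eq_iff toggle_toggle)+

lemma interval_1: "{S - {i}..S \<union> {i}} = {S, toggle i S}"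
  by (auto simp: toggle_def)

lemma interval_2: "i \<noteq> j \<Longrightarrow>
    {S - {i, j}..S \<union> {i, j}} = {S, toggle i S, toggle i (toggle j S), toggle j S}"
  by (auto simp: toggle_def)

lemma Pow_lessThan_eq_card: "card (Pow {..<n::nat}) = 2 ^ n"
  by (simp add: card_Pow)

locale cat0 =
  fixes X :: "'v cubical"
  assumes CAT0: "CAT0_cube_complex X"
begin

lemma cube_cx: "cube_complex X" and simply_conn: "simply_connected_complex X"
  and flag_link: "v \<in> verts X \<Longrightarrow> flag (link X v)"
  using CAT0 by (auto simp: CAT0_cube_complex_def)

lemma cubes_verts: "C \<in> cubes X \<Longrightarrow> x \<in> C \<Longrightarrow> x \<in> verts X"
  using cube_cx by (auto simp: cube_complex_def)

lemma cube_Int: "C \<in> cubes X \<Longrightarrow> D \<in> cubes X \<Longrightarrow> C \<inter> D \<noteq> {} \<Longrightarrow> C \<inter> D \<in> cubes X"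
  using cube_cx by (auto simp: cube_complex_def)

lemma adj_verts: assumes "adj X x y" shows "x \<in> verts X" "y \<in> verts X"
  using assms cubes_verts[of "{x,y}"] by (auto simp: adj_def edges_def)

text \<open>A chart of the cube \<open>C\<close> by subsets of \<open>{..<n}\<close> in which faces
  are order intervals; statements about a single cube are reduced to set computations in such a
  chart.\<close>

definition labelled :: "nat \<Rightarrow> (nat set \<Rightarrow> 'v) \<Rightarrow> 'v set \<Rightarrow> bool" where
  "labelled n f C \<longleftrightarrow> bij_betw f (Pow {..<n}) C \<and>
     {D \<in> cubes X. D \<subseteq> C} = {f ` {L..U} |L U. L \<subseteq> U \<and> U \<subseteq> {..<n}}"

lemma cube_labelled:
  assumes "C \<in> cubes X" obtains n f where "labelled n f C"
proof -
  have "\<exists>n f. labelled n f C"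
    using assms cube_cx unfolding cube_complex_def labelled_def by (elim conjE) (rule bspec)
  then show ?thesis using that by blast
qed

lemma labelled_bij: "labelled n f C \<Longrightarrow> bij_betw f (Pow {..<n}) C"
  unfolding labelled_def by (rule conjunct1)

lemma labelled_card: "labelled n f C \<Longrightarrow> card C = 2 ^ n"
  using bij_betw_same_card[OF labelled_bij] Pow_lessThan_eq_card by metis

lemma labelled_inj: "labelled n f C \<Longrightarrow> S \<subseteq> {..<n} \<Longrightarrow> T \<subseteq> {..<n} \<Longrightarrow> f S = f T \<longleftrightarrow> S = T"
  using labelled_bij[of n f C] unfolding bij_betw_def by (auto dest: inj_onD)

lemma labelled_surj: "labelled n f C \<Longrightarrow> x \<in> C \<Longrightarrow> \<exists>S\<subseteq>{..<n}. x = f S"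
  using labelled_bij[of n f C] unfolding bij_betw_def by blast

lemma labelled_face:
  assumes "labelled n f C" "L \<subseteq> U" "U \<subseteq> {..<n}" shows "f ` {L..U} \<in> cubes X"
proof -
  have "f ` {L..U} \<in> {D \<in> cubes X. D \<subseteq> C}"
    unfolding assms(1)[unfolded labelled_def, THEN conjunct2] 
    by (rule CollectI, rule exI[of _ L], rule exI[of _ U]) (simp add: assms(2,3))
  then show ?thesis by simp
qed

lemma labelled_faceD:
  assumes "labelled n f C" "D \<in> cubes X" "D \<subseteq> C"
  obtains L U where "D = f ` {L..U}" "L \<subseteq> U" "U \<subseteq> {..<n}"
proof -
  have "D \<in> {f ` {L..U} |L U. L \<subseteq> U \<and> U \<subseteq> {..<n}}"
    unfolding assms(1)[unfolded labelled_def, THEN conjunct2, symmetric] using assms(2,3) by simp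
  then show ?thesis using that by blast
qed

lemma labelled_adj:
  assumes "labelled n f C" "S \<subseteq> {..<n}" "i < n"
  shows "adj X (f S) (f (toggle i S))"
proof -
  have "f ` {S - {i}..S \<union> {i}} \<in> cubes X"
    by (rule labelled_face[OF assms(1)]) (use assms(2,3) in auto)
  moreover have "f S \<noteq> f (toggle i S)"
    using labelled_inj[OF assms(1,2)] toggle_subset[of i "{..<n}" S] assms by simp
  ultimately show ?thesis
    unfolding interval_1 by (simp add: adj_def edges_def)
qed

text \<open>An edge inside \<open>C\<close> is a face, hence the image of an interval
  \<open>{L..U}\<close> with two elements. Any \<open>i\<close> in \<open>U - L\<close> puts both
  \<open>L\<close> and \<open>insert i L\<close> into it, so these are all.\<close>

lemma labelled_adjD:
  assumes l: "labelled n f C" "S \<subseteq> {..<n}" "T \<subseteq> {..<n}" and a: "adj X (f S) (f T)"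
  obtains i where "i < n" "T = toggle i S"
proof -
  have "{f S, f T} \<in> cubes X" "{f S, f T} \<subseteq> C"
    using a l labelled_bij[OF l(1)] by (auto simp: adj_def edges_def bij_betw_def)
  then obtain L U where LU: "{f S, f T} = f ` {L..U}" "L \<subseteq> U" "U \<subseteq> {..<n}"
    using labelled_faceD[OF l(1)] by metis
  have eq: "{S, T} = {L..U}"
  proof (rule inj_on_image_eq_iff[THEN iffD1, of f "Pow {..<n}"])
    show "inj_on f (Pow {..<n})" using labelled_bij[OF l(1)] by (auto simp: bij_betw_def)
    show "f ` {S, T} = f ` {L..U}" using LU(1) by simp
    show "{S, T} \<subseteq> Pow {..<n}" using l by blast
    show "{L..U} \<subseteq> Pow {..<n}" using LU(3) by fastforce
  qed
  have "S \<noteq> T" using adj_neq[OF a] by blast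
  have "L \<noteq> U"
  proof
    assume "L = U"
    then have "{S, T} = {L}" using eq by simp
    then show False using \<open>S \<noteq> T\<close> by (metis doubleton_eq_iff insert_absorb2)
  qed
  then obtain i where i: "i \<in> U" "i \<notin> L" using LU(2) by blast
  have "insert i L \<in> {L..U}" "L \<in> {L..U}" using i LU(2) by (simp_all add: subset_insertI)
  then have 1: "insert i L \<in> {S, T}" "L \<in> {S, T}" unfolding eq by simp_all
  have "insert i L \<noteq> L" using i by blast
  then have "S = L \<and> T = insert i L \<or> S = insert i L \<and> T = L"
    using 1 \<open>S \<noteq> T\<close> by simp metis
  then have "T = toggle i S" using i by (auto simp: toggle_def)
  moreover have "i < n" using i LU(3) by auto
  ultimately show ?thesis using that by blast
qed

text \<open>The corners come in cyclic order, so the diagonals are \<open>x\<close>,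
  \<open>z\<close> and \<open>y\<close>, \<open>w\<close>.\<close>

definition sq :: "'v \<Rightarrow> 'v \<Rightarrow> 'v \<Rightarrow> 'v \<Rightarrow> bool" where
  "sq x y z w \<longleftrightarrow> distinct [x, y, z, w] \<and> {x, y, z, w} \<in> cubes X \<and>
     adj X x y \<and> adj X y z \<and> adj X z w \<and> adj X w x"

lemma sq_rot: "sq x y z w \<Longrightarrow> sq y z w x"
  by (auto simp: sq_def insert_commute)

lemma sq_flip: "sq x y z w \<Longrightarrow> sq x w z y"
  unfolding sq_def using adj_sym[of X x y] adj_sym[of X y z] adj_sym[of X z w] adj_sym[of X w x]
  by (auto simp: insert_commute)

text \<open>Cubes that meet do so in a cube, so the number of common vertices is a power of two;
  squares with three common corners and different fourth ones would share exactly three.\<close>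

lemma sq_unique:
  assumes "sq x y z w" "sq x y z w'" shows "w = w'"
proof -
  let ?C = "{x, y, z, w}" and ?D = "{x, y, z, w'}"
  have "?C \<inter> ?D \<in> cubes X" using assms cube_Int unfolding sq_def by blast
  then obtain n f where "labelled n f (?C \<inter> ?D)" using cube_labelled by blast
  then have n: "card (?C \<inter> ?D) = 2 ^ n" by (rule labelled_card)
  show ?thesis
  proof (rule ccontr)
    assume "w \<noteq> w'"
    then have "?C \<inter> ?D = {x, y, z}" using assms unfolding sq_def by auto
    then have "card (?C \<inter> ?D) = 3" using assms by (simp add: sq_def)
    then have "2 ^ n = (3::nat)" using n by simp
    then show False by (cases n) (simp_all, presburger)
  qed
qed

lemma labelled_sq:
  assumes l: "labelled n f C" "S \<subseteq> {..<n}" and ij: "i < n" "j < n" "i \<noteq> j"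
  shows "sq (f S) (f (toggle i S)) (f (toggle i (toggle j S))) (f (toggle j S))"
proof -
  have sub: "toggle i S \<subseteq> {..<n}" "toggle j S \<subseteq> {..<n}" "toggle i (toggle j S) \<subseteq> {..<n}"
    using assms by (simp_all add: toggle_subset)
  have "f ` {S - {i, j}..S \<union> {i, j}} \<in> cubes X"
    using labelled_face[OF l(1), of "S - {i, j}" "S \<union> {i, j}"] assms by auto
  then have "{f S, f (toggle i S), f (toggle i (toggle j S)), f (toggle j S)} \<in> cubes X"
    unfolding interval_2[OF ij(3)] by simp
  moreover have "adj X (f S) (f (toggle i S))" "adj X (f (toggle j S)) (f S)"
    "adj X (f (toggle i S)) (f (toggle i (toggle j S)))"
    "adj X (f (toggle i (toggle j S))) (f (toggle j S))"
    using labelled_adj[OF l ij(1)] labelled_adj[OF l ij(2), THEN adj_sym]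
      labelled_adj[OF l(1) sub(1) ij(2)] labelled_adj[OF l(1) sub(2) ij(1), THEN adj_sym]
    unfolding toggle_commute[of j i] by blast+
  moreover have "distinct [f S, f (toggle i S), f (toggle i (toggle j S)), f (toggle j S)]"
    using assms sub toggle_toggle_neq(1)[OF ij(3), of S]
    by (auto simp: labelled_inj[OF l(1)])
  ultimately show ?thesis unfolding sq_def by blast
qed

lemma opposite_edges_sq:
  assumes "opposite_edges X {x, y} f"
  obtains x' y' where "f = {x', y'}" "sq x y y' x'"
proof -
  have a: "adj X x y" "f \<in> edges X" "{x, y} \<inter> f = {}" "{x, y} \<union> f \<in> cubes X"
    using assms by (auto simp: opposite_edges_def adj_def)
  obtain n g where l: "labelled n g ({x, y} \<union> f)" using a cube_labelled by blast
  have cf: "card f = 2" "card {x, y} = 2" using a(2) adj_neq[of X x y] assms by (auto simp: edges_def opposite_edges_def adj_def)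
  have fin: "finite f" using cf(1) by (intro card_ge_0_finite) simp
  have "card ({x, y} \<union> f) = 4"
    using a(3) card_Un_disjoint[of "{x, y}" f] fin cf by simp
  then have "2 ^ n = (2::nat) ^ 2" using labelled_card[OF l] by simp
  then have n: "n = 2" using power_inject_exp[of "2::nat" n 2] by simp
  obtain S where S: "x = g S" "S \<subseteq> {..<n}" using labelled_surj[OF l] by blast
  obtain T where T: "y = g T" "T \<subseteq> {..<n}" using labelled_surj[OF l] by blast
  obtain i where i: "i < n" "T = toggle i S" using labelled_adjD[OF l S(2) T(2)] a S T by blast
  \<comment> \<open>The chart has the two directions 0 and 1, and \<open>i\<close> is that of
    \<open>{x, y}\<close>; so \<open>1 - i\<close> is the other one.\<close>
  define j where "j = 1 - i"
  have j: "j < n" "i \<noteq> j" using i(1) n unfolding j_def by arith+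
  have s: "sq (g S) (g (toggle i S)) (g (toggle i (toggle j S))) (g (toggle j S))"
    by (rule labelled_sq[OF l S(2) i(1) j])
  have "g (toggle i (toggle j S)) \<in> {x, y} \<union> f" "g (toggle j S) \<in> {x, y} \<union> f"
    using labelled_bij[OF l] S(2) i j unfolding bij_betw_def by (auto simp: toggle_subset)
  then have "{g (toggle j S), g (toggle i (toggle j S))} \<subseteq> f"
    using s S T i by (auto simp: sq_def)
  moreover have "card {g (toggle j S), g (toggle i (toggle j S))} = 2"
    using s by (auto simp: sq_def)
  ultimately have "{g (toggle j S), g (toggle i (toggle j S))} = f"
    using cf(1) fin by (intro card_subset_eq) simp_all
  then show ?thesis using that[of "g (toggle j S)" "g (toggle i (toggle j S))"] s
    unfolding S T i(2) by simp
qed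

lemma sq_opposite: "sq x y z w \<Longrightarrow> opposite_edges X {x, y} {z, w}"
proof -
  assume s: "sq x y z w"
  have "{x, y} \<union> {z, w} = {x, y, z, w}" by blast
  then show ?thesis using s unfolding sq_def opposite_edges_def adj_def by simp
qed

end

section \<open>Edge paths and distances\<close>

lemma relpowp_iff_list:
  "(R ^^ n) x y \<longleftrightarrow> (\<exists>p. hd p = x \<and> last p = y \<and> length p = Suc n \<and> successively R p)"
proof (induction n arbitrary: x)
  case 0
  have "\<exists>p. hd p = x \<and> last p = x \<and> length p = Suc 0 \<and> successively R p"
    by (rule exI[of _ "[x]"]) simp
  moreover have "x = y" if "hd p = x" "last p = y" "length p = Suc 0" for p
    using that by (cases p) auto
  ultimately show ?case by auto
next
  case (Suc n)
  show ?case
  proof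
    assume "(R ^^ Suc n) x y"
    then obtain z where z: "R x z" "(R ^^ n) z y" by (metis relpowp_Suc_D2)
    then obtain p where p: "hd p = z" "last p = y" "length p = Suc n" "successively R p"
      using Suc by blast
    show "\<exists>p. hd p = x \<and> last p = y \<and> length p = Suc (Suc n) \<and> successively R p"
      by (rule exI[of _ "x # p"]) (use p z in \<open>auto simp: successively_Cons\<close>)
  next
    assume "\<exists>p. hd p = x \<and> last p = y \<and> length p = Suc (Suc n) \<and> successively R p"
    then obtain p where p: "hd p = x" "last p = y" "length p = Suc (Suc n)" "successively R p"
      by blast
    then obtain z q where q: "p = x # z # q"
      by (cases p; cases "tl p") auto
    then have "(R ^^ n) z y" using p by (subst Suc) (rule exI[of _ "z # q"], auto)
    moreover have "R x z" using p q by simp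
    ultimately show "(R ^^ Suc n) x y" by (metis relpowp_Suc_I2)
  qed
qed

text \<open>Counts the steps of a path along edges in \<open>S\<close>. With all edges as
  \<open>S\<close> it gives the parity of the length, with a hyperplane as \<open>S\<close> the
  separation property.\<close>

fun crossings :: "'v set set \<Rightarrow> 'v list \<Rightarrow> nat" where
  "crossings S (x # y # p) = (if {x, y} \<in> S then 1 else 0) + crossings S (y # p)"
| "crossings S p = 0"

lemma crossings_append: "crossings S (p @ x # q) = crossings S (p @ [x]) + crossings S (x # q)"
proof (induction p)
  case (Cons a p)
  then show ?case by (cases p) auto
qed simp

lemma crossings_edges: "successively (adj X) p \<Longrightarrow> crossings (edges X) p = length p - 1"
  by (induction p rule: induct_list012) (auto simp: adj_def)

lemma crossings_0: "successively (\<lambda>x y. {x, y} \<notin> S) p \<Longrightarrow> crossings S p = 0"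
  by (induction p rule: induct_list012) auto

context cat0
begin

text \<open>A backtrack uses the same edge twice. A square move exchanges two consecutive edges for
  their opposite ones, and \<open>S\<close> contains opposite edges of a square together; so the
  parity survives.\<close>

lemma homotopic_crossings:
  assumes "homotopic_edge_paths X p q"
    and S: "\<And>x y z w. sq x y z w \<Longrightarrow> {x, y} \<in> S \<longleftrightarrow> {z, w} \<in> S"
  shows "even (crossings S p) \<longleftrightarrow> even (crossings S q)"
  using assms(1)
proof induction
  case (backtrack x y p q)
  show ?case
    using crossings_append[of S p x "y # x # q"] crossings_append[of S p x q]
    by (simp add: insert_commute)
next
  case (square x y z w p q)
  then have s: "sq x y z w" by (simp add: sq_def)
  have "{x, y} \<in> S \<longleftrightarrow> {w, z} \<in> S" "{y, z} \<in> S \<longleftrightarrow> {x, w} \<in> S"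
    using S[OF s] S[OF sq_rot[OF s]] by (simp_all add: insert_commute)
  then show ?case
    using crossings_append[of S p x "y # z # q"] crossings_append[of S p x "w # z # q"]
    by simp
qed auto

definition is_path :: "'v list \<Rightarrow> bool" where
  "is_path p \<longleftrightarrow> p \<noteq> [] \<and> set p \<subseteq> verts X \<and> successively (adj X) p"

lemma closed_null: "is_path p \<Longrightarrow> hd p = last p \<Longrightarrow> homotopic_edge_paths X p [hd p]"
  using simply_conn unfolding simply_connected_complex_def is_path_def by blast

lemma closed_even:
  assumes "is_path p" "hd p = last p"
    and "\<And>x y z w. sq x y z w \<Longrightarrow> {x, y} \<in> S \<longleftrightarrow> {z, w} \<in> S"
  shows "even (crossings S p)"
  using homotopic_crossings[OF closed_null[OF assms(1,2)], of S] assms(3) by simp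

text \<open>Paths are lists of vertices, so odd \<open>length\<close> means an even number of edges:
  the 1-skeleton is bipartite.\<close>

lemma closed_odd:
  assumes "is_path p" "hd p = last p" shows "odd (length p)"
proof -
  have "even (crossings (edges X) p)"
    by (rule closed_even[OF assms]) (auto simp: sq_def adj_def)
  moreover have "crossings (edges X) p = length p - 1"
    using assms by (intro crossings_edges) (simp add: is_path_def)
  moreover have "length p > 0" using assms by (simp add: is_path_def)
  ultimately show ?thesis by simp
qed

lemma no_triangle: "adj X x y \<Longrightarrow> adj X y z \<Longrightarrow> \<not> adj X x z"
  using closed_odd[of "[x, y, z, x]"] adj_verts[of x y] adj_verts[of y z] adj_sym[of X x z]
  by (auto simp: is_path_def)

lemma successively_verts:
  "successively (adj X) p \<Longrightarrow> p \<noteq> [] \<Longrightarrow> hd p \<in> verts X \<Longrightarrow> set p \<subseteq> verts X"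
proof (induction p rule: induct_list012)
  case (3 x y zs)
  then show ?case using adj_verts[of x y] by auto
qed auto

lemma dist_path:
  assumes "x \<in> verts X" "y \<in> verts X"
  obtains p where "is_path p" "hd p = x" "last p = y" "length p = Suc (cdist X x y)"
proof -
  have "(adj X)\<^sup>*\<^sup>* x y"
    using simply_conn assms unfolding simply_connected_complex_def by blast
  then have "\<exists>n. (adj X ^^ n) x y" by (rule rtranclp_imp_relpowp)
  then have "(adj X ^^ cdist X x y) x y" unfolding cdist_def by (rule LeastI_ex)
  then obtain p where p: "hd p = x" "last p = y" "length p = Suc (cdist X x y)"
    "successively (adj X) p"
    unfolding relpowp_iff_list by blast
  then have "p \<noteq> []" by auto
  with p have "is_path p" using successively_verts[of p] assms(1) by (simp add: is_path_def)
  then show ?thesis using that p by blast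
qed

lemma dist_le: "is_path p \<Longrightarrow> cdist X (hd p) (last p) < length p"
proof -
  assume p: "is_path p"
  have l: "length p = Suc (length p - 1)" using p by (simp add: is_path_def)
  have "(adj X ^^ (length p - 1)) (hd p) (last p)"
    unfolding relpowp_iff_list using p l by (intro exI[of _ p]) (simp add: is_path_def)
  then have "cdist X (hd p) (last p) \<le> length p - 1" unfolding cdist_def by (rule Least_le)
  then show ?thesis using l by linarith
qed

lemma is_path_snoc: "is_path p \<Longrightarrow> adj X (last p) x \<Longrightarrow> is_path (p @ [x])"
  by (auto simp: is_path_def successively_append_iff adj_verts)

lemma dist_adj_le: 
  assumes "v \<in> verts X" "adj X x y" shows "cdist X v y \<le> Suc (cdist X v x)"
proof -
  obtain p where p: "is_path p" "hd p = v" "last p = x" "length p = Suc (cdist X v x)"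
    using dist_path[of v x] assms adj_verts by blast
  then have "is_path (p @ [y])" using is_path_snoc assms by simp
  from dist_le[OF this] p show ?thesis by (simp add: is_path_def)
qed

text \<open>Two geodesics of equal length from \<open>v\<close>, joined by the edge
  \<open>{x, y}\<close>, would form a closed path with an odd number of edges.\<close>

lemma dist_adj_neq:
  assumes "v \<in> verts X" "adj X x y" shows "cdist X v x \<noteq> cdist X v y"
proof
  assume e: "cdist X v x = cdist X v y"
  obtain p where p: "is_path p" "hd p = v" "last p = x" "length p = Suc (cdist X v x)"
    using dist_path[of v x] assms adj_verts by blast
  obtain q where q: "is_path q" "hd q = v" "last q = y" "length q = Suc (cdist X v y)"
    using dist_path[of v y] assms adj_verts by blast
  have "successively (adj X) (rev q)"
    using q(1) unfolding is_path_def successively_rev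
    by (auto elim: successively_mono simp: adj_sym_iff)
  then have "is_path (p @ rev q)" "hd (p @ rev q) = last (p @ rev q)"
    using p q assms by (auto simp: is_path_def successively_append_iff hd_rev last_rev)
  then have "odd (length (p @ rev q))" by (rule closed_odd)
  then show False using p q e by simp
qed

lemma dist_adj_cases:
  assumes "v \<in> verts X" "adj X x y"
  shows "cdist X v y = Suc (cdist X v x) \<or> cdist X v x = Suc (cdist X v y)"
  using dist_adj_le[OF assms] dist_adj_le[OF assms(1) adj_sym[OF assms(2)]] dist_adj_neq[OF assms]
  by linarith

lemma sq_unique3: "sq x y z w \<Longrightarrow> sq x y z' w \<Longrightarrow> z = z'"
  by (metis sq_rot sq_unique)

lemma sq_link: assumes "sq p a q b" shows "{a, b} \<in> link X p"
proof -
  have "{w \<in> {p, a, q, b}. adj X p w} = {a, b}"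
    using assms no_triangle[of p a q] adj_neq[of X p p] adj_sym[of X b p]
    unfolding sq_def by auto
  moreover have "{p, a, q, b} \<in> cubes X" using assms by (simp add: sq_def)
  ultimately show ?thesis unfolding link_def by (intro CollectI exI[of _ "{p, a, q, b}"]) simp
qed

lemma adj_link: assumes "adj X p a" shows "{a} \<in> link X p"
proof -
  have "{w \<in> {p, a}. adj X p w} = {a}" using assms adj_neq[of X p p] by auto
  moreover have "{p, a} \<in> cubes X" using assms by (simp add: adj_def edges_def)
  ultimately show ?thesis unfolding link_def by (intro CollectI exI[of _ "{p, a}"]) simp
qed

text \<open>The squares make \<open>a\<close>, \<open>b\<close>, \<open>c\<close> pairwise joined in
  the link of \<open>p\<close>, and the flag condition yields a cube \<open>C\<close> that contains
  them. In a chart of \<open>C\<close> the corner \<open>p\<close> is some \<open>S\<close>, and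
  \<open>z\<close> is \<open>S\<close> with three entries toggled. The prescribed corners
  \<open>q\<close>, \<open>r\<close>, \<open>s\<close> lie in \<open>C\<close> because a square is
  determined by three of its corners.\<close>

lemma cube_corner:
  assumes ab: "sq p a q b" and bc: "sq p b r c" and ac: "sq p a s c"
  obtains z where "sq a q z s" "sq b q z r" "sq c s z r"
proof -
  have adj: "adj X p a" "adj X p b" "adj X p c"
    using ab bc unfolding sq_def by (auto intro: adj_sym)
  have "flag (link X p)" using flag_link adj_verts adj by blast
  moreover have "\<forall>x\<in>{a, b, c}. \<forall>y\<in>{a, b, c}. {x, y} \<in> link X p"
    using sq_link[OF ab] sq_link[OF bc] sq_link[OF ac] adj_link[OF adj(1)] adj_link[OF adj(2)]
      adj_link[OF adj(3)] by (simp add: insert_commute)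
  ultimately have "{a, b, c} \<in> link X p"
    unfolding flag_def by (elim allE[of _ "{a, b, c}"]) simp
  then obtain C where C: "C \<in> cubes X" "p \<in> C" "{w \<in> C. adj X p w} = {a, b, c}"
    unfolding link_def by auto
  then have in_C: "a \<in> C" "b \<in> C" "c \<in> C" by auto
  obtain n f where l: "labelled n f C" using C(1) by (rule cube_labelled)
  obtain S where S: "p = f S" "S \<subseteq> {..<n}" using labelled_surj[OF l C(2)] by blast
  have nb: "\<exists>i<n. w = f (toggle i S)" if w: "w \<in> C" "adj X p w" for w
  proof -
    obtain T where T: "w = f T" "T \<subseteq> {..<n}" using labelled_surj[OF l w(1)] by blast
    obtain i where "i < n" "T = toggle i S"
      using labelled_adjD[OF l S(2) T(2)] w(2) S(1) T(1) by blast
    then show ?thesis using T by blast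
  qed
  obtain i where i: "i < n" "a = f (toggle i S)" using nb[OF in_C(1) adj(1)] by blast
  obtain j where j: "j < n" "b = f (toggle j S)" using nb[OF in_C(2) adj(2)] by blast
  obtain k where k: "k < n" "c = f (toggle k S)" using nb[OF in_C(3) adj(3)] by blast
  have ne: "i \<noteq> j" "i \<noteq> k" "j \<noteq> k" using ab bc ac i j k unfolding sq_def by auto
  have q: "q = f (toggle i (toggle j S))"
    using labelled_sq[OF l S(2) i(1) j(1) ne(1)] ab i j S by (auto intro: sq_unique3)
  have s: "s = f (toggle i (toggle k S))"
    using labelled_sq[OF l S(2) i(1) k(1) ne(2)] ac i k S by (auto intro: sq_unique3)
  have r: "r = f (toggle j (toggle k S))"
    using labelled_sq[OF l S(2) j(1) k(1) ne(3)] bc j k S by (auto intro: sq_unique3)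
  let ?z = "f (toggle i (toggle j (toggle k S)))"
  have "sq a q ?z s"
    using labelled_sq[OF l toggle_subset[of i "{..<n}" S] j(1) k(1) ne(3)] i S(2) q s
    by (simp add: toggle_commute)
  moreover have "sq b q ?z r"
    using labelled_sq[OF l toggle_subset[of j "{..<n}" S] i(1) k(1) ne(2)] j S(2) q r
    by (simp add: toggle_commute)
  moreover have "sq c s ?z r"
    using labelled_sq[OF l toggle_subset[of k "{..<n}" S] i(1) j(1) ne(1)] k S(2) s r
    by (simp add: toggle_commute)
  ultimately show ?thesis by (rule that)
qed

section \<open>Swap classes of edge paths\<close>


definition swap1 :: "'v list \<Rightarrow> 'v list \<Rightarrow> bool" where
  "swap1 p q \<longleftrightarrow> (\<exists>a b x y z w. sq x y z w \<and> p = a @ [x, y, z] @ b \<and> q = a @ [x, w, z] @ b)"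

abbreviation swaps :: "'v list \<Rightarrow> 'v list \<Rightarrow> bool" (infix "\<approx>" 50) where
  "p \<approx> q \<equiv> swap1\<^sup>*\<^sup>* p q"

lemma swap1_sq: "sq x y z w \<Longrightarrow> swap1 (a @ [x, y, z] @ b) (a @ [x, w, z] @ b)"
  unfolding swap1_def by blast

lemma swaps_sq: "sq x y z w \<Longrightarrow> a @ [x, y, z] \<approx> a @ [x, w, z]"
  using swap1_sq[of x y z w a "[]"] by auto

lemma swap1_sym: "swap1 p q \<Longrightarrow> swap1 q p"
  unfolding swap1_def by (metis sq_flip)

lemma swaps_sym: "p \<approx> q \<Longrightarrow> q \<approx> p"
proof (induction rule: rtranclp_induct)
  case (step y z)
  then show ?case using swap1_sym by (metis converse_rtranclp_into_rtranclp)
qed simp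

lemma swaps_trans: "p \<approx> q \<Longrightarrow> q \<approx> r \<Longrightarrow> p \<approx> r"
  by (rule rtranclp_trans)

lemma swap1_append: "swap1 p q \<Longrightarrow> swap1 (p @ b) (q @ b)"
  unfolding swap1_def by (metis append.assoc)

lemma swaps_append: "p \<approx> q \<Longrightarrow> p @ b \<approx> q @ b"
proof (induction rule: rtranclp_induct)
  case (step y z)
  then show ?case using swap1_append by (metis rtranclp.rtrancl_into_rtrancl)
qed simp

lemma swap1_inv:
  assumes "swap1 p q"
  shows "length p = length q" "hd p = hd q" "last p = last q" "is_path p \<Longrightarrow> is_path q" "p \<noteq> []"
proof -
  obtain a b x y z w where *: "sq x y z w" "p = a @ [x, y, z] @ b" "q = a @ [x, w, z] @ b"
    using assms unfolding swap1_def by blast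
  show "length p = length q" "last p = last q" "p \<noteq> []" using * by auto
  show "hd p = hd q" using * by (cases a) auto
  have "adj X x w" "adj X w z" "w \<in> verts X"
    using *(1) adj_verts by (auto simp: sq_def intro: adj_sym)
  then show "is_path q" if "is_path p"
    using that * by (auto simp: is_path_def successively_append_iff successively_Cons)
qed

lemma swaps_inv:
  assumes "p \<approx> q"
  shows "length p = length q" "hd p = hd q" "last p = last q" "is_path p \<Longrightarrow> is_path q"
  using assms by (induction rule: rtranclp_induct) (auto dest: swap1_inv)

text \<open>Compares two paths that are about to be continued to \<open>x\<close>. Either they are
  swap equivalent, or their last edges into \<open>x\<close> are two sides of a square and both
  paths come, up to swaps, from its corner \<open>u\<close> opposite to \<open>x\<close> along a
  common path \<open>s\<close>. It is the analogue of a rule for words in partially commuting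
  letters: different last letters commute and leave a common prefix.\<close>

definition same_end :: "'v \<Rightarrow> 'v list \<Rightarrow> 'v list \<Rightarrow> bool" where
  "same_end x p q \<longleftrightarrow> last p = last q \<and> p \<approx> q \<or>
     (\<exists>s u. sq x (last p) u (last q) \<and> p \<approx> s @ [u, last p] \<and> q \<approx> s @ [u, last q])"

lemma same_end_swap1:
  assumes "swap1 p q"
  shows "same_end (last p) (butlast p) (butlast q)"
proof -
  obtain a b x y z w where *: "sq x y z w" "p = a @ [x, y, z] @ b" "q = a @ [x, w, z] @ b"
    using assms unfolding swap1_def by blast
  show ?thesis
  proof (cases b rule: rev_cases)
    case Nil
    have "sq z y x w" using *(1) sq_flip sq_rot by blast
    then show ?thesis using * Nil unfolding same_end_def
      by (auto simp: butlast_append)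
  next
    case (snoc b' l)
    have "butlast p = a @ [x, y, z] @ b'" "butlast q = a @ [x, w, z] @ b'"
      using * snoc by (simp_all add: butlast_append)
    moreover from this have "swap1 (butlast p) (butlast q)" using swap1_sq[OF *(1)] by simp
    ultimately show ?thesis unfolding same_end_def by auto
  qed
qed

text \<open>The flag condition enters here: three squares at the last but one vertex are filled by a 3-cube.\<close>

lemma same_end_trans:
  assumes IH: "\<And>p q. p \<approx> q \<Longrightarrow> length p = n \<Longrightarrow> 2 \<le> n \<Longrightarrow>
      same_end (last p) (butlast p) (butlast q)"
    and "length p = n" and "same_end x p q" "same_end x q r"
  shows "same_end x p r"
proof -
  consider (1) "last p = last q" "p \<approx> q" | (2) "last q = last r" "q \<approx> r" |
    (3) s u s' u' where "sq x (last p) u (last q)" "p \<approx> s @ [u, last p]" "q \<approx> s @ [u, last q]"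
      "sq x (last q) u' (last r)" "q \<approx> s' @ [u', last q]" "r \<approx> s' @ [u', last r]"
    using assms(3,4) unfolding same_end_def by blast
  then show ?thesis
  proof cases
    case 1
    then show ?thesis using assms(4) swaps_trans unfolding same_end_def by metis
  next
    case 2
    then show ?thesis using assms(3) swaps_trans swaps_sym unfolding same_end_def by metis
  next
    case 3
    let ?y = "last q"
    have len: "length (s @ [u, ?y]) = n"
      using swaps_inv(1)[OF 3(2)] assms(2) by simp
    \<comment> \<open>Both decompositions are swap equivalent to \<open>q\<close>, whose last vertex
      is \<open>?y\<close>; the induction hypothesis compares the two ways of arriving
      there.\<close>
    have "s @ [u, ?y] \<approx> s' @ [u', ?y]" using swaps_trans[OF swaps_sym[OF 3(3)] 3(5)] .
    from IH[OF this len] len have "same_end ?y (s @ [u]) (s' @ [u'])"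
      by (simp add: butlast_append)
    then consider (a) "u = u'" "s @ [u] \<approx> s' @ [u']" |
      (b) t w where "sq ?y u w u'" "s @ [u] \<approx> t @ [w, u]" "s' @ [u'] \<approx> t @ [w, u']"
      unfolding same_end_def by auto
    then show ?thesis
    proof cases
      case a
      have "sq x ?y u (last p)" using sq_flip[OF 3(1)] .
      then have e: "last p = last r" using 3(4) a(1) sq_unique by blast
      have "p \<approx> s' @ [u', last p]"
        using swaps_trans[OF 3(2)] swaps_append[OF a(2), of "[last p]"] by simp
      then have "p \<approx> r" using swaps_trans[OF _ swaps_sym[OF 3(6)]] e by simp
      then show ?thesis using e unfolding same_end_def by blast
    next
      case b
      have "sq ?y x (last p) u" using 3(1) sq_flip sq_rot by blast
      moreover have "sq ?y u w u'" by fact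
      moreover have "sq ?y x (last r) u'" using 3(4) sq_flip sq_rot by blast
      ultimately obtain z where z: "sq x (last p) z (last r)" "sq u (last p) z w" "sq u' (last r) z w"
        by (rule cube_corner)
      have "p \<approx> t @ [w, z, last p]"
      proof -
        have "sq w u (last p) z" using z(2) sq_rot sq_flip by blast
        then have "t @ [w, u, last p] \<approx> t @ [w, z, last p]" by (rule swaps_sq)
        moreover have "p \<approx> t @ [w, u, last p]"
          using swaps_trans[OF 3(2)] swaps_append[OF b(2), of "[last p]"] by simp
        ultimately show ?thesis using swaps_trans by blast
      qed
      moreover have "r \<approx> t @ [w, z, last r]"
      proof -
        have "sq w u' (last r) z" using z(3) sq_rot sq_flip by blast
        then have "t @ [w, u', last r] \<approx> t @ [w, z, last r]" by (rule swaps_sq)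
        moreover have "r \<approx> t @ [w, u', last r]"
          using swaps_trans[OF 3(6)] swaps_append[OF b(3), of "[last r]"] by simp
        ultimately show ?thesis using swaps_trans by blast
      qed
      ultimately show ?thesis using z(1) unfolding same_end_def
        by (metis append.assoc append_Cons append_Nil)
    qed
  qed
qed

text \<open>The inner induction runs along the sequence of swaps, with \<open>same_end_trans\<close>
  as the composition step. Composition compares paths that are shorter by one, because
  \<open>same_end\<close> is applied to \<open>butlast\<close>, and for these the outer induction on
  the length supplies the claim.\<close>

lemma same_end_swaps:
  "p \<approx> q \<Longrightarrow> length p = n \<Longrightarrow> 2 \<le> n \<Longrightarrow> same_end (last p) (butlast p) (butlast q)"
proof (induction n arbitrary: p q)
  case (Suc n)
  from Suc.prems(1) show ?case
  proof (induction rule: rtranclp_induct)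
    case base
    then show ?case unfolding same_end_def by simp
  next
    case (step q r)
    have "same_end (last p) (butlast q) (butlast r)"
      using same_end_swap1[OF step(2)] swaps_inv(3)[OF step(1)] by simp
    show ?case
    proof (rule same_end_trans)
      show "length (butlast p) = n" using Suc.prems(2) by simp
      show "same_end (last p) (butlast p) (butlast q)" by (rule step.IH)
      show "same_end (last p) (butlast q) (butlast r)" by fact
    qed (rule Suc.IH)
  qed
qed simp

lemma two_ends:
  assumes "p @ [x] \<approx> q @ [x]" "p \<noteq> []"
  shows "same_end x p q"
  using same_end_swaps[OF assms(1), of "length (p @ [x])"] assms(2)
  by (cases p) auto

text \<open>The condition concerns the whole swap class because swaps can bring an edge and its
  reverse next to each other.\<close>

definition reduced :: "'v list \<Rightarrow> bool" where
  "reduced p \<longleftrightarrow> (\<forall>q. p \<approx> q \<longrightarrow> \<not> (\<exists>a x y b. q = a @ [x, y, x] @ b))"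

lemma reduced_swaps: "reduced p \<Longrightarrow> p \<approx> q \<Longrightarrow> reduced q"
  unfolding reduced_def using swaps_trans[of p q] by blast

lemma reduced_prefix: "reduced (p @ b) \<Longrightarrow> reduced p"
  unfolding reduced_def by (metis append.assoc swaps_append)

lemma not_reduced_backtrack: "\<not> reduced (a @ [x, y, x] @ b)"
  unfolding reduced_def by blast

lemma not_reduced_swaps_backtrack: "p \<approx> a @ [x, y, x] \<Longrightarrow> \<not> reduced p"
  using not_reduced_backtrack[of a x y "[]"] reduced_swaps by auto

lemma reduced_single: "reduced [x]"
proof -
  have "\<not> [x] \<approx> a @ [z, y, z] @ b" for a b y z
    using swaps_inv(1)[of "[x]" "a @ [z, y, z] @ b"] by auto
  then show ?thesis unfolding reduced_def by blast
qed

text \<open>Some path in the class of \<open>p @ [y]\<close> has a backtrack. If the backtrack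
  avoids the end, then removing the end leaves a path not equivalent to \<open>p\<close>; so the two
  differ by a square at \<open>y\<close>, and a shorter path inherits the problem. If the backtrack
  is at the end, comparing last edges either gives the claim or produces a backtrack in the class of
  \<open>p\<close>.\<close>

lemma not_reduced_snoc:
  "reduced p \<Longrightarrow> p \<noteq> [] \<Longrightarrow> \<not> reduced (p @ [y]) \<Longrightarrow> \<exists>q. p \<approx> q @ [y, last p]"
proof (induction "length p" arbitrary: p y rule: less_induct)
  case less
  obtain a c d b where r: "p @ [y] \<approx> a @ [c, d, c] @ b"
    using less.prems(3) unfolding reduced_def by blast
  let ?x = "last p"
  show ?case
  proof (cases b rule: rev_cases)
    case (snoc b' l)
    let ?r = "a @ [c, d, c] @ b'"
    have ly: "l = y" using swaps_inv(3)[OF r] snoc by simp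
    then have "same_end y p ?r" using two_ends[of p y ?r] r snoc less.prems(2) by simp
    moreover have "\<not> p \<approx> ?r" using reduced_swaps[OF less.prems(1)] not_reduced_backtrack by blast
    ultimately obtain s u where su: "sq y ?x u (last ?r)" "p \<approx> s @ [u, ?x]" "?r \<approx> s @ [u, last ?r]"
      unfolding same_end_def by blast
    have "reduced (s @ [u])" using reduced_prefix[of "s @ [u]" "[?x]"]
      reduced_swaps[OF less.prems(1) su(2)] by simp
    moreover have "\<not> reduced (s @ [u, last ?r])"
      using not_reduced_backtrack[of a c d b'] reduced_swaps[OF _ swaps_sym[OF su(3)]] by blast
    moreover have "length (s @ [u]) < length p" using swaps_inv(1)[OF su(2)] by simp
    ultimately obtain q where q: "s @ [u] \<approx> q @ [last ?r, u]"
      using less.hyps[of "s @ [u]" "last ?r"] by auto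
    have "sq (last ?r) u ?x y" using su(1) sq_rot sq_flip by blast
    then have "q @ [last ?r, u, ?x] \<approx> q @ [last ?r, y, ?x]" by (rule swaps_sq)
    moreover have "p \<approx> q @ [last ?r, u, ?x]"
      using swaps_trans[OF su(2)] swaps_append[OF q, of "[?x]"] by simp
    ultimately have "p \<approx> q @ [last ?r, y, ?x]" using swaps_trans by blast
    then have "p \<approx> (q @ [last ?r]) @ [y, ?x]" by simp
    then show ?thesis by blast
  next
    case Nil
    have cy: "c = y" using swaps_inv(3)[OF r] Nil by simp
    have "same_end y p (a @ [y, d])" using two_ends[of p y "a @ [y, d]"] r Nil cy less.prems(2) by simp
    then consider "?x = d" "p \<approx> a @ [y, d]" |
      (2) s u where "sq y ?x u d" "p \<approx> s @ [u, ?x]" "a @ [y, d] \<approx> s @ [u, d]"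
      unfolding same_end_def by auto
    then show ?thesis
    proof cases
      case 2
      \<comment> \<open>Removing one more vertex gives another square at \<open>d\<close>. It shares
        three corners with the previous one, so its corner \<open>w\<close> is \<open>?x\<close>,
        and the class of \<open>p\<close> would contain the backtrack \<open>?x\<close>,
        \<open>u\<close>, \<open>?x\<close>.\<close>
      have "same_end d (a @ [y]) (s @ [u])" using two_ends[of "a @ [y]" d "s @ [u]"] 2(3) by simp
      moreover have "y \<noteq> u" using 2(1) by (auto simp: sq_def)
      ultimately obtain t w where t: "sq d y w u" "s @ [u] \<approx> t @ [w, u]"
        unfolding same_end_def by auto
      have "sq d y ?x u" using 2(1) sq_rot sq_flip by blast
      then have "w = ?x" using t(1) sq_unique3 by blast
      then have "p \<approx> t @ [?x, u, ?x]"
        using swaps_trans[OF 2(2)] swaps_append[OF t(2), of "[?x]"] by simp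
      then show ?thesis using not_reduced_swaps_backtrack less.prems(1) by blast
    qed auto
  qed
qed

section \<open>Reduced paths with common ends\<close>


text \<open>One step of the edge-path groupoid on swap classes of reduced paths: the end of
  \<open>p\<close> is moved to \<open>y\<close> by appending \<open>y\<close> or by cancelling the
  last edge. With both options in one relation, the inverse step is the same relation read
  backwards.\<close>

definition next_red :: "'v list \<Rightarrow> 'v \<Rightarrow> 'v list \<Rightarrow> bool" where
  "next_red p y q \<longleftrightarrow> reduced p \<and> reduced q \<and> p \<noteq> [] \<and> q \<noteq> [] \<and> last q = y \<and>
     (q \<approx> p @ [y] \<or> p \<approx> q @ [last p])"

lemma next_red_ex: assumes "reduced p" "p \<noteq> []" shows "\<exists>q. next_red p y q"
proof (cases "reduced (p @ [y])")
  case True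
  then show ?thesis using assms unfolding next_red_def by (intro exI[of _ "p @ [y]"]) simp
next
  case False
  then obtain q where q: "p \<approx> q @ [y, last p]" using not_reduced_snoc assms by blast
  then have "reduced (q @ [y])"
    using reduced_swaps[OF assms(1) q] reduced_prefix[of "q @ [y]" "[last p]"] by simp
  then show ?thesis using assms q unfolding next_red_def by (intro exI[of _ "q @ [y]"]) simp
qed

lemma next_red_sym: "next_red p y q \<Longrightarrow> next_red q (last p) p"
  unfolding next_red_def by auto

text \<open>If one representative could be extended to \<open>y\<close> and another one shortened to
  \<open>y\<close>, the extension would contain the backtrack \<open>y\<close>,
  \<open>last p'\<close>, \<open>y\<close>.\<close>

lemma next_red_mixed:
  assumes "next_red p y q" "p \<approx> p'" "q \<approx> p @ [y]" "next_red p' y q'" "p' \<approx> q' @ [last p']"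
  shows False
proof -
  have "q \<approx> q' @ [last p', y]"
    using swaps_trans[OF assms(3) swaps_append[OF swaps_trans[OF assms(2,5)], of "[y]"]] by simp
  moreover have "q' = butlast q' @ [y]" using assms(4) unfolding next_red_def
    by (metis append_butlast_last_id)
  ultimately have "q \<approx> butlast q' @ [y, last p', y]"
    by (metis append.assoc append_Cons append_Nil)
  then show False using not_reduced_swaps_backtrack assms(1) unfolding next_red_def by blast
qed

lemma next_red_unique:
  assumes "p \<approx> p'" "next_red p y q" "next_red p' y q'"
  shows "q \<approx> q'"
proof -
  have l: "last p = last p'" using swaps_inv(3)[OF assms(1)] .
  consider (1) "q \<approx> p @ [y]" "q' \<approx> p' @ [y]" | (2) "p \<approx> q @ [last p]" "p' \<approx> q' @ [last p']" |
    (3) "q \<approx> p @ [y]" "p' \<approx> q' @ [last p']" | (4) "p \<approx> q @ [last p]" "q' \<approx> p' @ [y]"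
    using assms unfolding next_red_def by blast
  then show ?thesis
  proof cases
    case 1
    then show ?thesis using swaps_append[OF assms(1), of "[y]"] swaps_trans swaps_sym by metis
  next
    case 2
    have "q @ [last p] \<approx> q' @ [last p]"
      using swaps_trans[OF swaps_sym[OF 2(1)] swaps_trans[OF assms(1) 2(2)]] l by simp
    from two_ends[OF this] show ?thesis
      using assms(2,3) unfolding next_red_def same_end_def sq_def by auto
  next
    case 3
    then show ?thesis using next_red_mixed assms by blast
  next
    case 4
    then show ?thesis using next_red_mixed[OF assms(3) swaps_sym[OF assms(1)]] assms by blast
  qed
qed

text \<open>\<open>q\<close> is \<open>q'\<close> followed by \<open>x\<close>, \<open>y\<close>,
  which the square turns into \<open>q'\<close> followed by \<open>z\<close>, \<open>y\<close>.
  Hence the step from \<open>q\<close> to \<open>z\<close> cancels, and both results are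
  \<open>q' @ [z]\<close>.\<close>

lemma next_red_square_up_down:
  assumes "sq x y z w" "last p = x"
    "next_red p y q" "next_red p w q'" "q \<approx> p @ [y]" "p \<approx> q' @ [x]"
    "next_red q z r" "next_red q' z r'"
  shows "r \<approx> r'"
proof -
  have q': "q' = butlast q' @ [w]" "reduced q'" "last q' = w"
    using assms(4) unfolding next_red_def by (metis append_butlast_last_id)+
  have q1: "q \<approx> q' @ [x, y]"
    using swaps_trans[OF assms(5) swaps_append[OF assms(6), of "[y]"]] by simp
  have "sq w x y z" using assms(1) sq_rot by blast
  then have "butlast q' @ [w, x, y] \<approx> butlast q' @ [w, z, y]" by (rule swaps_sq)
  then have "q' @ [x, y] \<approx> q' @ [z, y]" using q'(1) by (metis append.assoc append_Cons append_Nil)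
  then have q2: "q \<approx> (q' @ [z]) @ [y]" using swaps_trans[OF q1] by simp
  have red: "reduced (q' @ [z])"
    using reduced_swaps[OF _ q2] reduced_prefix assms(3) unfolding next_red_def by blast
  have "next_red q z (q' @ [z])"
    using red q2 assms(3) unfolding next_red_def by simp
  moreover have "next_red q' z (q' @ [z])"
    using red q'(2) assms(4) unfolding next_red_def by simp
  ultimately have "r \<approx> q' @ [z]" "q' @ [z] \<approx> r'"
    using next_red_unique[of q q z r] next_red_unique[of q' q' z _ r'] assms(7,8) by simp_all
  then show ?thesis by (rule swaps_trans)
qed

text \<open>If the step from \<open>q\<close> to \<open>z\<close> were a cancellation, the class of
  \<open>p\<close> would contain a path with the corner \<open>w\<close> just before
  \<open>x\<close>, and the class of \<open>q'\<close> would contain the backtrack \<open>w\<close>,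
  \<open>x\<close>, \<open>w\<close>.\<close>

lemma next_red_square_up_up:
  assumes s: "sq x y z w" "last p = x" "p \<noteq> []"
    and q: "next_red p y q" "next_red p w q'" "q \<approx> p @ [y]" "q' \<approx> p @ [w]"
    and r: "next_red q z r"
  shows "r \<approx> p @ [y, z]"
proof -
  have lq: "last q = y" using q(1) unfolding next_red_def by simp
  consider "r \<approx> q @ [z]" | "q \<approx> r @ [y]" using r lq unfolding next_red_def by auto
  then show ?thesis
  proof cases
    case 1
    then show ?thesis using swaps_trans[OF 1 swaps_append[OF q(3), of "[z]"]] by simp
  next
    case 2
    then have "p @ [y] \<approx> r @ [y]" using swaps_trans[OF swaps_sym[OF q(3)]] by simp
    from two_ends[OF this s(3)] have "same_end y p r" .
    moreover have "last r = z" "x \<noteq> z" using r s(1) unfolding next_red_def sq_def by auto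
    ultimately obtain t u where t: "sq y x u z" "p \<approx> t @ [u, x]"
      using s(2) unfolding same_end_def by auto
    have "sq y x w z" using s(1) sq_rot sq_flip by blast
    then have "u = w" using t(1) sq_unique3 by blast
    then have "q' \<approx> t @ [w, x, w]"
      using swaps_trans[OF q(4) swaps_append[OF t(2), of "[w]"]] by simp
    then show ?thesis using not_reduced_swaps_backtrack q(2) unfolding next_red_def by blast
  qed
qed

text \<open>Steps respect squares; together with their uniqueness this is why homotopic paths act
  alike. The four cases are extension or cancellation along the two edges at
  \<open>x\<close>.\<close>

lemma next_red_square:
  assumes s: "sq x y z w" "last p = x"
    and q: "next_red p y q" "next_red p w q'"
    and r: "next_red q z r" "next_red q' z r'"
  shows "r \<approx> r'"
proof -
  have p: "p \<noteq> []" "reduced p" using q(1) unfolding next_red_def by simp_all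
  consider (1) "q \<approx> p @ [y]" "q' \<approx> p @ [w]" | (2) "p \<approx> q @ [x]" "p \<approx> q' @ [x]" |
    (3) "q \<approx> p @ [y]" "p \<approx> q' @ [x]" | (4) "p \<approx> q @ [x]" "q' \<approx> p @ [w]"
    using q s(2) unfolding next_red_def by auto
  then show ?thesis
  proof cases
    case 1
    have "r \<approx> p @ [y, z]" using next_red_square_up_up[OF s p(1) q 1 r(1)] .
    moreover have "r' \<approx> p @ [w, z]"
      using next_red_square_up_up[OF sq_flip[OF s(1)] s(2) p(1) q(2,1) 1(2,1) r(2)] .
    moreover have "p @ [y, z] \<approx> p @ [w, z]"
    proof -
      have "p = butlast p @ [x]" using p s(2) by (metis append_butlast_last_id)
      then show ?thesis using swaps_sq[OF s(1), of "butlast p"]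
        by (metis append.assoc append_Cons append_Nil)
    qed
    ultimately show ?thesis using swaps_trans swaps_sym by metis
  next
    case 2
    have "q @ [x] \<approx> q' @ [x]" using swaps_trans[OF swaps_sym[OF 2(1)] 2(2)] .
    moreover have l: "last q = y" "last q' = w" "q \<noteq> []" using q unfolding next_red_def by simp_all
    ultimately have "same_end x q q'" using two_ends by blast
    moreover have "y \<noteq> w" using s(1) unfolding sq_def by auto
    ultimately obtain t u where t: "sq x y u w" "q \<approx> t @ [u, y]" "q' \<approx> t @ [u, w]"
      using l unfolding same_end_def by auto
    then have u: "u = z" using s(1) sq_unique3 by blast
    have red: "reduced (t @ [z])"
      using reduced_swaps[OF _ t(2)] reduced_prefix[of "t @ [z]" "[y]"] q(1) u
      unfolding next_red_def by simp
    have "next_red q z (t @ [z])" "next_red q' z (t @ [z])"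
      using red q t u l unfolding next_red_def by simp_all
    then show ?thesis using next_red_unique[of q q z r] next_red_unique[of q' q' z _ r'] r
      by (meson rtranclp.rtrancl_refl swaps_trans)
  next
    case 3
    then show ?thesis using next_red_square_up_down[OF s q 3 r] by simp
  next
    case 4
    then show ?thesis
      using next_red_square_up_down[OF sq_flip[OF s(1)] s(2) q(2,1) 4(2,1) r(2,1)] swaps_sym by simp
  qed
qed

text \<open>A chosen representative: the next reduced path is determined only up to swaps, which is
  why its laws are stated with \<open>\<approx>\<close>.\<close>

definition red_step :: "'v list \<Rightarrow> 'v \<Rightarrow> 'v list" where
  "red_step p y = (SOME q. next_red p y q)"

lemma red_step: "reduced p \<Longrightarrow> p \<noteq> [] \<Longrightarrow> next_red p y (red_step p y)"
  unfolding red_step_def by (rule someI_ex) (rule next_red_ex)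

lemma red_step_reduced:
  assumes "reduced p" "p \<noteq> []"
  shows "reduced (red_step p y)" "red_step p y \<noteq> []" "last (red_step p y) = y"
  using red_step[OF assms] unfolding next_red_def by auto

lemma foldl_red_step:
  "reduced p \<Longrightarrow> p \<noteq> [] \<Longrightarrow> reduced (foldl red_step p ys) \<and> foldl red_step p ys \<noteq> [] \<and>
    last (foldl red_step p ys) = last (last p # ys)"
  by (induction ys arbitrary: p) (simp_all add: red_step_reduced)

lemma red_step_cong:
  "p \<approx> p' \<Longrightarrow> reduced p \<Longrightarrow> p \<noteq> [] \<Longrightarrow> p' \<noteq> [] \<Longrightarrow> red_step p y \<approx> red_step p' y"
  using next_red_unique[OF _ red_step red_step] reduced_swaps by blast

lemma foldl_red_step_cong:
  "p \<approx> p' \<Longrightarrow> reduced p \<Longrightarrow> p \<noteq> [] \<Longrightarrow> p' \<noteq> [] \<Longrightarrow> foldl red_step p ys \<approx> foldl red_step p' ys"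
proof (induction ys arbitrary: p p')
  case (Cons y ys)
  have "reduced p'" using reduced_swaps Cons.prems by blast
  then show ?case
    using Cons.IH[OF red_step_cong[OF Cons.prems, of y]] Cons.prems red_step_reduced by simp
qed simp

lemma red_step_back:
  assumes "reduced p" "p \<noteq> []" shows "red_step (red_step p y) (last p) \<approx> p"
  using next_red_unique[OF _ red_step next_red_sym[OF red_step[OF assms]]] red_step_reduced[OF assms]
  by blast

text \<open>The path acts on the trivial path at its starting point. The result is reduced and, up
  to swaps, an invariant of the homotopy class.\<close>

definition nform :: "'v list \<Rightarrow> 'v list" where
  "nform p = foldl red_step [hd p] (tl p)"

lemma nform_append: "p \<noteq> [] \<Longrightarrow> nform (p @ q) = foldl red_step (nform p) q"
  by (simp add: nform_def)

lemma nform_reduced: "reduced (nform p)" "nform p \<noteq> []" "p \<noteq> [] \<Longrightarrow> last (nform p) = last p"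
  using foldl_red_step[OF reduced_single, of "hd p" "tl p"] by (auto simp: nform_def)

text \<open>Backtracks act trivially by \<open>red_step_back\<close>, and the two sides of a square
  act alike by \<open>next_red_square\<close>. The alternative \<open>p = q\<close> covers the empty
  list, which is homotopic to itself.\<close>

lemma nform_homotopic:
  "homotopic_edge_paths X p q \<Longrightarrow> p = q \<or> p \<noteq> [] \<and> q \<noteq> [] \<and> hd p = hd q \<and> nform p \<approx> nform q"
proof (induction rule: homotopic_edge_paths.induct)
  case (sym p q)
  then show ?case using swaps_sym by auto
next
  case (trans p q r)
  then show ?case using swaps_trans by auto
next
  case (backtrack x y p q)
  let ?P = "nform (p @ [x])"
  have P: "reduced ?P" "?P \<noteq> []" "last ?P = x" using nform_reduced[of "p @ [x]"] by simp_all
  have "red_step (red_step ?P y) x \<approx> ?P" using red_step_back[OF P(1,2)] P(3) by simp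
  then have "foldl red_step (red_step (red_step ?P y) x) q \<approx> foldl red_step ?P q"
    by (rule foldl_red_step_cong) (simp_all add: P red_step_reduced)
  then have "nform (p @ [x, y, x] @ q) \<approx> nform (p @ [x] @ q)"
    using nform_append[of "p @ [x]" "y # x # q"] nform_append[of "p @ [x]" q] by simp
  then show ?case by (cases p) auto
next
  case (square x y z w p q)
  then have s: "sq x y z w" by (simp add: sq_def)
  let ?P = "nform (p @ [x])"
  have P: "reduced ?P" "?P \<noteq> []" "last ?P = x" using nform_reduced[of "p @ [x]"] by simp_all
  have "red_step (red_step ?P y) z \<approx> red_step (red_step ?P w) z"
    by (rule next_red_square[OF s P(3) red_step[OF P(1,2)] red_step[OF P(1,2)]
          red_step[OF red_step_reduced(1,2)[OF P(1,2)]] red_step[OF red_step_reduced(1,2)[OF P(1,2)]]])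
  then have "foldl red_step (red_step (red_step ?P y) z) q \<approx>
      foldl red_step (red_step (red_step ?P w) z) q"
    by (rule foldl_red_step_cong) (simp_all add: P red_step_reduced)
  then have "nform (p @ [x, y, z] @ q) \<approx> nform (p @ [x, w, z] @ q)"
    using nform_append[of "p @ [x]" "y # z # q"] nform_append[of "p @ [x]" "w # z # q"] by simp
  then show ?case by (cases p) auto
qed simp

text \<open>Going along \<open>ys\<close> and back undoes the action. The reversed list begins with
  the turning point, where the action already is, and \<open>tl\<close> removes it.\<close>

lemma foldl_red_step_rev:
  "reduced p \<Longrightarrow> p \<noteq> [] \<Longrightarrow> foldl red_step (foldl red_step p ys) (tl (rev (last p # ys))) \<approx> p"
proof (induction ys arbitrary: p)
  case (Cons y ys)
  let ?q = "red_step p y"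
  have q: "reduced ?q" "?q \<noteq> []" "last ?q = y" using red_step_reduced Cons.prems by blast+
  let ?r = "foldl red_step (foldl red_step ?q ys) (tl (rev (y # ys)))"
  have "?r \<approx> ?q" using Cons.IH[OF q(1,2)] q(3) by simp
  moreover have "reduced ?r" "?r \<noteq> []"
    using foldl_red_step q by (metis)+
  ultimately have "red_step ?r (last p) \<approx> red_step ?q (last p)"
    using red_step_cong q by blast
  also have "red_step ?q (last p) \<approx> p" using red_step_back Cons.prems by blast
  finally have "red_step ?r (last p) \<approx> p" .
  moreover have "tl (rev (last p # y # ys)) = tl (rev (y # ys)) @ [last p]"
    by (cases "rev ys") auto
  ultimately show ?case by simp
qed simp

text \<open>Along a reduced path appending is a valid step, and steps are unique; so nothing is
  cancelled.\<close>

lemma nform_self: "reduced p \<Longrightarrow> p \<noteq> [] \<Longrightarrow> nform p \<approx> p"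
proof (induction p rule: rev_induct)
  case (snoc y p)
  show ?case
  proof (cases "p = []")
    case True
    then show ?thesis by (simp add: nform_def)
  next
    case False
    have r: "reduced p" using snoc.prems reduced_prefix by blast
    have "next_red p y (p @ [y])" using snoc.prems r False unfolding next_red_def by simp
    moreover have "nform p \<approx> p" using snoc.IH r False by blast
    moreover have "next_red (nform p) y (red_step (nform p) y)" using red_step nform_reduced by blast
    ultimately have "red_step (nform p) y \<approx> p @ [y]" using next_red_unique by blast
    then show ?thesis using nform_append[OF False, of "[y]"] by simp
  qed
qed simp

text \<open>The closed path \<open>p\<close> followed by the reverse of \<open>q\<close> is
  null-homotopic and acts trivially on the starting point. Acting with \<open>q\<close> afterwards
  gives \<open>nform q\<close> on the one hand and, as it undoes the reverse of \<open>q\<close>,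
  \<open>nform p\<close> on the other.\<close>

theorem reduced_paths_swaps:
  assumes p: "is_path p" "reduced p" and q: "is_path q" "reduced q"
    and e: "hd p = hd q" "last p = last q"
  shows "p \<approx> q"
proof -
  have ne: "p \<noteq> []" "q \<noteq> []" using p q by (auto simp: is_path_def)
  let ?r = "tl (rev q)"
  have rq: "rev q = last p # ?r" using ne e by (metis hd_rev list.collapse rev_is_Nil_conv)
  have "successively (adj X) (rev q)"
    using q(1) unfolding is_path_def successively_rev by (auto elim: successively_mono simp: adj_sym_iff)
  then have sr: "successively (adj X) (last p # ?r)" "set ?r \<subseteq> verts X"
    using rq q(1) unfolding is_path_def by (metis, metis set_rev list.set_intros(2) subset_iff)
  have path: "is_path (p @ ?r)"
    using p(1) sr unfolding is_path_def by (auto simp: successively_append_iff successively_Cons)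
  have "last (p @ ?r) = last (rev q)" using rq by (metis last_append last_ConsL last_ConsR)
  then have cl: "hd (p @ ?r) = last (p @ ?r)" using ne e by (simp add: last_rev)
  then have h: "homotopic_edge_paths X (p @ ?r) [hd p]" using closed_null[OF path] ne by simp
  have 1: "foldl red_step (nform p) ?r \<approx> [hd p]"
    using nform_homotopic[OF h] nform_append[OF ne(1), of ?r] by (auto simp: nform_def)
  let ?s = "foldl red_step (nform p) ?r"
  have s: "reduced ?s" "?s \<noteq> []" using foldl_red_step nform_reduced by blast+
  have "tl (rev (last (nform p) # ?r)) = tl q" using nform_reduced(3)[OF ne(1)] rq by (metis rev_rev_ident)
  then have "foldl red_step ?s (tl q) \<approx> nform p"
    using foldl_red_step_rev[OF nform_reduced(1,2), of p ?r] by simp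
  moreover have "foldl red_step ?s (tl q) \<approx> nform q"
    using foldl_red_step_cong[OF 1 s, of "tl q"] e by (simp add: nform_def)
  ultimately have "nform p \<approx> nform q" using swaps_trans swaps_sym by metis
  then show ?thesis using nform_self p q ne swaps_trans swaps_sym by metis
qed

end

section \<open>Hyperplanes, half-spaces and axes\<close>

definition hyp :: "'v cubical \<Rightarrow> 'v set \<Rightarrow> 'v set set" where
  "hyp X e = {f. (opposite_edges X)\<^sup>*\<^sup>* e f}"

definition side :: "'v cubical \<Rightarrow> 'v set \<Rightarrow> 'v \<Rightarrow> 'v set" where
  "side X e v = {w. (\<lambda>x y. adj X x y \<and> {x, y} \<notin> hyp X e)\<^sup>*\<^sup>* v w}"

lemma opposite_edges_sym: "opposite_edges X e f \<Longrightarrow> opposite_edges X f e"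
  by (simp add: opposite_edges_def Int_commute Un_commute)

lemma hyp_sym: "f \<in> hyp X e \<Longrightarrow> e \<in> hyp X f"
proof -
  have "symp (opposite_edges X)" by (rule sympI) (rule opposite_edges_sym)
  then have "symp (opposite_edges X)\<^sup>*\<^sup>*" by (rule symp_rtranclp)
  then show "f \<in> hyp X e \<Longrightarrow> e \<in> hyp X f" unfolding hyp_def by (simp add: sympD)
qed

lemma hyp_trans: "f \<in> hyp X e \<Longrightarrow> g \<in> hyp X f \<Longrightarrow> g \<in> hyp X e"
  unfolding hyp_def by simp

lemma hyp_eq: "f \<in> hyp X e \<Longrightarrow> hyp X f = hyp X e"
  using hyp_sym hyp_trans by blast

lemma hyp_self: "e \<in> hyp X e"
  unfolding hyp_def by simp

lemma hyperplanes_eq: "hyperplanes X = hyp X ` edges X"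
  unfolding hyperplanes_def hyp_def by blast

lemma side_step: "x \<in> side X e v \<Longrightarrow> adj X x y \<Longrightarrow> {x, y} \<notin> hyp X e \<Longrightarrow> y \<in> side X e v"
  unfolding side_def by (simp add: rtranclp.rtrancl_into_rtrancl)

lemma side_self: "v \<in> side X e v"
  unfolding side_def by simp

lemma side_eq: "w \<in> side X e v \<Longrightarrow> side X e w = side X e v"
proof -
  assume w: "w \<in> side X e v"
  let ?R = "\<lambda>x y. adj X x y \<and> {x, y} \<notin> hyp X e"
  have "symp ?R" by (rule sympI) (simp add: adj_sym insert_commute)
  then have "symp ?R\<^sup>*\<^sup>*" by (rule symp_rtranclp)
  then have "?R\<^sup>*\<^sup>* w v" "?R\<^sup>*\<^sup>* v w" using w unfolding side_def by (auto dest: sympD)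
  then show ?thesis unfolding side_def by (auto intro: rtranclp_trans)
qed

lemma side_halfspace: "e \<in> edges X \<Longrightarrow> v \<in> verts X \<Longrightarrow> side X e v \<in> halfspaces X"
  unfolding halfspaces_def hyperplanes_eq side_def by blast

lemma halfspace_side:
  assumes "H \<in> halfspaces X" obtains e v where "e \<in> edges X" "v \<in> verts X" "H = side X e v"
  using assms unfolding halfspaces_def hyperplanes_eq side_def by blast

text \<open>Only an edge of the bounding hyperplane can leave a half-space, so any such edge
  determines the hyperplane and, with its inner end, the half-space.\<close>

lemma halfspace_unique:
  assumes "H \<in> halfspaces X" "adj X x y" "x \<notin> H" "y \<in> H"
  shows "H = side X {x, y} y"
proof -
  obtain e v where e: "H = side X e v" using assms(1) by (rule halfspace_side)
  have "{x, y} \<in> hyp X e"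
  proof (rule ccontr)
    assume "{x, y} \<notin> hyp X e"
    then have "x \<in> H" using side_step[of y X e v x] assms e adj_sym[of X x y]
      by (simp add: insert_commute)
    then show False using assms by blast
  qed
  then have "hyp X {x, y} = hyp X e" by (rule hyp_eq)
  moreover have "side X e y = H" using side_eq[of y X e v] assms(4) e by simp
  ultimately show ?thesis unfolding side_def by simp
qed

lemma successively_crossing:
  "successively R p \<Longrightarrow> p \<noteq> [] \<Longrightarrow> hd p \<notin> H \<Longrightarrow> last p \<in> H \<Longrightarrow>
    \<exists>u\<in>set p. \<exists>w\<in>set p. R u w \<and> u \<notin> H \<and> w \<in> H"
proof (induction p rule: induct_list012)
  case (3 x y zs)
  then show ?case by (cases "y \<in> H") auto
qed auto

text \<open>An automorphism together with its inverse. The relation is symmetric, so an inclusion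
  proved for \<open>t\<close> is available for \<open>s\<close> and can be turned into an
  equality.\<close>

definition auto_pair :: "'v cubical \<Rightarrow> ('v \<Rightarrow> 'v) \<Rightarrow> ('v \<Rightarrow> 'v) \<Rightarrow> bool" where
  "auto_pair X t s \<longleftrightarrow>
     (\<forall>x\<in>verts X. t x \<in> verts X \<and> s x \<in> verts X \<and> t (s x) = x \<and> s (t x) = x) \<and>
     (\<forall>C\<in>cubes X. t ` C \<in> cubes X \<and> s ` C \<in> cubes X)"

lemma auto_pair_sym: "auto_pair X t s \<Longrightarrow> auto_pair X s t"
  unfolding auto_pair_def by blast

lemma int_crossing:
  assumes "a \<le> (b::int)" "\<not> P a" "P b" obtains m where "\<not> P m" "P (m + 1)"
proof -
  have "\<exists>m. \<not> P m \<and> P (m + 1)"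
  proof (rule ccontr)
    assume n: "\<nexists>m. \<not> P m \<and> P (m + 1)"
    have "\<not> P b" using assms(1)
    proof (induction rule: int_ge_induct)
      case (step i)
      then show ?case using n by blast
    qed (use assms in simp)
    then show False using assms by blast
  qed
  then show ?thesis using that by blast
qed

context cat0
begin

lemma geodesic_reduced:
  assumes "is_path p" "length p = Suc (cdist X (hd p) (last p))"
  shows "reduced p"
  unfolding reduced_def
proof (intro allI impI notI)
  fix q assume q: "p \<approx> q" and "\<exists>a x y b. q = a @ [x, y, x] @ b"
  then obtain a x y b where e: "q = a @ [x, y, x] @ b" by blast
  let ?r = "a @ [x] @ b"
  have "is_path ?r"
    using swaps_inv(4)[OF q assms(1)] e
    by (auto simp: is_path_def successively_append_iff successively_Cons)
  from dist_le[OF this] have "cdist X (hd ?r) (last ?r) < length ?r" .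
  moreover have "hd ?r = hd p" using swaps_inv(2)[OF q] e by (cases a) auto
  moreover have "last ?r = last p" using swaps_inv(3)[OF q] e by auto
  moreover have "length p = length ?r + 2" using swaps_inv(1)[OF q] e by simp
  ultimately show False using assms(2) by simp
qed

text \<open>Geodesics to \<open>x\<close> and \<open>y\<close> both extend to geodesics to
  \<open>z\<close>. Geodesics are reduced, so the extensions are swap equivalent, and comparing
  their last edges gives the square. Its corner \<open>u\<close> is the last but one vertex of a
  geodesic to \<open>x\<close>.\<close>

lemma quadrangle:
  assumes v: "v \<in> verts X" and xy: "adj X x z" "adj X y z" "x \<noteq> y"
    and d: "cdist X v z = Suc (cdist X v x)" "cdist X v y = cdist X v x"
  obtains u where "sq z x u y" "cdist X v u < cdist X v x"
proof -
  obtain p where p: "is_path p" "hd p = v" "last p = x" "length p = Suc (cdist X v x)"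
    using dist_path[of v x] v xy adj_verts by blast
  obtain q where q: "is_path q" "hd q = v" "last q = y" "length q = Suc (cdist X v y)"
    using dist_path[of v y] v xy adj_verts by blast
  have ne: "p \<noteq> []" "q \<noteq> []" using p q by (auto simp: is_path_def)
  have pz: "is_path (p @ [z])" "is_path (q @ [z])" using is_path_snoc p q xy by auto
  then have "reduced (p @ [z])" "reduced (q @ [z])"
    using geodesic_reduced p q d ne by auto
  then have "p @ [z] \<approx> q @ [z]"
    using reduced_paths_swaps[OF pz(1) _ pz(2)] p q ne by simp
  then have "same_end z p q" using two_ends ne by blast
  then obtain s u where su: "sq z x u y" "p \<approx> s @ [u, x]"
    using p q xy unfolding same_end_def by auto
  have l: "length (s @ [u]) = cdist X v x" using swaps_inv(1)[OF su(2)] p by simp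
  have "hd (s @ [u]) = v" using swaps_inv(2)[OF su(2)] p by (cases s) auto
  moreover have "is_path (s @ [u])"
    using swaps_inv(4)[OF su(2) p(1)] by (auto simp: is_path_def successively_append_iff)
  ultimately have "cdist X v u < cdist X v x" using dist_le[of "s @ [u]"] l by simp
  then show ?thesis using that su(1) by blast
qed

text \<open>Otherwise the distances from \<open>v\<close> alternate around the square between two
  values, with \<open>y\<close> and \<open>w\<close> as the far corners. The quadrangle condition at
  \<open>y\<close> gives a square whose fourth corner is nearer to \<open>v\<close>; by uniqueness
  this corner is \<open>w\<close>.\<close>

lemma sq_dist_aux:
  assumes v: "v \<in> verts X" and s: "sq x y z w" and l: "cdist X v x < cdist X v y"
  shows "cdist X v w < cdist X v z"
proof (rule ccontr)
  assume n: "\<not> cdist X v w < cdist X v z"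
  have a: "adj X x y" "adj X z y" "adj X z w" "adj X w x" "x \<noteq> z"
    using s by (auto simp: sq_def intro: adj_sym)
  have 1: "cdist X v y = Suc (cdist X v x)" "cdist X v z = cdist X v x"
      "cdist X v w = Suc (cdist X v x)"
    using dist_adj_cases[OF v a(1)] dist_adj_cases[OF v a(2)] dist_adj_cases[OF v a(3)]
      dist_adj_cases[OF v a(4)] l n by linarith+
  obtain u where u: "sq y x u z" "cdist X v u < cdist X v x"
    using quadrangle[OF v a(1,2,5) 1(1,2)] .
  have "sq y x w z" using s sq_rot sq_flip by blast
  then have "u = w" using u(1) sq_unique3 by blast
  then show False using u 1 by simp
qed

lemma sq_dist:
  assumes v: "v \<in> verts X" and s: "sq x y z w"
  shows "cdist X v x < cdist X v y \<longleftrightarrow> cdist X v w < cdist X v z"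
proof -
  have "sq w z y x" using s sq_rot sq_flip by blast
  then show ?thesis using sq_dist_aux[OF v] s by blast
qed

text \<open>\<open>sq_dist\<close> carries the orientation of an edge across a square. The same
  labelling of the ends of \<open>f\<close> serves all vertices \<open>v\<close>, so different
  observers can be played off against each other.\<close>

lemma hyp_oriented:
  assumes "f \<in> hyp X {x, y}"
  obtains x' y' where "f = {x', y'}"
    "\<And>v. v \<in> verts X \<Longrightarrow> cdist X v x < cdist X v y \<longleftrightarrow> cdist X v x' < cdist X v y'"
proof -
  have "(opposite_edges X)\<^sup>*\<^sup>* {x, y} f" using assms by (simp add: hyp_def)
  then have "\<exists>x' y'. f = {x', y'} \<and>
    (\<forall>v\<in>verts X. cdist X v x < cdist X v y \<longleftrightarrow> cdist X v x' < cdist X v y')"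
  proof (induction rule: rtranclp_induct)
    case base
    then show ?case by blast
  next
    case (step f f')
    then obtain x' y' where xy: "f = {x', y'}"
      "\<forall>v\<in>verts X. cdist X v x < cdist X v y \<longleftrightarrow> cdist X v x' < cdist X v y'" by blast
    obtain x'' y'' where s: "f' = {x'', y''}" "sq x' y' y'' x''"
      using opposite_edges_sq step(2) xy(1) by blast
    then show ?case using xy sq_dist[OF _ s(2)] by (intro exI[of _ x''] exI[of _ y'']) simp
  qed
  then show ?thesis using that by blast
qed

text \<open>A path from \<open>y\<close> to \<open>x\<close> that avoids the hyperplane, preceded by
  the edge itself, would be a closed path that crosses the hyperplane exactly once, against
  parity.\<close>

lemma side_separates:
  assumes "adj X x y" shows "x \<notin> side X {x, y} y"
proof
  assume "x \<in> side X {x, y} y"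
  let ?R = "\<lambda>u w. adj X u w \<and> {u, w} \<notin> hyp X {x, y}"
  have "?R\<^sup>*\<^sup>* y x" using \<open>x \<in> side X {x, y} y\<close> by (simp add: side_def)
  then obtain n where "(?R ^^ n) y x" using rtranclp_imp_relpowp by fast
  then obtain p where p: "hd p = y" "last p = x" "length p = Suc n" "successively ?R p"
    unfolding relpowp_iff_list by blast
  obtain q where q: "p = y # q" using p by (cases p) auto
  have sa: "successively (adj X) p" using p(4) by (rule successively_mono) simp
  have path: "is_path (x # p)"
    using sa p(1) q assms adj_verts[OF assms] successively_verts[OF sa] by (auto simp: is_path_def)
  have "even (crossings (hyp X {x, y}) (x # p))"
  proof (rule closed_even[OF path])
    show "hd (x # p) = last (x # p)" using p q by simp
    fix a b c d assume "sq a b c d"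
    then have "opposite_edges X {a, b} {c, d}" by (rule sq_opposite)
    then show "{a, b} \<in> hyp X {x, y} \<longleftrightarrow> {c, d} \<in> hyp X {x, y}"
      unfolding hyp_def using opposite_edges_sym[of X "{a, b}" "{c, d}"]
      by (auto intro: rtranclp.rtrancl_into_rtrancl)
  qed
  moreover have "crossings (hyp X {x, y}) p = 0"
    using p(4) by (intro crossings_0) (auto elim: successively_mono)
  ultimately show False using q hyp_self[of "{x, y}" X] by simp
qed

lemma side_verts: "v \<in> verts X \<Longrightarrow> side X e v \<subseteq> verts X"
proof
  fix w assume "v \<in> verts X" "w \<in> side X e v"
  then have "(\<lambda>x y. adj X x y \<and> {x, y} \<notin> hyp X e)\<^sup>*\<^sup>* v w" "v \<in> verts X" by (auto simp: side_def)
  then show "w \<in> verts X" by (induction rule: rtranclp_induct) (auto dest: adj_verts)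
qed

text \<open>Fix one path from \<open>x\<close> to \<open>y\<close>. Every such half-space is entered
  by one of its edges and determined by it.\<close>

lemma finite_separating:
  assumes "x \<in> verts X" "y \<in> verts X"
  shows "finite {H \<in> halfspaces X. x \<notin> H \<and> y \<in> H}"
proof -
  obtain p where p: "is_path p" "hd p = x" "last p = y" using dist_path[OF assms] by blast
  have "{H \<in> halfspaces X. x \<notin> H \<and> y \<in> H} \<subseteq> (\<lambda>(u, w). side X {u, w} w) ` (set p \<times> set p)"
  proof
    fix H assume "H \<in> {H \<in> halfspaces X. x \<notin> H \<and> y \<in> H}"
    then have H: "H \<in> halfspaces X" "x \<notin> H" "y \<in> H" by auto
    obtain u w where "u \<in> set p" "w \<in> set p" "adj X u w" "u \<notin> H" "w \<in> H"
      using successively_crossing[of "adj X" p H] p H unfolding is_path_def by blast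
    then show "H \<in> (\<lambda>(u, w). side X {u, w} w) ` (set p \<times> set p)"
      using halfspace_unique[OF H(1)] by (intro image_eqI[of _ _ "(u, w)"]) auto
  qed
  then show ?thesis by (rule finite_subset) simp
qed

section \<open>Automorphisms acting on hyperplanes and half-spaces\<close>

lemma auto_adj:
  assumes "auto_pair X t s" "adj X x y" shows "adj X (t x) (t y)"
proof -
  have "t ` {x, y} \<in> cubes X" using assms by (auto simp: auto_pair_def adj_def edges_def)
  moreover have "t x \<noteq> t y" using assms adj_verts[OF assms(2)] adj_neq[OF assms(2)]
    unfolding auto_pair_def by metis
  ultimately show ?thesis by (simp add: adj_def edges_def)
qed

lemma auto_edge:
  assumes "auto_pair X t s" "e \<in> edges X" shows "t ` e \<in> edges X" "s ` t ` e = e"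
proof -
  obtain x y where e: "e = {x, y}" using assms(2) by (auto simp: edges_def card_2_iff)
  have a: "adj X x y" using assms(2) e by (simp add: adj_def)
  show "t ` e \<in> edges X" using auto_adj[OF assms(1) a] e by (simp add: adj_def)
  show "s ` t ` e = e" using assms(1) adj_verts[OF a] e by (simp add: auto_pair_def)
qed

lemma auto_opposite:
  assumes "auto_pair X t s" "opposite_edges X e f" shows "opposite_edges X (t ` e) (t ` f)"
proof -
  have ef: "e \<in> edges X" "f \<in> edges X" "e \<inter> f = {}" "e \<union> f \<in> cubes X"
    using assms by (auto simp: opposite_edges_def)
  have "inj_on t (verts X)" using assms(1) unfolding auto_pair_def by (metis inj_onI)
  moreover have "e \<subseteq> verts X" "f \<subseteq> verts X" using cubes_verts ef by (auto simp: edges_def)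
  ultimately have "t ` e \<inter> t ` f = {}" using ef(3) by (metis image_empty inj_on_image_Int)
  moreover have "t ` e \<union> t ` f \<in> cubes X" using assms(1) ef(4) by (metis auto_pair_def image_Un)
  ultimately show ?thesis using auto_edge[OF assms(1)] ef by (simp add: opposite_edges_def)
qed

lemma auto_hyp:
  assumes "auto_pair X t s" "f \<in> hyp X e" shows "t ` f \<in> hyp X (t ` e)"
proof -
  have "(opposite_edges X)\<^sup>*\<^sup>* e f" using assms by (simp add: hyp_def)
  then have "(opposite_edges X)\<^sup>*\<^sup>* (t ` e) (t ` f)"
    by (induction rule: rtranclp_induct) (auto intro: rtranclp.rtrancl_into_rtrancl auto_opposite[OF assms(1)])
  then show ?thesis by (simp add: hyp_def)
qed

lemma auto_side_subset:
  assumes t: "auto_pair X t s" and e: "e \<in> edges X"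
  shows "t ` side X e v \<subseteq> side X (t ` e) (t v)"
proof
  fix w' assume "w' \<in> t ` side X e v"
  then obtain w where w: "w' = t w" "(\<lambda>x y. adj X x y \<and> {x, y} \<notin> hyp X e)\<^sup>*\<^sup>* v w"
    by (auto simp: side_def)
  from w(2) have "t w \<in> side X (t ` e) (t v)"
  proof (induction rule: rtranclp_induct)
    case (step u w)
    have a: "adj X (t u) (t w)" using auto_adj t step by blast
    have "{t u, t w} \<notin> hyp X (t ` e)"
    proof
      assume "{t u, t w} \<in> hyp X (t ` e)"
      from auto_hyp[OF auto_pair_sym[OF t] this] have "s ` t ` {u, w} \<in> hyp X e"
        using auto_edge(2)[OF t e] by simp
      moreover have "s ` t ` {u, w} = {u, w}"
        using auto_edge(2)[OF t, of "{u, w}"] step by (simp add: adj_def)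
      ultimately show False using step by simp
    qed
    then show ?case by (rule side_step[OF step.IH a])
  qed (rule side_self)
  then show "w' \<in> side X (t ` e) (t v)" using w by simp
qed

lemma auto_side:
  assumes t: "auto_pair X t s" and e: "e \<in> edges X" and v: "v \<in> verts X"
  shows "t ` side X e v = side X (t ` e) (t v)"
proof
  show "t ` side X e v \<subseteq> side X (t ` e) (t v)" using auto_side_subset[OF t e] .
  have "s ` side X (t ` e) (t v) \<subseteq> side X e v"
    using auto_side_subset[OF auto_pair_sym[OF t] auto_edge(1)[OF t e], of "t v"]
      auto_edge(2)[OF t e] t v unfolding auto_pair_def by auto
  moreover have "side X (t ` e) (t v) \<subseteq> verts X" using side_verts t v by (auto simp: auto_pair_def)
  ultimately have "s w \<in> side X e v \<and> t (s w) = w" if "w \<in> side X (t ` e) (t v)" for w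
    using that t unfolding auto_pair_def by auto
  then show "side X (t ` e) (t v) \<subseteq> t ` side X e v" by (metis imageI subsetI)
qed

section \<open>Half-spaces crossed by bi-infinite geodesics\<close>

definition bi_geodesic :: "(int \<Rightarrow> 'v) \<Rightarrow> bool" where
  "bi_geodesic \<gamma> \<longleftrightarrow> (\<forall>n. \<gamma> n \<in> verts X) \<and> (\<forall>m n. int (cdist X (\<gamma> m) (\<gamma> n)) = \<bar>m - n\<bar>)"

definition axis_hs :: "(int \<Rightarrow> 'v) \<Rightarrow> int \<Rightarrow> 'v set" where
  "axis_hs \<gamma> n = side X {\<gamma> n, \<gamma> (n + 1)} (\<gamma> (n + 1))"

lemma bi_geodesic_adj:
  assumes "bi_geodesic \<gamma>" shows "adj X (\<gamma> n) (\<gamma> (n + 1))"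
proof -
  have d: "int (cdist X (\<gamma> n) (\<gamma> (n + 1))) = \<bar>n - (n + 1)\<bar>"
    using assms unfolding bi_geodesic_def by blast
  obtain p where p: "is_path p" "hd p = \<gamma> n" "last p = \<gamma> (n + 1)"
      "length p = Suc (cdist X (\<gamma> n) (\<gamma> (n + 1)))"
    using dist_path assms unfolding bi_geodesic_def by blast
  from p(4) d have "length p = Suc (Suc 0)" by simp
  then obtain a b where "p = [a, b]" by (metis length_0_conv length_Suc_conv)
  then show ?thesis using p by (simp add: is_path_def)
qed

text \<open>Seen from \<open>\<gamma> n\<close> both edges point forwards along \<gamma>. Seen from
  \<open>\<gamma> (n + 1)\<close> the first one points backwards and the second one still forwards,
  so they cannot be oriented alike for both observers.\<close>

lemma bi_geodesic_hyp:
  assumes g: "bi_geodesic \<gamma>" and "n < m"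
  shows "{\<gamma> m, \<gamma> (m + 1)} \<notin> hyp X {\<gamma> n, \<gamma> (n + 1)}"
proof
  assume "{\<gamma> m, \<gamma> (m + 1)} \<in> hyp X {\<gamma> n, \<gamma> (n + 1)}"
  then obtain x y where xy: "{\<gamma> m, \<gamma> (m + 1)} = {x, y}"
    "\<And>v. v \<in> verts X \<Longrightarrow>
      cdist X v (\<gamma> n) < cdist X v (\<gamma> (n + 1)) \<longleftrightarrow> cdist X v x < cdist X v y"
    by (rule hyp_oriented) auto
  have d: "int (cdist X (\<gamma> a) (\<gamma> b)) = \<bar>a - b\<bar>" for a b
    using g by (simp add: bi_geodesic_def)
  have v: "\<gamma> a \<in> verts X" for a using g by (simp add: bi_geodesic_def)
  have "x = \<gamma> m \<and> y = \<gamma> (m + 1) \<or> x = \<gamma> (m + 1) \<and> y = \<gamma> m"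
    using xy(1) by (metis doubleton_eq_iff)
  then show False
    using xy(2)[OF v[of n]] xy(2)[OF v[of "n + 1"]] d[of n m] d[of n "m + 1"] d[of n n]
      d[of n "n + 1"] d[of "n + 1" n] d[of "n + 1" "n + 1"] d[of "n + 1" m] d[of "n + 1" "m + 1"]
      \<open>n < m\<close> by auto
qed

lemma bi_geodesic_hyp':
  assumes g: "bi_geodesic \<gamma>" and "m \<noteq> n"
  shows "{\<gamma> m, \<gamma> (m + 1)} \<notin> hyp X {\<gamma> n, \<gamma> (n + 1)}"
  using bi_geodesic_hyp[OF g, of n m] bi_geodesic_hyp[OF g, of m n] hyp_sym assms(2)
  by (metis linorder_less_linear)

lemma axis_hs_mem:
  assumes g: "bi_geodesic \<gamma>" shows "\<gamma> m \<in> axis_hs \<gamma> n \<longleftrightarrow> n < m"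
proof -
  have adv: "\<gamma> (k + 1) \<in> axis_hs \<gamma> n" if "\<gamma> k \<in> axis_hs \<gamma> n" "k \<noteq> n" for k
    using side_step[OF that(1)[unfolded axis_hs_def] bi_geodesic_adj[OF g]
        bi_geodesic_hyp'[OF g that(2)]] unfolding axis_hs_def .
  show ?thesis
  proof
    assume "n < m"
    then have "n + 1 \<le> m" by simp
    then show "\<gamma> m \<in> axis_hs \<gamma> n"
    proof (induction rule: int_ge_induct)
      case base
      then show ?case by (simp add: axis_hs_def side_self)
    qed (use adv in auto)
  next
    assume m: "\<gamma> m \<in> axis_hs \<gamma> n"
    show "n < m"
    proof (rule ccontr)
      assume "\<not> n < m"
      then have "m \<le> n" by simp
      moreover have "k \<le> n \<Longrightarrow> \<gamma> k \<in> axis_hs \<gamma> n" if "m \<le> k" for k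
        using that
      proof (induction rule: int_ge_induct)
        case (step i)
        then show ?case using adv[of i] by auto
      qed (use m in auto)
      ultimately have "\<gamma> n \<in> axis_hs \<gamma> n" by blast
      then show False using side_separates[OF bi_geodesic_adj[OF g]] by (simp add: axis_hs_def)
    qed
  qed
qed

lemma axis_hs_halfspace: "bi_geodesic \<gamma> \<Longrightarrow> axis_hs \<gamma> n \<in> halfspaces X"
  unfolding axis_hs_def using bi_geodesic_adj[of \<gamma> n]
  by (intro side_halfspace) (simp_all add: adj_def bi_geodesic_def)

lemma axis_hs_unique:
  assumes "bi_geodesic \<gamma>" "H \<in> halfspaces X" "\<gamma> n \<notin> H" "\<gamma> (n + 1) \<in> H"
  shows "H = axis_hs \<gamma> n"
  using halfspace_unique[OF assms(2) bi_geodesic_adj[OF assms(1)] assms(3,4)] by (simp add: axis_hs_def)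

lemma axis_hs_verts: "bi_geodesic \<gamma> \<Longrightarrow> axis_hs \<gamma> n \<subseteq> verts X"
  unfolding axis_hs_def by (rule side_verts) (simp add: bi_geodesic_def)

lemma axis_hs_shift:
  assumes g: "bi_geodesic \<gamma>" and t: "auto_pair X t s" and l: "\<And>n. t (\<gamma> n) = \<gamma> (n + l)"
  shows "t ` axis_hs \<gamma> n = axis_hs \<gamma> (n + l)"
proof -
  have "t ` axis_hs \<gamma> n = side X (t ` {\<gamma> n, \<gamma> (n + 1)}) (t (\<gamma> (n + 1)))"
    unfolding axis_hs_def using bi_geodesic_adj[OF g] g
    by (intro auto_side[OF t]) (simp_all add: adj_def bi_geodesic_def)
  then show ?thesis by (simp add: axis_hs_def l add.commute add.left_commute)
qed

lemma axis_hs_translate: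
  assumes g: "bi_geodesic \<gamma>" "bi_geodesic \<gamma>'" and t: "auto_pair X t s"
    and l: "\<And>n. t (\<gamma> n) = \<gamma> (n + l)" "\<And>n. t (\<gamma>' n) = \<gamma>' (n + l)"
  shows "\<gamma> (m + j * l) \<in> axis_hs \<gamma>' (n + j * l) \<longleftrightarrow> \<gamma> m \<in> axis_hs \<gamma>' n"
proof -
  have inj: "inj_on t (verts X)" using t unfolding auto_pair_def by (metis inj_onI)
  have 1: "\<gamma> (m + l) \<in> axis_hs \<gamma>' (n + l) \<longleftrightarrow> \<gamma> m \<in> axis_hs \<gamma>' n" for m n
    using inj_on_image_mem_iff[OF inj, of "\<gamma> m" "axis_hs \<gamma>' n"] axis_hs_verts[OF g(2)] g(1)
      axis_hs_shift[OF g(2) t l(2)] l(1) by (simp add: bi_geodesic_def)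
  show ?thesis
  proof (induction j rule: int_induct[of _ 0])
    case (step1 i)
    then show ?case using 1[of "m + i * l" "n + i * l"] by (simp add: algebra_simps)
  next
    case (step2 i)
    then show ?case using 1[of "m + (i - 1) * l" "n + (i - 1) * l"] by (simp add: algebra_simps)
  qed simp
qed

text \<open>Only finitely many of the translates \<open>K j\<close> separate
  \<open>\<gamma> 0\<close> from \<open>\<gamma>' 0\<close>. As \<open>\<gamma>' 0\<close> is in
  \<open>K j\<close> for very negative \<open>j\<close> and outside for large \<open>j\<close>, the
  point \<open>\<gamma> 0\<close> is inside one translate and outside a later one. Moving \<gamma>
  instead of the half-space, one finds an edge of \<gamma> that enters
  \<open>axis_hs \<gamma>' n\<close>, and this edge determines the half-space.\<close>

lemma axis_hs_range:
  assumes g: "bi_geodesic \<gamma>" "bi_geodesic \<gamma>'" and t: "auto_pair X t s"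
    and l: "\<And>n. t (\<gamma> n) = \<gamma> (n + l)" "\<And>n. t (\<gamma>' n) = \<gamma>' (n + l)" and "0 < l"
  shows "axis_hs \<gamma>' n \<in> range (axis_hs \<gamma>)"
proof -
  define K where "K j = axis_hs \<gamma>' (n + j * l)" for j
  have K': "\<gamma>' 0 \<in> K j \<longleftrightarrow> n + j * l < 0" for j
    using axis_hs_mem[OF g(2)] by (simp add: K_def)
  have inj: "inj_on K S" for S
  proof (rule inj_onI)
    fix i j assume "K i = K j"
    then have "n + i * l < m \<longleftrightarrow> n + j * l < m" for m
      unfolding K_def axis_hs_mem[OF g(2), symmetric] by simp
    from this[of "n + i * l"] this[of "n + j * l"] have "n + i * l = n + j * l" by linarith
    then show "i = j" using \<open>0 < l\<close> by simp
  qed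
  have hs: "K j \<in> halfspaces X" for j unfolding K_def using axis_hs_halfspace g by blast
  have v: "\<gamma> 0 \<in> verts X" "\<gamma>' 0 \<in> verts X" using g by (auto simp: bi_geodesic_def)
  have fin1: "finite {j. \<gamma> 0 \<notin> K j \<and> \<gamma>' 0 \<in> K j}"
    by (rule inj_on_finite[OF inj _ finite_separating[OF v]]) (use hs in auto)
  have fin2: "finite {j. \<gamma>' 0 \<notin> K j \<and> \<gamma> 0 \<in> K j}"
    by (rule inj_on_finite[OF inj _ finite_separating[OF v(2,1)]]) (use hs in auto)
  \<comment> \<open>As \<open>l\<close> is at least 1, \<open>\<bar>n\<bar> + 1\<close> periods
    outweigh the offset \<open>n\<close>.\<close>
  have b: "j \<le> - \<bar>n\<bar> - 1 \<Longrightarrow> n + j * l < 0" for j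
  proof -
    assume "j \<le> - \<bar>n\<bar> - 1"
    then have "j * l \<le> j * 1" using \<open>0 < l\<close> by (intro mult_left_mono_neg) auto
    then show ?thesis using \<open>j \<le> _\<close> by linarith
  qed
  have b': "\<bar>n\<bar> \<le> j \<Longrightarrow> \<not> n + j * l < 0" for j
  proof -
    assume "\<bar>n\<bar> \<le> j"
    then have "j * 1 \<le> j * l" using \<open>0 < l\<close> by (intro mult_left_mono) auto
    then show ?thesis using \<open>_ \<le> j\<close> by linarith
  qed
  have "\<not> {..- \<bar>n\<bar> - 1} \<subseteq> {j. \<gamma> 0 \<notin> K j \<and> \<gamma>' 0 \<in> K j}"
    using fin1 finite_subset infinite_Iic by blast
  then obtain i where i: "\<gamma> 0 \<in> K i" "i \<le> - \<bar>n\<bar> - 1" using K' b by auto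
  have "\<not> {\<bar>n\<bar>..} \<subseteq> {j. \<gamma>' 0 \<notin> K j \<and> \<gamma> 0 \<in> K j}"
    using fin2 finite_subset infinite_Ici by blast
  then obtain j where j: "\<gamma> 0 \<notin> K j" "\<bar>n\<bar> \<le> j" using K' b' by auto
  \<comment> \<open>Undoes the translation by \<open>k\<close> periods, so that one fixed half-space
    is tested on different points of \<gamma>.\<close>
  have tr: "\<gamma> (- k * l) \<in> axis_hs \<gamma>' n \<longleftrightarrow> \<gamma> 0 \<in> K k" for k
    using axis_hs_translate[OF g t l, of "- k * l" k n] by (simp add: K_def)
  have "- j * l \<le> - i * l" using i j \<open>0 < l\<close> by (intro mult_right_mono) auto
  moreover have "\<not> \<gamma> (- j * l) \<in> axis_hs \<gamma>' n" "\<gamma> (- i * l) \<in> axis_hs \<gamma>' n" using tr i j by blast+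
  ultimately obtain m where "\<not> \<gamma> m \<in> axis_hs \<gamma>' n" "\<gamma> (m + 1) \<in> axis_hs \<gamma>' n"
    by (rule int_crossing)
  then have "axis_hs \<gamma>' n = axis_hs \<gamma> m"
    using axis_hs_unique[OF g(1) axis_hs_halfspace[OF g(2)]] by blast
  then show ?thesis by blast
qed

text \<open>Apart from bijectivity of \<open>t\<close> and non-transversality, this is what the
  sequel uses of the geometry of \<open>X\<close>: the positive half-spaces are numbered by the
  edges of one axis, and \<open>t\<close> acts as a shift of the numbers.\<close>

theorem axis_family:
  assumes t: "auto_pair X t s" and "hyperbolic X t" and "A_pos X t \<noteq> {}"
  obtains \<gamma> :: "int \<Rightarrow> 'v" and H l where "0 < l" "\<And>n. \<gamma> n \<in> verts X" "A_pos X t = range H"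
    "\<And>m n. \<gamma> m \<in> H n \<longleftrightarrow> n < m" "\<And>n. H n \<subseteq> verts X" "\<And>n. t ` H n = H (n + l)"
proof -
  define l where "l = int (translation_length X t)"
  have l: "0 < l" using assms(2) by (simp add: l_def hyperbolic_def)
  have ax: "bi_geodesic \<gamma>" "\<And>n. t (\<gamma> n) = \<gamma> (n + l)" if "combinatorial_axis X t \<gamma>" for \<gamma>
    using that unfolding combinatorial_axis_def bi_geodesic_def l_def by blast+
  obtain \<gamma> where \<gamma>: "combinatorial_axis X t \<gamma>" using assms(3) unfolding A_pos_def by blast
  note g = ax[OF \<gamma>]
  have "A_pos X t = range (axis_hs \<gamma>)"
  proof
    show "A_pos X t \<subseteq> range (axis_hs \<gamma>)"
    proof
      fix H assume "H \<in> A_pos X t"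
      then obtain \<gamma>' n where H: "H \<in> halfspaces X" "combinatorial_axis X t \<gamma>'"
        "\<gamma>' n \<notin> H" "\<gamma>' (n + 1) \<in> H"
        unfolding A_pos_def by blast
      then have "H = axis_hs \<gamma>' n" using axis_hs_unique ax by blast
      then show "H \<in> range (axis_hs \<gamma>)"
        using axis_hs_range[OF g(1) ax(1)[OF H(2)] t g(2) ax(2)[OF H(2)] l] by blast
    qed
    have "axis_hs \<gamma> n \<in> A_pos X t" for n
      unfolding A_pos_def using axis_hs_halfspace[OF g(1)] axis_hs_mem[OF g(1)] \<gamma>
      by (intro CollectI conjI exI[of _ \<gamma>] exI[of _ n]) simp_all
    then show "range (axis_hs \<gamma>) \<subseteq> A_pos X t" by blast
  qed
  moreover have "\<gamma> n \<in> verts X" for n using g(1) by (simp add: bi_geodesic_def)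
  ultimately show ?thesis
    using that[OF l, of \<gamma> "axis_hs \<gamma>"] axis_hs_mem[OF g(1)] axis_hs_verts[OF g(1)]
      axis_hs_shift[OF g(1) t g(2)] by blast
qed

end

section \<open>Chains and antichains\<close>

definition is_antichain :: "('a \<Rightarrow> 'a \<Rightarrow> bool) \<Rightarrow> 'a set \<Rightarrow> bool" where
  "is_antichain lq S \<longleftrightarrow> (\<forall>x\<in>S. \<forall>y\<in>S. lq x y \<longrightarrow> x = y)"

locale weak_order =
  fixes lq :: "'a \<Rightarrow> 'a \<Rightarrow> bool"
  assumes lq_refl [simp]: "lq x x"
    and lq_trans: "lq x y \<Longrightarrow> lq y z \<Longrightarrow> lq x z"
    and lq_antisym: "lq x y \<Longrightarrow> lq y x \<Longrightarrow> x = y"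
begin

lemma ex_maximal: "finite P \<Longrightarrow> P \<noteq> {} \<Longrightarrow> \<exists>a\<in>P. \<forall>x\<in>P. lq a x \<longrightarrow> x = a"
proof (induction P rule: finite_ne_induct)
  case (insert x F)
  then obtain a where a: "a \<in> F" "\<forall>y\<in>F. lq a y \<longrightarrow> y = a" by blast
  show ?case
  proof (cases "lq a x")
    case True
    have "y = x" if "y \<in> F" "lq x y" for y
      using that a True lq_trans lq_antisym by metis
    then show ?thesis by blast
  next
    case False
    then show ?thesis using a by blast
  qed
qed simp

lemma ex_maximum_chain:
  assumes "finite P" "P \<noteq> {}" "\<And>x y. x \<in> P \<Longrightarrow> y \<in> P \<Longrightarrow> lq x y \<or> lq y x"
  shows "\<exists>a\<in>P. \<forall>x\<in>P. lq x a"
  using ex_maximal[OF assms(1,2)] assms(3) lq_refl by metis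

text \<open>Colour classes are chains, so elements of an antichain have different colours; with as
  many elements as colours, each colour occurs exactly once.\<close>

lemma antichain_colours:
  assumes "is_antichain lq S" "S \<subseteq> P" "card S = k" "finite S"
    and "f ` P \<subseteq> {..<k}" "\<And>x y. x \<in> P \<Longrightarrow> y \<in> P \<Longrightarrow> f x = f y \<Longrightarrow> lq x y \<or> lq y x"
  shows "inj_on f S" "f ` S = {..<k}"
proof -
  show inj: "inj_on f S"
    using assms(1,2,6) unfolding is_antichain_def by (intro inj_onI) (metis subsetD)
  show "f ` S = {..<k}"
    using assms(2,3,5) card_image[OF inj] by (intro card_subset_eq) auto
qed

text \<open>Galvin's argument: in each chain take the topmost element that lies on a maximum antichain of the
  poset without \<open>a\<close>; these elements form an antichain.\<close>

theorem dilworth: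
  assumes "finite P" "\<And>S. S \<subseteq> P \<Longrightarrow> is_antichain lq S \<Longrightarrow> card S \<le> k"
  shows "\<exists>f. f ` P \<subseteq> {..<k::nat} \<and> (\<forall>x\<in>P. \<forall>y\<in>P. f x = f y \<longrightarrow> lq x y \<or> lq y x)"
  using assms
proof (induction "card P" arbitrary: P k rule: less_induct)
  case less
  show ?case
  proof (cases "P = {}")
    case False
    obtain a where a: "a \<in> P" "\<forall>x\<in>P. lq a x \<longrightarrow> x = a"
      using ex_maximal[OF less.prems(1) False] by blast
    define Q where "Q = P - {a}"
    have Q: "finite Q" "Q \<subseteq> P" "card Q < card P"
      using less.prems(1) a card_Diff1_less[of P a] by (auto simp: Q_def)
    let ?P = "\<lambda>S. S \<subseteq> Q \<and> is_antichain lq S"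
    have "\<exists>W. ?P W \<and> (\<forall>S. ?P S \<longrightarrow> card S \<le> card W)"
    proof (rule Lattices_Big.ex_has_greatest_nat[of ?P "{}" card "Suc k"])
      show "?P {}" by (simp add: is_antichain_def)
      show "\<forall>S. ?P S \<longrightarrow> card S < Suc k" using less.prems(2) Q by (auto simp: less_Suc_eq_le)
    qed
    then obtain W where W: "?P W" "\<And>S. ?P S \<Longrightarrow> card S \<le> card W" by blast
    define k' where "k' = card W"
    have k': "k' \<le> k" using W less.prems(2) Q unfolding k'_def by auto
    obtain f where f: "f ` Q \<subseteq> {..<k'}" "\<And>x y. x \<in> Q \<Longrightarrow> y \<in> Q \<Longrightarrow> f x = f y \<Longrightarrow> lq x y \<or> lq y x"
      using less.hyps[OF Q(3,1)] W(2) unfolding k'_def by metis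
    \<comment> \<open>The elements of colour \<open>i\<close> that lie on some maximum antichain of
      \<open>Q\<close>. By \<open>hit\<close> every maximum antichain passes through each
      \<open>G i\<close>.\<close>
    define G where "G i = {z \<in> Q. f z = i \<and> (\<exists>S. ?P S \<and> card S = k' \<and> z \<in> S)}" for i
    have hit: "\<exists>y\<in>S. y \<in> G i" if S: "?P S" "card S = k'" and i: "i < k'" for S i
    proof -
      have "finite S" using S Q finite_subset by blast
      then have "f ` S = {..<k'}" using antichain_colours(2)[of S Q k' f] S f by simp
      then obtain y where "y \<in> S" "f y = i" using i by (metis imageE lessThan_iff)
      then show ?thesis using S unfolding G_def by blast
    qed
    have "\<exists>x\<in>G i. \<forall>z\<in>G i. lq z x" if "i < k'" for i
    proof (rule ex_maximum_chain)
      show "finite (G i)" using Q by (simp add: G_def)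
      show "G i \<noteq> {}" using hit[of W i] W that by (auto simp: k'_def)
      show "lq x y \<or> lq y x" if "x \<in> G i" "y \<in> G i" for x y
        using that f(2) by (auto simp: G_def)
    qed
    then obtain x where x: "\<And>i. i < k' \<Longrightarrow> x i \<in> G i" "\<And>i z. i < k' \<Longrightarrow> z \<in> G i \<Longrightarrow> lq z (x i)"
      by metis
    have fx: "f (x i) = i" "x i \<in> Q" if "i < k'" for i using x(1)[OF that] by (auto simp: G_def)
    have anti: "i = j" if ij: "i < k'" "j < k'" "lq (x i) (x j)" for i j
    proof -
      obtain S where S: "?P S" "card S = k'" "x j \<in> S" using x(1)[OF ij(2)] by (auto simp: G_def)
      obtain y where y: "y \<in> S" "y \<in> G i" using hit[OF S(1,2) ij(1)] by blast
      have "lq y (x j)" using x(2)[OF ij(1) y(2)] ij(3) lq_trans by blast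
      then have "y = x j" using S y by (auto simp: is_antichain_def)
      then show ?thesis using y(2) fx[OF ij(2)] by (simp add: G_def)
    qed
    show ?thesis
    proof (cases "\<exists>i<k'. lq (x i) a")
      case True
      then obtain i where i: "i < k'" "lq (x i) a" by blast
      \<comment> \<open>The chain to be removed: \<open>a\<close> on top of the part of colour
        \<open>i\<close> up to \<open>x i\<close>. Every maximum antichain of \<open>Q\<close> meets
        it, so antichains in the rest have at most \<open>k' - 1\<close> elements.\<close>
      define K where "K = insert a {z \<in> Q. f z = i \<and> lq z (x i)}"
      have K: "K \<subseteq> P" "a \<in> K" using a Q by (auto simp: K_def)
      have "card (P - K) < card P"
        using a K less.prems(1) by (intro psubset_card_mono) auto
      moreover have "card S \<le> k' - 1" if S: "S \<subseteq> P - K" "is_antichain lq S" for S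
      proof -
        have SQ: "?P S" using S K(2) by (auto simp: Q_def)
        then have "card S \<le> k'" using W(2) by (simp add: k'_def)
        moreover have "card S \<noteq> k'"
        proof
          assume "card S = k'"
          then obtain y where y: "y \<in> S" "y \<in> G i" using hit[OF SQ _ i(1)] by blast
          then have "y \<in> K" using x(2)[OF i(1) y(2)] by (auto simp: K_def G_def)
          then show False using y S by blast
        qed
        ultimately show ?thesis by simp
      qed
      ultimately have "\<exists>h. h ` (P - K) \<subseteq> {..<k' - 1} \<and>
          (\<forall>x\<in>P - K. \<forall>y\<in>P - K. h x = h y \<longrightarrow> lq x y \<or> lq y x)"
        using less.prems(1) by (intro less.hyps) auto
      then obtain h where h: "h ` (P - K) \<subseteq> {..<k' - 1}"
        "\<And>x y. x \<in> P - K \<Longrightarrow> y \<in> P - K \<Longrightarrow> h x = h y \<Longrightarrow> lq x y \<or> lq y x"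
        by blast
      let ?f = "\<lambda>z. if z \<in> K then k' - 1 else h z"
      have hK: "h z < k' - 1" if "z \<in> P - K" for z using h(1) that by auto
      have "?f ` P \<subseteq> {..<k}" using hK i(1) k' by fastforce
      moreover have K2: "lq y z \<or> lq z y" if "y \<in> K" "z \<in> K" for y z
        using that f(2) i(2) lq_trans unfolding K_def by auto
      moreover have "lq y z \<or> lq z y" if yz: "y \<in> P" "z \<in> P" "?f y = ?f z" for y z
        using yz hK[of y] hK[of z] K2 h(2) by (auto split: if_splits)
      ultimately show ?thesis by (intro exI[of _ ?f] conjI ballI impI) auto
    next
      case False
      \<comment> \<open>Here \<open>a\<close> is incomparable to every \<open>x i\<close> and
        enlarges their antichain, so the bound \<open>k\<close> leaves a spare colour for
        \<open>a\<close> alone.\<close>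
      let ?T = "insert a (x ` {..<k'})"
      have na: "a \<notin> x ` {..<k'}" using fx(2) by (auto simp: Q_def)
      have "lq a (x i) \<Longrightarrow> i < k' \<Longrightarrow> a = x i" for i using a(2) fx(2) Q(2) by blast
      then have "is_antichain lq ?T" using False anti unfolding is_antichain_def by auto
      moreover have "?T \<subseteq> P" using a fx(2) Q(2) by auto
      ultimately have "card ?T \<le> k" using less.prems(2) by blast
      moreover have "inj_on x {..<k'}" using fx(1) by (metis inj_onI lessThan_iff)
      ultimately have k1: "Suc k' \<le> k" using na by (simp add: card_image)
      let ?f = "\<lambda>z. if z = a then k' else f z"
      have fQ: "f z < k'" if "z \<in> P" "z \<noteq> a" for z using f(1) that by (auto simp: Q_def)
      have "?f ` P \<subseteq> {..<k}" using fQ k1 by fastforce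
      moreover have "lq y z \<or> lq z y" if yz: "y \<in> P" "z \<in> P" "?f y = ?f z" for y z
        using yz fQ[of y] fQ[of z] f(2)[of y z] by (auto simp: Q_def split: if_splits)
      ultimately show ?thesis by (intro exI[of _ ?f] conjI ballI impI) auto
    qed
  qed simp
qed

end

section \<open>Integer powers of a bijection, and increasing enumerations of sets of
  integers\<close>

lemma int_powers:
  fixes \<rho> :: "'a \<Rightarrow> 'a"
  assumes "bij \<rho>" "\<rho> ` D = D"
  obtains z :: "int \<Rightarrow> 'a \<Rightarrow> 'a" where "z 0 = id" "\<And>k x. z (k + 1) x = \<rho> (z k x)"
    "\<And>k. bij (z k)" "\<And>k. z k ` D = D"
proof -
  define \<sigma> where "\<sigma> = inv_into UNIV \<rho>"
  define z where "z k = (if 0 \<le> k then \<rho> ^^ nat k else \<sigma> ^^ nat (- k))" for k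
  have step: "z (k + 1) x = \<rho> (z k x)" for k x
  proof (cases "0 \<le> k")
    case True
    then have "nat (k + 1) = Suc (nat k)" by simp
    then show ?thesis using True by (simp add: z_def)
  next
    case False
    then have n: "nat (- k) = Suc (nat (- (k + 1)))" by simp
    have "\<rho> (\<sigma> y) = y" for y using assms(1) unfolding \<sigma>_def by (simp add: bij_is_surj surj_f_inv_f)
    then have "\<rho> (z k x) = (\<sigma> ^^ nat (- (k + 1))) x" using False n by (simp add: z_def)
    then show ?thesis using False by (cases "k = -1") (auto simp: z_def)
  qed
  have bij: "bij (z k)" for k
  proof -
    have "bij \<sigma>" using assms(1) unfolding \<sigma>_def by (rule bij_imp_bij_inv)
    then show ?thesis using assms(1) by (auto simp: z_def intro: bij_fn)
  qed
  have D: "z k ` D = D" for k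
  proof (induction k rule: int_induct[of _ 0])
    case base
    show ?case by (simp add: z_def)
  next
    case (step1 i)
    have "z (i + 1) ` D = \<rho> ` z i ` D" using step by (auto simp: image_image)
    then show ?case using step1 assms(2) by simp
  next
    case (step2 i)
    have "z (i - 1 + 1) ` D = \<rho> ` z (i - 1) ` D" using step[of "i - 1"] by (auto simp: image_image)
    then have "\<rho> ` z (i - 1) ` D = \<rho> ` D" using step2 assms(2) by simp
    then show ?case using assms(1) by (simp add: bij_is_inj inj_image_eq_iff)
  qed
  have "z 0 = id" by (auto simp: z_def)
  then show ?thesis using that step bij D by blast
qed

lemma strict_mono_intI:
  assumes "\<And>n::int. e n < (e (n + 1) :: int)" shows "strict_mono e"
proof (rule strict_monoI)
  fix m n :: int assume "m < n"
  then have "m + 1 \<le> n" by simp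
  then show "e m < e n"
  proof (induction rule: int_ge_induct)
    case (step i)
    then show ?case using assms[of i] by simp
  qed (rule assms)
qed

lemma strict_mono_int_bounds:
  assumes "strict_mono (e :: int \<Rightarrow> int)"
  shows "0 \<le> n \<Longrightarrow> e 0 + n \<le> e n" "n \<le> 0 \<Longrightarrow> e n \<le> e 0 + n"
proof -
  show "e 0 + n \<le> e n" if "0 \<le> n" using that
  proof (induction rule: int_ge_induct)
    case (step i)
    then show ?case using strict_monoD[OF assms, of i "i + 1"] by simp
  qed simp
  show "e n \<le> e 0 + n" if "n \<le> 0" using that
  proof (induction rule: int_le_induct)
    case (step i)
    then show ?case using strict_monoD[OF assms, of "i - 1" i] by simp
  qed simp
qed

lemma int_set_next:
  fixes S :: "int set" assumes "\<And>N. \<exists>m\<in>S. N < m"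
  obtains nxt where "\<And>x. nxt x \<in> S" "\<And>x. x < nxt x" "\<And>x z. z \<in> S \<Longrightarrow> x < z \<Longrightarrow> nxt x \<le> z"
proof -
  have "\<exists>y\<in>S. x < y \<and> (\<forall>z\<in>S. x < z \<longrightarrow> y \<le> z)" for x
  proof -
    let ?P = "\<lambda>n::nat. x + 1 + int n \<in> S"
    obtain m where m: "m \<in> S" "x < m" using assms by blast
    then have "?P (nat (m - x - 1))" by simp
    then have L: "?P (Least ?P)" by (rule LeastI)
    have "x + 1 + int (Least ?P) \<le> z" if z: "z \<in> S" "x < z" for z
    proof -
      have "?P (nat (z - x - 1))" using z by simp
      then have "Least ?P \<le> nat (z - x - 1)" by (rule Least_le)
      then show ?thesis using z by linarith
    qed
    then show ?thesis using L by (intro bexI[of _ "x + 1 + int (Least ?P)"]) auto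
  qed
  then show ?thesis using that by metis
qed

text \<open>The successor map of \<open>S\<close> is a bijection of \<open>S\<close>. Extended by
  the identity it has integer powers, and their values at \<open>a\<close> enumerate
  \<open>S\<close> increasingly.\<close>

lemma int_set_enum:
  fixes S :: "int set"
  assumes up: "\<And>N. \<exists>m\<in>S. N < m" and dn: "\<And>N. \<exists>m\<in>S. m < N" and "a \<in> S"
  obtains e :: "int \<Rightarrow> int" where "strict_mono e" "range e = S" "e 0 = a"
proof -
  obtain nxt where n: "\<And>x. nxt x \<in> S" "\<And>x. x < nxt x" "\<And>x z. z \<in> S \<Longrightarrow> x < z \<Longrightarrow> nxt x \<le> z"
    using int_set_next[OF up] by blast
  \<comment> \<open>Predecessors are obtained as successors in the reflected set.\<close>
  have "\<exists>m\<in>uminus ` S. N < m" for N using dn[of "- N"] by force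
  then obtain prv where p: "\<And>x. prv x \<in> uminus ` S" "\<And>x. x < prv x"
      "\<And>x z. z \<in> uminus ` S \<Longrightarrow> x < z \<Longrightarrow> prv x \<le> z"
    using int_set_next by metis
  define \<rho> where "\<rho> x = (if x \<in> S then nxt x else x)" for x
  have inj: "x = y" if "x \<in> S" "y \<in> S" "nxt x = nxt y" for x y
    using n(3)[of y x] n(3)[of x y] that n(2)[of x] n(2)[of y] by linarith
  have surj: "\<exists>x\<in>S. nxt x = y" if y: "y \<in> S" for y
  proof -
    let ?x = "- prv (- y)"
    have x: "?x \<in> S" "?x < y" using p(1)[of "- y"] p(2)[of "- y"] by auto
    have "nxt ?x \<le> y" using n(3) x y by blast
    moreover have "\<not> nxt ?x < y"
    proof
      assume "nxt ?x < y"
      then have "prv (- y) \<le> - nxt ?x" using p(3)[of "- nxt ?x" "- y"] n(1) by simp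
      then show False using n(2)[of ?x] by linarith
    qed
    ultimately show ?thesis using x by force
  qed
  have "\<rho> ` S = S" using n(1) surj unfolding \<rho>_def by force
  moreover have "bij \<rho>"
  proof (rule bijI)
    show "inj \<rho>" unfolding \<rho>_def using inj n(1) by (auto intro!: injI split: if_splits)
    have "\<exists>x. \<rho> x = y" for y using surj[of y] unfolding \<rho>_def by (cases "y \<in> S") metis+
    then show "surj \<rho>" by (metis surjI)
  qed
  ultimately obtain z :: "int \<Rightarrow> int \<Rightarrow> int"
    where z: "z 0 = id" "\<And>k x. z (k + 1) x = \<rho> (z k x)" "\<And>k. z k ` S = S"
    using int_powers[of \<rho> S] by metis
  define e where "e k = z k a" for k
  have eS: "e k \<in> S" for k using z(3) \<open>a \<in> S\<close> unfolding e_def by blast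
  have en: "e (k + 1) = nxt (e k)" for k using z(2) eS unfolding e_def \<rho>_def by simp
  have sm: "strict_mono e" using strict_mono_intI[of e] en n(2) by simp
  have "y \<in> range e" if "y \<in> S" for y
  proof -
    \<comment> \<open>A strictly increasing enumeration moves by at least one per step, so the
      distance from \<open>y\<close> to \<open>e 0\<close> bounds the positions at which
      \<open>y\<close> can be passed.\<close>
    have 1: "\<not> y < e (- \<bar>y - e 0\<bar>)" using strict_mono_int_bounds(2)[OF sm, of "- \<bar>y - e 0\<bar>"] by linarith
    have 2: "y < e (\<bar>y - e 0\<bar> + 1)"
      using strict_mono_int_bounds(1)[OF sm, of "\<bar>y - e 0\<bar> + 1"] by linarith
    have 3: "- \<bar>y - e 0\<bar> \<le> \<bar>y - e 0\<bar> + 1" by linarith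
    obtain k where k: "\<not> y < e k" "y < e (k + 1)"
      by (rule int_crossing[of _ _ "\<lambda>k. y < e k", OF 3 1 2])
    then have "\<not> e k < y" using n(3)[of y "e k"] that en by force
    then show ?thesis using k by (intro range_eqI[of _ _ k]) simp
  qed
  then have "range e = S" using eS by blast
  moreover have "e 0 = a" using z(1) by (simp add: e_def)
  ultimately show ?thesis using that sm by blast
qed

text \<open>Where the enumerations agree, their next and previous values agree too, being the
  neighbours of one element in one range. A single common value therefore fixes the shift.\<close>

lemma int_enum_shift:
  fixes e e' :: "int \<Rightarrow> int"
  assumes e: "strict_mono e" and e': "strict_mono e'" and r: "range e = range e'"
  obtains s where "\<And>n. e' n = e (n + s)"
proof -
  have step: "e' (n + 1) = e (m + 1)" "e' (n - 1) = e (m - 1)" if nm: "e' n = e m" for n m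
  proof -
    have ex: "\<exists>j. e' k = e j" "\<exists>j. e k = e' j" for k using r by (metis rangeE rangeI)+
    note less = strict_mono_less[OF e] strict_mono_less[OF e'] strict_mono_less_eq[OF e]
      strict_mono_less_eq[OF e']
    obtain j where j: "e' (n + 1) = e j" using ex by blast
    obtain i where i: "e (m + 1) = e' i" using ex by blast
    have "m < j" "n < i" using j i nm less by (metis less_add_one)+
    then have "e (m + 1) \<le> e j" "e' (n + 1) \<le> e' i" using less by simp_all
    then show "e' (n + 1) = e (m + 1)" using i j by simp
    obtain j where j: "e' (n - 1) = e j" using ex by blast
    obtain i where i: "e (m - 1) = e' i" using ex by blast
    have "e j < e m" "e' i < e' n" unfolding j[symmetric] i[symmetric]
      by (simp add: nm[symmetric] less, simp add: nm less)
    then have "j < m" "i < n" using less by simp_all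
    then have "e j \<le> e (m - 1)" "e' i \<le> e' (n - 1)" using less by simp_all
    then show "e' (n - 1) = e (m - 1)" using i j by simp
  qed
  obtain s where s: "e' 0 = e s" using r by (metis rangeE rangeI)
  have "e' n = e (n + s)" for n
  proof (induction n rule: int_induct[of _ 0])
    case (step1 i)
    then show ?case using step(1)[of i "i + s"] by (simp add: algebra_simps)
  next
    case (step2 i)
    then show ?case using step(2)[of i "i + s"] by (simp add: algebra_simps)
  qed (use s in simp)
  then show ?thesis by (rule that)
qed

text \<open>Models the positive half-spaces by their positions on the axis: \<open>lq m n\<close>
  will stand for \<open>H n \<subseteq> H m\<close> and \<open>l\<close> for the translation length.
  The comparability of an index with its translate, \<open>lq_adv\<close>, is where
  non-transversality enters.\<close>

locale periodic_order =
  fixes lq :: "int \<Rightarrow> int \<Rightarrow> bool" and l :: int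
  assumes pre_refl [simp]: "lq m m"
    and pre_trans: "lq m n \<Longrightarrow> lq n k \<Longrightarrow> lq m k"
    and lq_le: "lq m n \<Longrightarrow> m \<le> n"
    and lq_shift1: "lq (m + l) (n + l) \<longleftrightarrow> lq m n"
    and l_pos: "0 < l"
    and lq_adv: "lq m (m + l)"
begin

sublocale weak_order lq
proof unfold_locales
  show "lq x z" if "lq x y" "lq y z" for x y z using that by (rule pre_trans)
  show "x = y" if "lq x y" "lq y x" for x y using lq_le[OF that(1)] lq_le[OF that(2)] by simp
qed simp

lemma lq_shift: "lq (m + k * l) (n + k * l) \<longleftrightarrow> lq m n"
proof (induction k rule: int_induct[of _ 0])
  case (step1 i)
  then show ?case using lq_shift1[of "m + i * l" "n + i * l"] by (simp add: algebra_simps)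
next
  case (step2 i)
  then show ?case using lq_shift1[of "m + (i - 1) * l" "n + (i - 1) * l"] by (simp add: algebra_simps)
qed simp

lemma lq_advance: "j \<le> k \<Longrightarrow> lq (m + j * l) (m + k * l)"
proof (induction rule: int_ge_induct)
  case (step i)
  then show ?case using lq_trans[OF step(2) lq_adv] by (simp add: algebra_simps)
qed simp

text \<open>Indices in one residue class modulo \<open>l\<close> are comparable by
  \<open>lq_advance\<close>, so an antichain has at most one element in each class.\<close>

lemma antichain_finite:
  assumes "is_antichain lq S" shows "finite S" "card S \<le> nat l"
proof -
  have inj: "inj_on (\<lambda>m. m mod l) S"
  proof (rule inj_onI)
    fix m n assume mn: "m \<in> S" "n \<in> S" "m mod l = n mod l"
    then have "l dvd n - m" by (metis mod_eq_dvd_iff)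
    then obtain k where k: "n = m + k * l" by (metis add_diff_cancel_left' diff_add_cancel dvdE add.commute mult.commute)
    show "m = n"
    proof (cases "0 \<le> k")
      case True
      then have "lq m n" using lq_advance[of 0 k m] k by simp
      then show ?thesis using assms mn by (simp add: is_antichain_def)
    next
      case False
      then have "lq n m" using lq_advance[of k 0 m] k by simp
      then show ?thesis using assms mn by (auto simp: is_antichain_def)
    qed
  qed
  have sub: "(\<lambda>m. m mod l) ` S \<subseteq> {0..<l}" using l_pos by auto
  show "finite S" using inj_on_finite[OF inj sub] by simp
  show "card S \<le> nat l" using card_inj_on_le[OF inj sub] by simp
qed

end

section \<open>Layers between a maximum antichain and its translates\<close>

locale max_antichain = periodic_order +
  fixes A :: "int set" and d :: nat
  assumes A: "is_antichain lq A" and card_A: "card A = d"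
    and card_le: "is_antichain lq S \<Longrightarrow> card S \<le> d"
begin

lemma fin_A: "finite A" using antichain_finite A by blast

lemma A_eq: "a \<in> A \<Longrightarrow> b \<in> A \<Longrightarrow> lq a b \<Longrightarrow> a = b"
  using A by (simp add: is_antichain_def)

lemma comparable: "\<exists>a\<in>A. lq a m \<or> lq m a"
proof (rule ccontr)
  assume n: "\<not> ?thesis"
  then have "is_antichain lq (insert m A)" using A by (auto simp: is_antichain_def)
  then have "card (insert m A) \<le> d" by (rule card_le)
  moreover have "m \<notin> A" using n by auto
  ultimately show False using fin_A card_A by simp
qed

text \<open>The up-set of \<open>A\<close>: here \<open>A\<close> is below \<open>m\<close>. By
  \<open>comparable\<close> every other index lies under an element of \<open>A\<close>, so
  \<open>A\<close> cuts the order in two.\<close>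

definition below :: "int \<Rightarrow> bool" where "below m \<longleftrightarrow> (\<exists>a\<in>A. lq a m)"

lemma below_mono: "below m \<Longrightarrow> lq m n \<Longrightarrow> below n"
  unfolding below_def using lq_trans by blast

lemma A_below: "a \<in> A \<Longrightarrow> below a"
  unfolding below_def by (intro bexI[of _ a]) simp_all

lemma not_below_Min: "m < Min A \<Longrightarrow> \<not> below m"
  unfolding below_def using fin_A lq_le Min_le by fastforce

lemma below_Max: "Max A < m \<Longrightarrow> below m"
  unfolding below_def using comparable[of m] fin_A lq_le Max_ge
  by (metis linorder_not_less order_trans)

lemma not_below_A: "a \<in> A \<Longrightarrow> \<not> below (a - l)"
proof
  assume a: "a \<in> A" "below (a - l)"
  then obtain b where b: "b \<in> A" "lq b (a - l)" by (auto simp: below_def)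
  then have "lq b a" using lq_trans[OF b(2) lq_adv] by simp
  then have "b = a" using A_eq a b by blast
  then show False using lq_le[OF b(2)] l_pos by simp
qed

lemma not_belowD: "\<not> below m \<Longrightarrow> \<exists>a\<in>A. lq m a"
  using comparable[of m] unfolding below_def by blast

text \<open>The number of the layer of \<open>m\<close>: above \<open>A\<close> translated by
  \<open>k\<close> periods, but not above the next translate. Each layer is a fundamental domain for
  the shift by \<open>l\<close>.\<close>

definition is_lev :: "int \<Rightarrow> int \<Rightarrow> bool" where
  "is_lev m k \<longleftrightarrow> below (m - k * l) \<and> \<not> below (m - (k + 1) * l)"

lemma ex_lev: "\<exists>k. is_lev m k"
proof -
  \<comment> \<open>So many periods, each of length at least 1, carry \<open>m\<close> beyond
    \<open>Max A\<close> in one direction and beyond \<open>Min A\<close> in the other.\<close>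
  define b where "b = \<bar>m\<bar> + \<bar>Min A\<bar> + \<bar>Max A\<bar> + 1"
  have b: "m + b * l > Max A" "m - b * l < Min A" "- b \<le> b"
  proof -
    have 1: "b * 1 \<le> b * l" using l_pos by (intro mult_left_mono) (auto simp: b_def)
    have 2: "m + b > Max A" "m - b < Min A" "- b \<le> b" unfolding b_def by linarith+
    show "m + b * l > Max A" "m - b * l < Min A" "- b \<le> b" using 1 2 by simp_all
  qed
  have 1: "\<not> \<not> below (m - (- b) * l)" using below_Max[OF b(1)] by simp
  have 2: "\<not> below (m - b * l)" using b(2) by (rule not_below_Min)
  obtain k where "\<not> \<not> below (m - k * l)" "\<not> below (m - (k + 1) * l)"
    by (rule int_crossing[of _ _ "\<lambda>k. \<not> below (m - k * l)", OF b(3) 1 2])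
  then show ?thesis unfolding is_lev_def by blast
qed

lemma lev_unique: "is_lev m j \<Longrightarrow> is_lev m k \<Longrightarrow> j = k"
proof -
  have "\<not> j < k" if "is_lev m j" "is_lev m k" for j k
  proof
    assume "j < k"
    then have "lq (m + - k * l) (m + - (j + 1) * l)" by (intro lq_advance) simp
    then have "below (m - (j + 1) * l)" using that(2) below_mono
      unfolding is_lev_def by (metis add_uminus_conv_diff mult_minus_left)
    then show False using that(1) by (simp add: is_lev_def)
  qed
  then show "is_lev m j \<Longrightarrow> is_lev m k \<Longrightarrow> j = k" by (meson linorder_less_linear)
qed

definition lev :: "int \<Rightarrow> int" where "lev m = (SOME k. is_lev m k)"

lemma is_lev_lev: "is_lev m (lev m)"
  unfolding lev_def using ex_lev by (rule someI_ex)

lemma lev_eq: "is_lev m k \<Longrightarrow> lev m = k"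
  using lev_unique is_lev_lev by blast

lemma is_lev_shift: "is_lev (m + j * l) (k + j) \<longleftrightarrow> is_lev m k"
  by (simp add: is_lev_def algebra_simps)

lemma lev_shift: "lev (m + j * l) = lev m + j"
  using is_lev_shift is_lev_lev lev_eq by blast

lemma lev_A: "a \<in> A \<Longrightarrow> lev a = 0"
  by (rule lev_eq) (simp add: is_lev_def A_below not_below_A)

text \<open>The closed interval from \<open>A\<close> to its translate, that is, layer 0 together
  with the translate of \<open>A\<close>. The translate belongs to layer 1; it is included because
  chains of consecutive layers are glued there.\<close>

definition Q :: "int set" where "Q = {m. \<exists>a\<in>A. \<exists>b\<in>A. lq a m \<and> lq m (b + l)}"

lemma A_Q: "a \<in> A \<Longrightarrow> a \<in> Q" "a \<in> A \<Longrightarrow> a + l \<in> Q"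
  unfolding Q_def using lq_adv lq_refl by blast+

lemma lev_0_Q: "lev m = 0 \<Longrightarrow> m \<in> Q"
proof -
  assume "lev m = 0"
  then have b: "below m" "\<not> below (m - l)" using is_lev_lev[of m] by (auto simp: is_lev_def)
  then obtain a b where "a \<in> A" "lq a m" "b \<in> A" "lq (m - l) b"
    using not_belowD unfolding below_def by blast
  moreover from this have "lq m (b + l)" using lq_shift1[of "m - l" b] by simp
  ultimately show ?thesis unfolding Q_def by blast
qed

text \<open>If \<open>m\<close> is above the translate of \<open>A\<close> as well, then
  \<open>m - l\<close> is squeezed between two elements of the antichain and equals both.\<close>

lemma Q_cases:
  assumes "m \<in> Q" shows "lev m = 0 \<or> m - l \<in> A"
proof (cases "below (m - l)")
  case True
  obtain b where b: "b \<in> A" "lq m (b + l)" using assms by (auto simp: Q_def)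
  then have mb: "lq (m - l) b" using lq_shift1[of "m - l" b] by simp
  obtain a where a: "a \<in> A" "lq a (m - l)" using True by (auto simp: below_def)
  then have "a = b" using A_eq b lq_trans mb by blast
  then have "m - l = a" using lq_antisym a mb by blast
  then show ?thesis using a by simp
next
  case False
  have "below m" using assms by (auto simp: Q_def below_def)
  then show ?thesis using False by (intro disjI1 lev_eq) (simp add: is_lev_def)
qed

lemma Q_trans: "m \<in> Q \<Longrightarrow> n \<in> Q \<Longrightarrow> lq m x \<Longrightarrow> lq x n \<Longrightarrow> x \<in> Q"
  unfolding Q_def using lq_trans by blast

lemma fin_Q: "finite Q"
proof (rule finite_subset)
  show "Q \<subseteq> {Min A..Max A + l}"
  proof
    fix m assume "m \<in> Q"
    then obtain a b where ab: "a \<in> A" "b \<in> A" "lq a m" "lq m (b + l)" unfolding Q_def by blast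
    show "m \<in> {Min A..Max A + l}"
      using lq_le[OF ab(3)] lq_le[OF ab(4)] Min_le[OF fin_A ab(1)] Max_ge[OF fin_A ab(2)] by simp
  qed
qed simp

definition colouring :: "(int \<Rightarrow> nat) \<Rightarrow> bool" where
  "colouring f \<longleftrightarrow> f ` Q \<subseteq> {..<d} \<and> (\<forall>x\<in>Q. \<forall>y\<in>Q. f x = f y \<longrightarrow> lq x y \<or> lq y x)"

text \<open>Colour 0 has no gaps: if any index lies strictly between two elements of the class, so
  does an element of the class. Only colour 0 is treated because the tightness claim concerns the
  first coordinate direction.\<close>

definition saturated :: "(int \<Rightarrow> nat) \<Rightarrow> bool" where
  "saturated f \<longleftrightarrow> (\<forall>m\<in>Q. \<forall>n\<in>Q. \<forall>x. f m = 0 \<longrightarrow> f n = 0 \<longrightarrow> lq m x \<longrightarrow> lq x n \<longrightarrow>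
     x \<noteq> m \<longrightarrow> x \<noteq> n \<longrightarrow> (\<exists>y\<in>Q. f y = 0 \<and> lq m y \<and> lq y n \<and> y \<noteq> m \<and> y \<noteq> n))"

text \<open>If the first colour class is as large as possible, it has no gaps: an element in a gap could be
  recoloured.\<close>

lemma ex_saturated: "\<exists>f. colouring f \<and> saturated f"
proof -
  let ?N = "\<lambda>f. card {x \<in> Q. f x = (0::nat)}"
  have "\<exists>f. colouring f" unfolding colouring_def by (rule dilworth[OF fin_Q]) (rule card_le)
  then obtain f0 where f0: "colouring f0" by (rule exE)
  have b: "\<forall>f. colouring f \<longrightarrow> ?N f < Suc (card Q)"
    using card_mono[OF fin_Q] by (simp add: less_Suc_eq_le)
  have "\<exists>f. colouring f \<and> (\<forall>f'. colouring f' \<longrightarrow> ?N f' \<le> ?N f)"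
    by (rule Lattices_Big.ex_has_greatest_nat[of colouring f0 ?N, OF f0 b])
  then obtain f where f': "colouring f \<and> (\<forall>f'. colouring f' \<longrightarrow> ?N f' \<le> ?N f)" by (rule exE)
  note f = f'[THEN conjunct1] f'[THEN conjunct2, rule_format]
  have "saturated f"
    unfolding saturated_def
  proof (intro ballI allI impI, rule ccontr)
    fix m n x
    assume mn: "m \<in> Q" "n \<in> Q" "f m = 0" "f n = 0" "lq m x" "lq x n" "x \<noteq> m" "x \<noteq> n"
      and none: "\<not> (\<exists>y\<in>Q. f y = 0 \<and> lq m y \<and> lq y n \<and> y \<noteq> m \<and> y \<noteq> n)"
    have x: "x \<in> Q" by (rule Q_trans[OF mn(1,2,5,6)])
    have x0: "f x \<noteq> 0" using none x mn(5-8) by auto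
    have cmp: "lq y z \<or> lq z y" if "y \<in> Q" "z \<in> Q" "f y = f z" for y z
      using f(1) that unfolding colouring_def by simp
    let ?f = "f(x := 0)"
    \<comment> \<open>No \<open>y\<close> of colour 0 lies strictly between \<open>m\<close> and
      \<open>n\<close>, so it is under \<open>m\<close> or over \<open>n\<close> and thereby
      comparable with \<open>x\<close>.\<close>
    have cx: "lq x y \<or> lq y x" if y: "y \<in> Q" "f y = 0" for y
    proof -
      have "lq y m \<or> lq n y" using cmp[OF y(1) mn(1)] cmp[OF y(1) mn(2)] none y mn(3,4) lq_refl by metis
      then show ?thesis using lq_trans[OF _ mn(5)] lq_trans[OF mn(6)] by metis
    qed
    have "d \<noteq> 0" using mn(1) f(1) unfolding colouring_def by auto
    then have "colouring ?f"
      using f(1) cx cmp unfolding colouring_def by (auto simp: image_subset_iff)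
    then have "?N ?f \<le> ?N f" by (rule f)
    moreover have "{y \<in> Q. ?f y = 0} = insert x {y \<in> Q. f y = 0}" using x by auto
    ultimately show False using x0 fin_Q by simp
  qed
  then show ?thesis using f(1) by (intro exI[of _ f] conjI)
qed

end

section \<open>Gluing translated chains into bi-infinite rows\<close>

locale coloured_antichain = max_antichain +
  fixes f :: "int \<Rightarrow> nat"
  assumes col: "colouring f" and sat: "saturated f"
begin

lemma f_cmp: "x \<in> Q \<Longrightarrow> y \<in> Q \<Longrightarrow> f x = f y \<Longrightarrow> lq x y \<or> lq y x"
  using col unfolding colouring_def by simp

lemma f_lt: "x \<in> Q \<Longrightarrow> f x < d"
  using col unfolding colouring_def by auto

lemma f_A: "inj_on f A" "f ` A = {..<d}"
proof -
  have "A \<subseteq> Q" using A_Q(1) by blast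
  then show "inj_on f A" "f ` A = {..<d}"
    using antichain_colours[OF A _ card_A fin_A, of Q f] f_cmp col unfolding colouring_def by auto
qed

text \<open>The upper end of \<open>Q\<close> is an antichain of full size as well, so each class
  has exactly one element on either end.\<close>

lemma f_Al: "inj_on (\<lambda>a. f (a + l)) A" "(\<lambda>a. f (a + l)) ` A = {..<d}"
proof -
  let ?B = "(\<lambda>a. a + l) ` A"
  have i: "inj_on (\<lambda>a. a + l) A" by (simp add: inj_on_def)
  have a: "is_antichain lq ?B" using A lq_shift1 by (simp add: is_antichain_def)
  have c: "card ?B = d" using card_image[OF i] card_A by simp
  have s: "?B \<subseteq> Q" using A_Q(2) by blast
  have "inj_on f ?B" "f ` ?B = {..<d}"
    using antichain_colours[OF a s c, of f] fin_A f_cmp col unfolding colouring_def by auto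
  then show "inj_on (\<lambda>a. f (a + l)) A" "(\<lambda>a. f (a + l)) ` A = {..<d}"
    using comp_inj_on[OF i, of f] by (simp_all add: comp_def image_image)
qed

text \<open>If the class of colour \<open>i\<close> starts at \<open>a\<close> in \<open>A\<close>,
  its translate continues the class that ends at \<open>a + l\<close>, and \<open>rho i\<close> is
  the colour of the latter. Beyond \<open>d\<close> the identity is used in order to have a
  bijection of all natural numbers.\<close>

definition rho :: "nat \<Rightarrow> nat" where
  "rho i = (if i < d then f (inv_into A f i + l) else i)"

lemma rho_f: "a \<in> A \<Longrightarrow> rho (f a) = f (a + l)"
  using f_A f_lt[OF A_Q(1)] by (simp add: rho_def)

lemma rho_image: "rho ` {..<d} = {..<d}"
proof -
  have "rho ` {..<d} = rho ` f ` A" using f_A(2) by simp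
  also have "\<dots> = (\<lambda>a. f (a + l)) ` A" unfolding image_image by (rule image_cong) (simp_all add: rho_f)
  finally show ?thesis using f_Al by simp
qed

lemma bij_rho: "bij rho"
proof -
  have "inj_on rho {..<d}" using rho_image by (simp add: eq_card_imp_inj_on)
  then have "bij_betw rho {..<d} {..<d}" using rho_image by (simp add: bij_betw_def)
  moreover have "bij_betw rho {d..} {d..}"
  proof -
    have "bij_betw id {d..} {d..}" by simp
    then show ?thesis by (rule bij_betw_cong[THEN iffD1, rotated]) (simp add: rho_def)
  qed
  ultimately have "bij_betw rho ({..<d} \<union> {d..}) ({..<d} \<union> {d..})"
    by (rule bij_betw_combine) auto
  moreover have "{..<d} \<union> {d..} = UNIV" by auto
  ultimately show ?thesis by simp
qed

definition rho_pow :: "int \<Rightarrow> nat \<Rightarrow> nat" where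
  "rho_pow = (SOME z. z 0 = id \<and> (\<forall>k x. z (k + 1) x = rho (z k x)) \<and> (\<forall>k. z k ` {..<d} = {..<d}))"

lemma rho_pow: "rho_pow 0 = id" "rho_pow (k + 1) x = rho (rho_pow k x)"
  "rho_pow k ` {..<d} = {..<d}"
proof -
  have "\<exists>z :: int \<Rightarrow> nat \<Rightarrow> nat. z 0 = id \<and> (\<forall>k x. z (k + 1) x = rho (z k x)) \<and>
      (\<forall>k. z k ` {..<d} = {..<d})"
    using int_powers[OF bij_rho rho_image] by metis
  from someI_ex[OF this] have "rho_pow 0 = id \<and> (\<forall>k x. rho_pow (k + 1) x = rho (rho_pow k x)) \<and>
      (\<forall>k. rho_pow k ` {..<d} = {..<d})"
    unfolding rho_pow_def .
  then show "rho_pow 0 = id" "rho_pow (k + 1) x = rho (rho_pow k x)"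
    "rho_pow k ` {..<d} = {..<d}" by simp_all
qed

text \<open>The index is moved back to layer 0, and the colour found there is permuted once per
  period; so the shift by \<open>l\<close> acts on rows as \<open>rho\<close>.\<close>

definition row :: "int \<Rightarrow> nat" where "row m = rho_pow (lev m) (f (m - lev m * l))"

lemma lev_base: "lev (m - lev m * l) = 0"
  using lev_shift[of m "- lev m"] by simp

lemma row_lt: "row m < d"
  using f_lt[OF lev_0_Q[OF lev_base]] rho_pow(3)[of "lev m"] unfolding row_def by blast

lemma row_shift: "row (m + l) = rho (row m)"
proof -
  have e: "lev (m + l) = lev m + 1" using lev_shift[of m 1] by simp
  have "m + l - (lev m + 1) * l = m - lev m * l" by (simp add: algebra_simps)
  then show ?thesis unfolding row_def e rho_pow(2) by (rule arg_cong[where f = "\<lambda>x. rho (rho_pow (lev m) (f x))"])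
qed

text \<open>The point at issue is the upper end of \<open>Q\<close>, which has layer 1. There the
  row is computed from the layer above, and the definition of \<open>rho\<close> makes it agree with
  the colour; this is the gluing.\<close>

lemma row_Q: "m \<in> Q \<Longrightarrow> row m = f m"
proof -
  have 0: "row x = f x" if "lev x = 0" for x using that by (simp add: row_def rho_pow(1))
  assume "m \<in> Q"
  then consider "lev m = 0" | "m - l \<in> A" using Q_cases by blast
  then show ?thesis
  proof cases
    case 2
    have "row m = rho (row (m - l))" using row_shift[of "m - l"] by simp
    also have "row (m - l) = f (m - l)" using 0 lev_A 2 by blast
    finally show ?thesis using rho_f[OF 2] by simp
  qed (rule 0)
qed

lemma row_shift_eq: "row (x + k * l) = row (y + k * l) \<longleftrightarrow> row x = row y"
proof -
  have 1: "row (x + l) = row (y + l) \<longleftrightarrow> row x = row y" for x y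
    by (simp add: row_shift inj_eq[OF bij_is_inj[OF bij_rho]])
  show ?thesis
  proof (induction k rule: int_induct[of _ 0])
    case (step1 i)
    then show ?case using 1[of "x + i * l" "y + i * l"] by (simp add: algebra_simps)
  next
    case (step2 i)
    then show ?case using 1[of "x + (i - 1) * l" "y + (i - 1) * l"] by (simp add: algebra_simps)
  qed simp
qed

text \<open>Back in \<open>Q\<close>, the element \<open>b + l\<close> of the colour of
  \<open>?m\<close> is comparable with \<open>?m\<close>. It is not under \<open>?m\<close> without
  equality, since \<open>?m\<close> is itself under some \<open>b' + l\<close> of the same
  antichain.\<close>

lemma row_up: "\<exists>e. e - (lev m + 1) * l \<in> A \<and> row e = row m \<and> lq m e"
proof -
  let ?k = "lev m" let ?m = "m - ?k * l"
  have Q: "?m \<in> Q" using lev_0_Q lev_base by blast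
  then have "f ?m \<in> (\<lambda>a. f (a + l)) ` A" using f_lt f_Al(2) by auto
  then obtain b where b: "b \<in> A" "f (b + l) = f ?m" by auto
  obtain b' where b': "b' \<in> A" "lq ?m (b' + l)" using Q by (auto simp: Q_def)
  have "lq ?m (b + l)"
  proof (rule ccontr)
    assume n: "\<not> lq ?m (b + l)"
    then have "lq (b + l) ?m" using f_cmp[OF Q A_Q(2)[OF b(1)]] b by auto
    then have "lq (b + l) (b' + l)" using lq_trans b' by blast
    then have "b = b'" using A_eq b b' lq_shift1 by blast
    then show False using n b' by blast
  qed
  then have "lq m (b + l + ?k * l)" using lq_shift[of ?m ?k "b + l"] by simp
  moreover have "row (b + l + ?k * l) = row m"
    using row_shift_eq[of "b + l" ?k ?m] row_Q[OF Q] row_Q[OF A_Q(2)[OF b(1)]] b by simp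
  ultimately show ?thesis using b(1)
    by (intro exI[of _ "b + l + ?k * l"]) (simp add: algebra_simps)
qed

lemma row_down: "\<exists>e. e - lev m * l \<in> A \<and> row e = row m \<and> lq e m"
proof -
  let ?k = "lev m" let ?m = "m - ?k * l"
  have Q: "?m \<in> Q" using lev_0_Q lev_base by blast
  then have "f ?m \<in> f ` A" using f_lt f_A(2) by auto
  then obtain b where b: "b \<in> A" "f b = f ?m" by auto
  obtain b' where b': "b' \<in> A" "lq b' ?m" using Q by (auto simp: Q_def)
  have "lq b ?m"
  proof (rule ccontr)
    assume n: "\<not> lq b ?m"
    then have "lq ?m b" using f_cmp[OF Q A_Q(1)[OF b(1)]] b by auto
    then have "lq b' b" using lq_trans b' by blast
    then have "b' = b" using A_eq b b' by blast
    then show False using n b' by blast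
  qed
  then have "lq (b + ?k * l) m" using lq_shift[of b ?k ?m] by simp
  moreover have "row (b + ?k * l) = row m"
    using row_shift_eq[of b ?k ?m] row_Q[OF Q] row_Q[OF A_Q(1)[OF b(1)]] b by simp
  ultimately show ?thesis using b(1) by (intro exI[of _ "b + ?k * l"]) simp
qed

text \<open>Each translate of \<open>A\<close> meets a row in at most one point, so the elements
  found by \<open>row_up\<close> from one layer and by \<open>row_down\<close> from the next
  coincide.\<close>

lemma row_mark:
  assumes "e - k * l \<in> A" "e' - k * l \<in> A" "row e = row e'" shows "e = e'"
proof -
  have "row (e - k * l) = row (e' - k * l)" using assms(3) row_shift_eq[of e "- k" e'] by simp
  then have "f (e - k * l) = f (e' - k * l)" using row_Q A_Q(1) assms by simp
  then show ?thesis using f_A(1) assms(1,2) by (auto dest: inj_onD)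
qed

text \<open>Climb from \<open>m\<close> along the points of the row on the successive translates of
  \<open>A\<close>. The one that opens the layer of \<open>m'\<close> lies under
  \<open>m'\<close>.\<close>

lemma row_chain_lev:
  assumes "row m = row m'" "lev m < lev m'" shows "lq m m'"
proof -
  have "lev m + 1 \<le> lev m'" using assms(2) by simp
  then have "\<exists>e. e - lev m' * l \<in> A \<and> row e = row m \<and> lq m e"
  proof (induction rule: int_ge_induct)
    case base
    show ?case by (rule row_up)
  next
    case (step k)
    then obtain e where e: "e - k * l \<in> A" "row e = row m" "lq m e" by blast
    have "lev e = k" using lev_shift[of "e - k * l" k] lev_A[OF e(1)] by simp
    then obtain e' where "e' - (k + 1) * l \<in> A" "row e' = row e" "lq e e'"
      using row_up[of e] by blast
    then show ?case using e lq_trans by metis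
  qed
  then obtain e where e: "e - lev m' * l \<in> A" "row e = row m" "lq m e" by blast
  obtain e' where e': "e' - lev m' * l \<in> A" "row e' = row m'" "lq e' m'" using row_down by blast
  have "e = e'" using row_mark e e' assms(1) by metis
  then show ?thesis using lq_trans e e' by blast
qed

lemma row_chain: assumes "row m = row m'" shows "lq m m' \<or> lq m' m"
proof -
  consider "lev m < lev m'" | "lev m' < lev m" | "lev m = lev m'" by linarith
  then show ?thesis
  proof cases
    case 3
    let ?k = "lev m"
    have Q: "m - ?k * l \<in> Q" "m' - ?k * l \<in> Q"
      using lev_0_Q[OF lev_base[of m]] lev_0_Q[OF lev_base[of m']] unfolding 3 by simp_all
    have "row (m - ?k * l) = row (m' - ?k * l)" using assms row_shift_eq[of m "- ?k" m'] by simp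
    then have "f (m - ?k * l) = f (m' - ?k * l)" using row_Q Q by simp
    then have "lq (m - ?k * l) (m' - ?k * l) \<or> lq (m' - ?k * l) (m - ?k * l)" using f_cmp Q by blast
    then show ?thesis using lq_shift[of m "- ?k" m'] lq_shift[of m' "- ?k" m] by simp
  qed (use row_chain_lev assms in metis)+
qed

lemma row_ex: assumes "i < d" shows "\<exists>e. e - k * l \<in> A \<and> row e = i"
proof -
  have "i \<in> rho_pow k ` f ` A" using assms f_A(2) rho_pow(3)[of k] by auto
  then obtain a where a: "a \<in> A" "rho_pow k (f a) = i" by auto
  have "lev (a + k * l) = k" using lev_shift[of a k] lev_A[OF a(1)] by simp
  then have "row (a + k * l) = i" using a by (simp add: row_def)
  then show ?thesis using a by (intro exI[of _ "a + k * l"]) simp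
qed

lemma row_unbounded:
  assumes "i < d" shows "\<exists>m\<in>{m. row m = i}. N < m" "\<exists>m\<in>{m. row m = i}. m < N"
proof -
  define b where "b = \<bar>N\<bar> + \<bar>Min A\<bar> + \<bar>Max A\<bar> + 1"
  have 1: "b * 1 \<le> b * l" using l_pos by (intro mult_left_mono) (auto simp: b_def)
  have 2: "N < Min A + b" "Max A - b < N" unfolding b_def by linarith+
  obtain e where e: "e - b * l \<in> A" "row e = i" using row_ex assms by blast
  then have "N < e" using Min_le[OF fin_A e(1)] 1 2 by simp
  then show "\<exists>m\<in>{m. row m = i}. N < m" using e by blast
  obtain e where e: "e - (- b) * l \<in> A" "row e = i" using row_ex assms by blast
  then have "e < N" using Max_ge[OF fin_A e(1)] 1 2 by simp
  then show "\<exists>m\<in>{m. row m = i}. m < N" using e by blast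
qed

lemma row_enum:
  assumes "i < d"
  shows "\<exists>e :: int \<Rightarrow> int. strict_mono e \<and> range e = {m. row m = i} \<and> e 0 \<in> A"
proof -
  obtain a where a: "a - 0 * l \<in> A" "row a = i" using row_ex assms by blast
  obtain e :: "int \<Rightarrow> int" where "strict_mono e" "range e = {m. row m = i}" "e 0 = a"
    using int_set_enum[OF row_unbounded(1)[OF assms] row_unbounded(2)[OF assms], of a] a(2) by blast
  then show ?thesis using a by (intro exI[of _ e]) simp
qed

text \<open>Position \<open>n\<close> in row \<open>i\<close>, counted from the element of
  \<open>A\<close>. This choice of origin makes the given cube the unit cube.\<close>

definition cell :: "nat \<Rightarrow> int \<Rightarrow> int" where
  "cell i = (SOME e. strict_mono e \<and> range e = {m. row m = i} \<and> e 0 \<in> A)"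

lemma cell:
  assumes "i < d" shows "strict_mono (cell i)" "range (cell i) = {m. row m = i}" "cell i 0 \<in> A"
  using someI_ex[OF row_enum[OF assms]] unfolding cell_def by simp_all

lemma row_cell: "i < d \<Longrightarrow> row (cell i n) = i"
  using cell(2) by blast

lemma cell_ex: "\<exists>n. m = cell (row m) n"
  using cell(2)[OF row_lt, of m] by (metis (mono_tags) mem_Collect_eq rangeE)

lemma cell_bij: "bij_betw (\<lambda>(i, n). cell i n) ({..<d} \<times> UNIV) UNIV"
proof (rule bij_betw_imageI)
  show "inj_on (\<lambda>(i, n). cell i n) ({..<d} \<times> UNIV)"
  proof (rule inj_onI)
    fix p q :: "nat \<times> int"
    assume p: "p \<in> {..<d} \<times> UNIV" "q \<in> {..<d} \<times> UNIV"
      and e: "(case p of (i, n) \<Rightarrow> cell i n) = (case q of (i, n) \<Rightarrow> cell i n)"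
    obtain i m j n where pq: "p = (i, m)" "q = (j, n)" by fastforce
    have ij: "i < d" "j < d" "cell i m = cell j n" using p e pq by auto
    then have "i = j" using row_cell[of i m] row_cell[of j n] by simp
    then show "p = q" using ij strict_mono_eq[OF cell(1)[OF ij(1)]] pq by simp
  qed
  have "m \<in> (\<lambda>(i, n). cell i n) ` ({..<d} \<times> UNIV)" for m
  proof -
    obtain n where "m = cell (row m) n" using cell_ex by blast
    then show ?thesis using row_lt[of m] by (intro image_eqI[of _ _ "(row m, n)"]) simp_all
  qed
  then show "(\<lambda>(i, n). cell i n) ` ({..<d} \<times> UNIV) = UNIV" by (intro equalityI subset_UNIV subsetI)
qed

lemma cell_lq: assumes "i < d" shows "lq (cell i m) (cell i n) \<longleftrightarrow> m \<le> n"
proof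
  assume "lq (cell i m) (cell i n)"
  then show "m \<le> n" using lq_le strict_mono_less_eq[OF cell(1)[OF assms]] by blast
next
  assume "m \<le> n"
  then have "cell i m \<le> cell i n" using strict_mono_less_eq[OF cell(1)[OF assms]] by blast
  moreover have "lq (cell i m) (cell i n) \<or> lq (cell i n) (cell i m)"
    using row_chain row_cell assms by metis
  ultimately show "lq (cell i m) (cell i n)" using lq_le by fastforce
qed

text \<open>The shift by \<open>l\<close> carries row \<open>i\<close> increasingly onto row
  \<open>rho i\<close>, and two increasing enumerations of one set differ by a constant.\<close>

lemma cell_shift: assumes "i < d" shows "\<exists>s. \<forall>n. cell i n + l = cell (rho i) (n + s)"
proof -
  have r: "rho i < d" using rho_image assms by blast
  have pre: "row (m - l) = i \<longleftrightarrow> row m = rho i" for m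
    using row_shift[of "m - l"] inj_eq[OF bij_is_inj[OF bij_rho]] by simp
  have "{m. row m = rho i} = (\<lambda>m. m + l) ` {m. row m = i}"
  proof (intro equalityI subsetI)
    fix m assume "m \<in> {m. row m = rho i}"
    then show "m \<in> (\<lambda>m. m + l) ` {m. row m = i}"
      using pre[of m] by (intro image_eqI[of _ _ "m - l"]) simp_all
  next
    fix m assume "m \<in> (\<lambda>m. m + l) ` {m. row m = i}"
    then obtain m' where "m = m' + l" "row m' = i" by blast
    then show "m \<in> {m. row m = rho i}" using row_shift[of m'] by simp
  qed
  then have "range (cell (rho i)) = (\<lambda>m. m + l) ` {m. row m = i}"
    unfolding cell(2)[OF r] .
  then have "range (cell (rho i)) = range (\<lambda>n. cell i n + l)"
    unfolding cell(2)[OF assms, symmetric] by (simp add: image_image)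
  moreover have "strict_mono (\<lambda>n. cell i n + l)"
    using cell(1)[OF assms] by (simp add: strict_mono_def)
  ultimately show ?thesis using int_enum_shift[OF cell(1)[OF r]] by metis
qed

lemma cell_saturated:
  assumes "m \<in> Q" "n \<in> Q" "m \<in> range (cell 0)" "n \<in> range (cell 0)" "lq m x" "lq x n" "x \<noteq> m" "x \<noteq> n"
  shows "\<exists>y\<in>Q. y \<in> range (cell 0) \<and> lq m y \<and> lq y n \<and> y \<noteq> m \<and> y \<noteq> n"
proof -
  have d: "0 < d" using row_lt[of 0] by simp
  have r: "y \<in> range (cell 0) \<longleftrightarrow> f y = 0" if "y \<in> Q" for y
    unfolding cell(2)[OF d] using row_Q[OF that] by simp
  have "f m = 0" "f n = 0" using assms r by simp_all
  then have "\<exists>y\<in>Q. f y = 0 \<and> lq m y \<and> lq y n \<and> y \<noteq> m \<and> y \<noteq> n"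
    using sat assms unfolding saturated_def by simp
  then show ?thesis using r by blast
qed

end

context max_antichain
begin

text \<open>The chains become the coordinate directions: \<rho> tells how the generator permutes
  them and \<open>s\<close> how far it translates along each. The last clause is the gap-freeness
  behind the tightness claim.\<close>

theorem chain_decomposition:
  obtains c :: "nat \<Rightarrow> int \<Rightarrow> int" and \<rho> :: "nat \<Rightarrow> nat" and s :: "nat \<Rightarrow> int" where
    "\<And>i. i < d \<Longrightarrow> c i 0 \<in> A"
    "bij_betw (\<lambda>(i, n). c i n) ({..<d} \<times> UNIV) UNIV"
    "\<And>i m n. i < d \<Longrightarrow> lq (c i m) (c i n) \<longleftrightarrow> m \<le> n"
    "\<rho> ` {..<d} = {..<d}" "\<And>i n. i < d \<Longrightarrow> c i n + l = c (\<rho> i) (n + s i)"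
    "\<And>m n x. m \<in> Q \<Longrightarrow> n \<in> Q \<Longrightarrow> m \<in> range (c 0) \<Longrightarrow> n \<in> range (c 0) \<Longrightarrow>
      lq m x \<Longrightarrow> lq x n \<Longrightarrow> x \<noteq> m \<Longrightarrow> x \<noteq> n \<Longrightarrow>
      \<exists>y\<in>Q. y \<in> range (c 0) \<and> lq m y \<and> lq y n \<and> y \<noteq> m \<and> y \<noteq> n"
proof -
  obtain f where "colouring f \<and> saturated f" using ex_saturated by (rule exE)
  then interpret coloured_antichain lq l A d f by unfold_locales simp_all
  have "\<forall>i. \<exists>s. i < d \<longrightarrow> (\<forall>n. cell i n + l = cell (rho i) (n + s))" using cell_shift by blast
  then obtain s where s: "\<forall>i. i < d \<longrightarrow> (\<forall>n. cell i n + l = cell (rho i) (n + s i))" by metis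
  show ?thesis
  proof (rule that)
    show "cell i n + l = cell (rho i) (n + s i)" if "i < d" for i n using s that by simp
  qed (fact cell(3) cell_bij cell_lq rho_image cell_saturated)+
qed

end

section \<open>The integer cubing\<close>

lemma int_verts: "verts (int_cubing d) = {x. \<forall>i\<ge>d. x i = 0}"
  by (simp add: int_cubing_def)

definition box :: "(nat \<Rightarrow> int) \<Rightarrow> nat set \<Rightarrow> (nat \<Rightarrow> int) set" where
  "box a S = {x. \<forall>i. x i = a i \<or> i \<in> S \<and> x i = a i + 1}"

lemma int_cubes: "cubes (int_cubing d) = {box a S |a S. a \<in> verts (int_cubing d) \<and> S \<subseteq> {..<d}}"
  by (simp add: int_cubing_def box_def)

lemma box_mem: "x \<in> box a S \<longleftrightarrow> (\<forall>i. x i = a i \<or> i \<in> S \<and> x i = a i + 1)"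
  by (simp add: box_def)

lemma box_empty: "box a {} = {a}"
  by (auto simp: box_def)

lemma box_single: "box a {i} = {a, a(i := a i + 1)}"
proof
  show "box a {i} \<subseteq> {a, a(i := a i + 1)}"
  proof
    fix x assume x: "x \<in> box a {i}"
    show "x \<in> {a, a(i := a i + 1)}"
    proof (cases "x i = a i")
      case True
      then have "x = a" using x by (intro ext) (metis box_mem singletonD)
      then show ?thesis by simp
    next
      case False
      then have "x = a(i := a i + 1)" using x by (intro ext) (metis box_mem fun_upd_apply singletonD)
      then show ?thesis by simp
    qed
  qed
qed (auto simp: box_mem)

lemma int_edges_iff:
  "e \<in> edges (int_cubing d) \<longleftrightarrow>
    (\<exists>a i. a \<in> verts (int_cubing d) \<and> i < d \<and> e = {a, a(i := a i + 1)})"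
proof
  assume "e \<in> edges (int_cubing d)"
  then obtain a S where e: "e = box a S" "a \<in> verts (int_cubing d)" "S \<subseteq> {..<d}" "card e = 2"
    unfolding edges_def int_cubes by blast
  have "S \<noteq> {}" using e box_empty[of a] by auto
  then obtain i where i: "i \<in> S" by blast
  have "S = {i}"
  proof (rule ccontr)
    assume "S \<noteq> {i}"
    then obtain j where j: "j \<in> S" "j \<noteq> i" using i by blast
    have "a i + 1 \<noteq> a i" by simp
    then have ne: "a \<noteq> a(i := a i + 1)" "a \<noteq> a(j := a j + 1)" "a(i := a i + 1) \<noteq> a(j := a j + 1)"
      using j(2) by (auto simp: fun_eq_iff intro: exI[of _ i] exI[of _ j])
    have "{a, a(i := a i + 1), a(j := a j + 1)} \<subseteq> e" using i j e by (auto simp: box_mem)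
    moreover have "finite e" using e(4) by (intro card_ge_0_finite) simp
    ultimately have "card {a, a(i := a i + 1), a(j := a j + 1)} \<le> card e" by (intro card_mono)
    then show False using ne e(4) by simp
  qed
  then show "\<exists>a i. a \<in> verts (int_cubing d) \<and> i < d \<and> e = {a, a(i := a i + 1)}"
    using e box_single by blast
next
  assume "\<exists>a i. a \<in> verts (int_cubing d) \<and> i < d \<and> e = {a, a(i := a i + 1)}"
  then obtain a i where a: "a \<in> verts (int_cubing d)" "i < d" "e = {a, a(i := a i + 1)}" by blast
  have "a \<noteq> a(i := a i + 1)" by (auto simp: fun_eq_iff intro: exI[of _ i])
  then have "card e = 2" using a by simp
  moreover have "e \<in> cubes (int_cubing d)"
    unfolding int_cubes using a box_single[of a i] by blast
  ultimately show "e \<in> edges (int_cubing d)" by (simp add: edges_def)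
qed

lemma int_adj:
  "adj (int_cubing d) x y \<longleftrightarrow>
    x \<in> verts (int_cubing d) \<and> (\<exists>i<d. y = x(i := x i + 1) \<or> y = x(i := x i - 1))"
proof
  assume "adj (int_cubing d) x y"
  then obtain a i where a: "a \<in> verts (int_cubing d)" "i < d" "{x, y} = {a, a(i := a i + 1)}"
    unfolding adj_def int_edges_iff by blast
  then consider "x = a" "y = a(i := a i + 1)" | "y = a" "x = a(i := a i + 1)"
    unfolding doubleton_eq_iff by blast
  then show "x \<in> verts (int_cubing d) \<and> (\<exists>i<d. y = x(i := x i + 1) \<or> y = x(i := x i - 1))"
  proof cases
    case 2
    then have "y = x(i := x i - 1)" by simp
    moreover have "x \<in> verts (int_cubing d)" using a 2 by (simp add: int_verts)
    ultimately show ?thesis using a(2) by blast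
  qed (use a in blast)
next
  assume x: "x \<in> verts (int_cubing d) \<and> (\<exists>i<d. y = x(i := x i + 1) \<or> y = x(i := x i - 1))"
  then obtain i where i: "i < d" "y = x(i := x i + 1) \<or> y = x(i := x i - 1)" by blast
  from i(2) show "adj (int_cubing d) x y"
  proof
    assume "y = x(i := x i - 1)"
    then have "{x, y} = {y, y(i := y i + 1)}" "y \<in> verts (int_cubing d)"
      using x i(1) by (auto simp: int_verts)
    then show ?thesis unfolding adj_def int_edges_iff using i(1) by blast
  qed (use x i(1) in \<open>unfold adj_def int_edges_iff, blast\<close>)
qed

lemma coord_halfspace_eq: "coord_halfspace d i n = {x \<in> verts (int_cubing d). n < x i}"
proof -
  have "real_of_int n + 1 / 2 \<le> real_of_int m \<longleftrightarrow> n < m" for m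
  proof
    assume "real_of_int n + 1 / 2 \<le> real_of_int m"
    then have "real_of_int n < real_of_int m" by linarith
    then show "n < m" by simp
  next
    assume "n < m"
    then have "real_of_int n + 1 \<le> real_of_int m" by linarith
    then show "real_of_int n + 1 / 2 \<le> real_of_int m" by linarith
  qed
  then show ?thesis by (simp add: coord_halfspace_def)
qed

text \<open>\<open>u\<close> lies in the coordinate box spanned by \<open>x\<close> and
  \<open>y\<close>. A path inside the box keeps all coordinates that \<open>x\<close> and
  \<open>y\<close> share, and meets no coordinate hyperplane other than those that separate
  them.\<close>

definition between :: "(nat \<Rightarrow> int) \<Rightarrow> (nat \<Rightarrow> int) \<Rightarrow> (nat \<Rightarrow> int) \<Rightarrow> bool" where
  "between x y u \<longleftrightarrow> (\<forall>k. min (x k) (y k) \<le> u k \<and> u k \<le> max (x k) (y k))"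

lemma betweenD: "between x y u \<Longrightarrow> min (x k) (y k) \<le> u k \<and> u k \<le> max (x k) (y k)"
  by (simp add: between_def)

lemma between_trans: "between x y z \<Longrightarrow> between z y u \<Longrightarrow> between x y u"
  unfolding between_def min_def max_def by (smt (verit))

lemma int_path_between:
  assumes "x \<in> verts (int_cubing d)" "y \<in> verts (int_cubing d)"
  shows "(\<lambda>u w. adj (int_cubing d) u w \<and> between x y u \<and> between x y w)\<^sup>*\<^sup>* x y"
  using assms(1)
proof (induction "\<Sum>i<d. nat \<bar>x i - y i\<bar>" arbitrary: x rule: less_induct)
  case less
  let ?R = "\<lambda>x u w. adj (int_cubing d) u w \<and> between x y u \<and> between x y w"
  show ?case
  proof (cases "x = y")
    case False
    then obtain j where j: "x j \<noteq> y j" by blast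
    then have jd: "j < d" using less.prems assms(2) by (force simp: int_verts not_less[symmetric])
    define x' where "x' = x(j := if x j < y j then x j + 1 else x j - 1)"
    have x': "x' \<in> verts (int_cubing d)" using less.prems jd by (auto simp: x'_def int_verts)
    have bd: "between x y x'" using j by (auto simp: x'_def between_def)
    have "(\<Sum>i<d. nat \<bar>x' i - y i\<bar>) < (\<Sum>i<d. nat \<bar>x i - y i\<bar>)"
    proof (rule sum_strict_mono_ex1)
      show "\<forall>i\<in>{..<d}. nat \<bar>x' i - y i\<bar> \<le> nat \<bar>x i - y i\<bar>" using j by (auto simp: x'_def)
      show "\<exists>i\<in>{..<d}. nat \<bar>x' i - y i\<bar> < nat \<bar>x i - y i\<bar>"
        using j jd by (intro bexI[of _ j]) (auto simp: x'_def)
    qed simp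
    from less.hyps[OF this x'] have 1: "(?R x')\<^sup>*\<^sup>* x' y" .
    have 2: "?R x' \<le> ?R x"
    proof (intro predicate2I)
      fix u w assume uw: "?R x' u w"
      then show "?R x u w" using between_trans[OF bd] by blast
    qed
    have 3: "(?R x)\<^sup>*\<^sup>* x' y" by (rule rtranclp_mono[OF 2, THEN predicate2D, OF 1])
    have "adj (int_cubing d) x x'"
      unfolding int_adj using less.prems jd by (auto simp: x'_def)
    then have "?R x x x'" using bd by (simp add: between_def)
    then show ?thesis by (rule converse_rtranclp_into_rtranclp[where r = "?R x", OF _ 3])
  qed simp
qed

text \<open>Reflecting the cube in direction \<open>i\<close> exchanges the ends of the first edge.
  It preserves the cube and the first edge, hence also \<open>f\<close>, and it has no fixed vertex;
  so \<open>f\<close> has direction \<open>i\<close> and the same position in it.\<close>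

lemma int_opposite:
  assumes "opposite_edges (int_cubing d) {b, b(i := b i + 1)} f"
  shows "\<exists>q. q i = b i \<and> f = {q, q(i := q i + 1)}"
proof -
  let ?b = "b(i := b i + 1)"
  have f: "f \<in> edges (int_cubing d)" "{b, ?b} \<inter> f = {}" "{b, ?b} \<union> f \<in> cubes (int_cubing d)"
    using assms by (auto simp: opposite_edges_def)
  obtain a S where box: "{b, ?b} \<union> f = box a S" using f(3) unfolding int_cubes by blast
  have bb: "b \<in> box a S" "?b \<in> box a S" using box by blast+
  have bi: "b i = a i" "i \<in> S" using bb[unfolded box_mem, THEN spec[of _ i]] by auto
  \<comment> \<open>Exchanges the two possible values \<open>a i\<close> and \<open>a i + 1\<close>
    of the coordinate.\<close>
  define flip where "flip x = x(i := 2 * a i + 1 - x i)" for x :: "nat \<Rightarrow> int"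
  have ff: "flip (flip x) = x" for x by (auto simp: flip_def)
  have fb: "flip b = ?b" "flip ?b = b" using bi by (auto simp: flip_def)
  obtain p p' where p: "f = {p, p'}" "p \<noteq> p'" using f(1) by (auto simp: edges_def card_2_iff)
  have pb: "p \<in> box a S" using box p by blast
  have pi: "p i = a i \<or> p i = a i + 1" using pb by (auto simp: box_mem)
  have "flip p k = a k \<or> k \<in> S \<and> flip p k = a k + 1" for k
    using pi bi pb by (cases "k = i") (auto simp: flip_def box_mem)
  then have "flip p \<in> box a S" unfolding box_mem by blast
  moreover have "flip p \<notin> {b, ?b}"
  proof
    assume "flip p \<in> {b, ?b}"
    then have "flip (flip p) \<in> {b, ?b}" using fb by auto
    then show False using f(2) p ff by auto
  qed
  ultimately have "flip p \<in> f" using box by blast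
  moreover have "flip p \<noteq> p" unfolding flip_def fun_eq_iff by (auto intro!: exI[of _ i]) presburger
  ultimately have fp: "f = {p, flip p}" using p by auto
  from pi show ?thesis
  proof
    assume "p i = a i"
    then have "flip p = p(i := p i + 1)" by (simp add: flip_def)
    then show ?thesis using fp \<open>p i = a i\<close> bi by (intro exI[of _ p]) simp
  next
    assume pi: "p i = a i + 1"
    then have "flip p i = a i" "p = (flip p)(i := flip p i + 1)" by (auto simp: flip_def)
    moreover have "f = {flip p, p}" using fp by blast
    ultimately show ?thesis using bi by (intro exI[of _ "flip p"]) simp
  qed
qed

lemma int_hypD:
  assumes "f \<in> hyp (int_cubing d) {b, b(i := b i + 1)}"
  shows "\<exists>q. q i = b i \<and> f = {q, q(i := q i + 1)}"
proof -
  have "(opposite_edges (int_cubing d))\<^sup>*\<^sup>* {b, b(i := b i + 1)} f" using assms by (simp add: hyp_def)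
  then show ?thesis
  proof (induction rule: rtranclp_induct)
    case (step f f')
    then obtain q where q: "q i = b i" "f = {q, q(i := q i + 1)}" by blast
    have "opposite_edges (int_cubing d) {q, q(i := q i + 1)} f'" using step(2) unfolding q(2) .
    then have "\<exists>q'. q' i = q i \<and> f' = {q', q'(i := q' i + 1)}" by (rule int_opposite)
    then show ?case unfolding q(1) .
  qed blast
qed

lemma int_square:
  assumes "u \<in> verts (int_cubing d)" "i < d" "j < d" "i \<noteq> j"
  shows "opposite_edges (int_cubing d) {u, u(i := u i + 1)}
    {u(j := u j + 1), u(i := u i + 1, j := u j + 1)}"
proof -
  let ?w = "u(j := u j + 1)"
  have w: "?w \<in> verts (int_cubing d)" using assms by (simp add: int_verts)
  have eq: "u(i := u i + 1, j := u j + 1) = ?w(i := ?w i + 1)" using assms(4) by (auto simp: fun_eq_iff)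
  have "box u {i, j} = {u, u(i := u i + 1)} \<union> {?w, ?w(i := ?w i + 1)}" (is "_ = ?R")
  proof
    show "box u {i, j} \<subseteq> ?R"
    proof
      fix x assume x: "x \<in> box u {i, j}"
      have o: "x k = u k" if "k \<noteq> i" "k \<noteq> j" for k using x that by (auto simp: box_mem)
      have "x = u(i := x i, j := x j)" using o by (auto simp: fun_eq_iff)
      moreover have "x i = u i \<or> x i = u i + 1" "x j = u j \<or> x j = u j + 1"
        using x by (auto simp: box_mem)
      moreover have "u(i := u i, j := u j) = u" "u(i := u i, j := u j + 1) = ?w"
        "u(i := u i + 1, j := u j) = u(i := u i + 1)" "u(i := u i + 1, j := u j + 1) = ?w(i := ?w i + 1)"
        using assms(4) by (auto simp: fun_eq_iff)
      ultimately show "x \<in> ?R" by (metis Un_iff insertCI)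
    qed
    show "?R \<subseteq> box u {i, j}" using assms(4) by (auto simp: box_mem)
  qed
  moreover have "box u {i, j} \<in> cubes (int_cubing d)" unfolding int_cubes using assms by blast
  moreover have "{u, u(i := u i + 1)} \<inter> {?w, ?w(i := ?w i + 1)} = {}"
  proof -
    have "x j = u j" if "x \<in> {u, u(i := u i + 1)}" for x using that assms(4) by auto
    moreover have "x j = u j + 1" if "x \<in> {?w, ?w(i := ?w i + 1)}" for x using that assms(4) by auto
    ultimately show ?thesis by fastforce
  qed
  ultimately show ?thesis
    unfolding opposite_edges_def eq int_edges_iff using assms w by metis
qed

text \<open>Walk from \<open>b\<close> to \<open>q\<close> with coordinate \<open>i\<close>
  constant; every step carries the edge in direction \<open>i\<close> across a square.\<close>

lemma int_hypI:
  assumes "b \<in> verts (int_cubing d)" "q \<in> verts (int_cubing d)" "i < d" "q i = b i"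
  shows "{q, q(i := q i + 1)} \<in> hyp (int_cubing d) {b, b(i := b i + 1)}"
proof -
  have up: "{u(j := u j + 1), u(j := u j + 1, i := u i + 1)} \<in> hyp (int_cubing d) {u, u(i := u i + 1)}"
    if "u \<in> verts (int_cubing d)" "j < d" "j \<noteq> i" for u j
    using int_square[OF that(1) assms(3) that(2)] that(3) unfolding hyp_def
    by (simp add: fun_upd_twist r_into_rtranclp)
  have "(\<lambda>u w. adj (int_cubing d) u w \<and> u i = b i \<and> w i = b i)\<^sup>*\<^sup>* b q"
    using int_path_between[OF assms(1,2)] by (rule rtranclp_mono[THEN predicate2D, rotated])
      (use assms(4) in \<open>auto dest!: betweenD[where k = i]\<close>)
  then show ?thesis
  proof (induction rule: rtranclp_induct)
    case base
    show ?case by (rule hyp_self)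
  next
    case (step u w)
    have "{w, w(i := w i + 1)} \<in> hyp (int_cubing d) {u, u(i := u i + 1)}"
    proof -
      obtain j where j: "j < d" "w = u(j := u j + 1) \<or> w = u(j := u j - 1)" "u \<in> verts (int_cubing d)"
        using step(2) unfolding int_adj by blast
      have ji: "j \<noteq> i" using j(2) step(2) by auto
      from j(2) show ?thesis
      proof
        assume "w = u(j := u j + 1)"
        then show ?thesis using up[OF j(3,1) ji] ji by simp
      next
        assume w: "w = u(j := u j - 1)"
        then have "u = w(j := w j + 1)" "w \<in> verts (int_cubing d)" using j by (auto simp: int_verts)
        then show ?thesis using up[of w j] j ji hyp_sym by (metis fun_upd_apply)
      qed
    qed
    then show ?case using step.IH hyp_trans by blast
  qed
qed

text \<open>The truth value of \<open>b i < x i\<close> can change only along an edge of the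
  hyperplane. Conversely, two vertices with the same value are joined inside the box they span,
  which contains no edge of the hyperplane.\<close>

lemma int_side:
  assumes b: "b \<in> verts (int_cubing d)" "i < d" and y: "y \<in> verts (int_cubing d)"
  shows "side (int_cubing d) {b, b(i := b i + 1)} y =
    {x \<in> verts (int_cubing d). b i < x i \<longleftrightarrow> b i < y i}"
proof (intro equalityI subsetI)
  fix x assume "x \<in> side (int_cubing d) {b, b(i := b i + 1)} y"
  then have "(\<lambda>u w. adj (int_cubing d) u w \<and> {u, w} \<notin> hyp (int_cubing d) {b, b(i := b i + 1)})\<^sup>*\<^sup>* y x"
    by (simp add: side_def)
  then show "x \<in> {x \<in> verts (int_cubing d). b i < x i \<longleftrightarrow> b i < y i}"
  proof (induction rule: rtranclp_induct)
    case (step u w)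
    obtain j where j: "j < d" "w = u(j := u j + 1) \<or> w = u(j := u j - 1)" "u \<in> verts (int_cubing d)"
      using step(2) unfolding int_adj by blast
    have w: "w \<in> verts (int_cubing d)" using j by (auto simp: int_verts)
    have "b i < u i \<longleftrightarrow> b i < w i"
    proof (rule ccontr)
      assume n: "\<not> ?thesis"
      then have ji: "j = i" using j(2) by (auto split: if_splits)
      from j(2) have "{u, w} \<in> hyp (int_cubing d) {b, b(i := b i + 1)}"
      proof
        assume w': "w = u(j := u j + 1)"
        then have "u i = b i" using n ji by auto
        then show ?thesis using int_hypI[OF b(1) j(3) b(2)] w' ji by simp
      next
        assume w': "w = u(j := u j - 1)"
        then have "w i = b i" "u = w(i := w i + 1)" using n ji by auto
        then show ?thesis using int_hypI[OF b(1) w b(2)] by (metis insert_commute)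
      qed
      then show False using step by blast
    qed
    then show ?case using step.IH w by simp
  qed (use y in simp)
next
  fix x assume x: "x \<in> {x \<in> verts (int_cubing d). b i < x i \<longleftrightarrow> b i < y i}"
  have "(\<lambda>u w. adj (int_cubing d) u w \<and> {u, w} \<notin> hyp (int_cubing d) {b, b(i := b i + 1)})\<^sup>*\<^sup>* y x"
  proof (rule rtranclp_mono[THEN predicate2D, rotated, OF int_path_between[OF y]])
    show "x \<in> verts (int_cubing d)" using x by simp
    show "(\<lambda>u w. adj (int_cubing d) u w \<and> between y x u \<and> between y x w)
      \<le> (\<lambda>u w. adj (int_cubing d) u w \<and> {u, w} \<notin> hyp (int_cubing d) {b, b(i := b i + 1)})"
    proof (intro predicate2I conjI notI)
      fix u w
      assume uw: "adj (int_cubing d) u w \<and> between y x u \<and> between y x w"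
      then show "adj (int_cubing d) u w" by blast
      assume "{u, w} \<in> hyp (int_cubing d) {b, b(i := b i + 1)}"
      then obtain q where "q i = b i" "{u, w} = {q, q(i := q i + 1)}" using int_hypD by blast
      then have "u i = b i \<and> w i = b i + 1 \<or> u i = b i + 1 \<and> w i = b i"
        by (auto simp: doubleton_eq_iff)
      moreover have "min (y i) (x i) \<le> u i \<and> u i \<le> max (y i) (x i) \<and>
        min (y i) (x i) \<le> w i \<and> w i \<le> max (y i) (x i)" using uw betweenD by blast
      ultimately show False using x by (auto simp: min_def max_def split: if_splits)
    qed
  qed
  then show "x \<in> side (int_cubing d) {b, b(i := b i + 1)} y" by (simp add: side_def)
qed

lemma coord_halfspace_in:
  assumes "i < d"
  shows "coord_halfspace d i n \<in> halfspaces (int_cubing d)"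
    "opp (int_cubing d) (coord_halfspace d i n) \<in> halfspaces (int_cubing d)"
proof -
  let ?b = "(\<lambda>k. 0)(i := n)" let ?y = "?b(i := ?b i + 1)"
  have b: "?b \<in> verts (int_cubing d)" "?y \<in> verts (int_cubing d)" using assms by (auto simp: int_verts)
  have e: "{?b, ?y} \<in> edges (int_cubing d)" unfolding int_edges_iff using b(1) assms by blast
  have "coord_halfspace d i n = side (int_cubing d) {?b, ?y} ?y"
    unfolding int_side[OF b(1) assms b(2)] coord_halfspace_eq by simp
  then show "coord_halfspace d i n \<in> halfspaces (int_cubing d)" using side_halfspace[OF e b(2)] by simp
  have "opp (int_cubing d) (coord_halfspace d i n) = side (int_cubing d) {?b, ?y} ?b"
    unfolding int_side[OF b(1) assms b(1)] coord_halfspace_eq opp_def by auto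
  then show "opp (int_cubing d) (coord_halfspace d i n) \<in> halfspaces (int_cubing d)"
    using side_halfspace[OF e b(1)] by simp
qed

text \<open>A single edge that enters \<open>K\<close> and is mapped to an edge determines the
  half-space, so the description in \<open>induced_map\<close> has no second solution.\<close>

lemma induced_map_eq:
  assumes "adj X x y" "x \<notin> K" "y \<in> K" "adj Y (\<phi> x) (\<phi> y)" and H: "H \<in> halfspaces Y"
    and cross: "\<And>x y. adj X x y \<Longrightarrow> x \<notin> K \<Longrightarrow> y \<in> K \<Longrightarrow> \<phi> x \<notin> H \<and> \<phi> y \<in> H" and sub: "\<phi> ` K \<subseteq> H"
  shows "induced_map X Y \<phi> K = H"
  unfolding induced_map_def
proof (rule the_equality)
  show "H \<in> halfspaces Y \<and> (\<forall>x y. adj X x y \<and> x \<notin> K \<and> y \<in> K \<longrightarrow> \<phi> x \<notin> H \<and> \<phi> y \<in> H) \<and> \<phi> ` K \<subseteq> H"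
    using H cross sub by blast
  fix H' assume H': "H' \<in> halfspaces Y \<and>
    (\<forall>x y. adj X x y \<and> x \<notin> K \<and> y \<in> K \<longrightarrow> \<phi> x \<notin> H' \<and> \<phi> y \<in> H') \<and> \<phi> ` K \<subseteq> H'"
  then have "H' = side Y {\<phi> x, \<phi> y} (\<phi> y)" using halfspace_unique[of H' Y "\<phi> x" "\<phi> y"] assms(1-4) by blast
  moreover have "H = side Y {\<phi> x, \<phi> y} (\<phi> y)" using halfspace_unique[OF H assms(4)] cross[OF assms(1-3)] by blast
  ultimately show "H' = H" by simp
qed

lemma coord_halfspace_inj:
  assumes "i < d" "j < d" "coord_halfspace d i m = coord_halfspace d j n"
  shows "i = j \<and> m = n"
proof -
  have mem: "x \<in> coord_halfspace d i m \<longleftrightarrow> x \<in> coord_halfspace d j n" for x using assms(3) by simp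
  have v: "(\<lambda>k. if k < d then N else 0)(i' := p) \<in> verts (int_cubing d)" if "i' < d" for N p i'
    using that by (auto simp: int_verts)
  have ij: "i = j"
  proof (rule ccontr)
    assume "i \<noteq> j"
    \<comment> \<open>The test point has all coordinates except the \<open>i\<close>-th above
      \<open>n\<close>, and the \<open>i\<close>-th equal to \<open>m\<close>: it belongs to the
      half-space in direction \<open>j\<close> and not to the one in direction
      \<open>i\<close>.\<close>
    then show False
      using mem[of "(\<lambda>k. if k < d then \<bar>n\<bar> + 1 else 0)(i := m)"] v[OF assms(1)] assms(1,2)
      unfolding coord_halfspace_eq by auto
  qed
  have "m < p \<longleftrightarrow> n < p" for p
    using mem[of "(\<lambda>k. if k < d then 0 else 0)(i := p)"] v[OF assms(1), of 0 p] ij unfolding coord_halfspace_eq by simp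
  from this[of m] this[of n] show ?thesis using ij by auto
qed

lemma coord_halfspace_neq_opp:
  assumes "i < d" "j < d"
  shows "coord_halfspace d i m \<noteq> opp (int_cubing d) (coord_halfspace d j n)"
proof
  assume e: "coord_halfspace d i m = opp (int_cubing d) (coord_halfspace d j n)"
  \<comment> \<open>A point beyond both thresholds, hence in both positive half-spaces.\<close>
  let ?x = "\<lambda>k. if k < d then \<bar>m\<bar> + \<bar>n\<bar> + 1 else 0"
  have "?x \<in> verts (int_cubing d)" by (simp add: int_verts)
  moreover have "?x \<in> coord_halfspace d i m \<longleftrightarrow> ?x \<in> opp (int_cubing d) (coord_halfspace d j n)"
    using e by simp
  ultimately show False using assms unfolding coord_halfspace_eq opp_def by auto
qed

lemma opp_opp: "H \<subseteq> verts X \<Longrightarrow> opp X (opp X H) = H"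
  by (auto simp: opp_def)

definition l1 :: "nat \<Rightarrow> (nat \<Rightarrow> int) \<Rightarrow> (nat \<Rightarrow> int) \<Rightarrow> nat" where
  "l1 d x y = (\<Sum>i<d. nat \<bar>x i - y i\<bar>)"

lemma int_relpowp_l1: "(adj (int_cubing d) ^^ n) x y \<Longrightarrow> l1 d x y \<le> n"
proof (induction n arbitrary: y)
  case 0
  then show ?case by (simp add: l1_def)
next
  case (Suc n)
  then obtain z where z: "(adj (int_cubing d) ^^ n) x z" "adj (int_cubing d) z y" by auto
  then obtain j where j: "j < d" "y = z(j := z j + 1) \<or> y = z(j := z j - 1)" unfolding int_adj by blast
  have "l1 d x y \<le> (\<Sum>i<d. nat \<bar>x i - z i\<bar> + (if i = j then 1 else 0))"
    unfolding l1_def by (intro sum_mono) (use j in auto)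
  also have "\<dots> = l1 d x z + 1" using j by (simp add: l1_def sum.distrib)
  finally show ?case using Suc.IH[OF z(1)] by simp
qed

section \<open>Vertices and cubes of the essential complex\<close>

lemma sym_diff_toggle: "(A - B) \<union> (B - A) = {x} \<longleftrightarrow> B = toggle x A"
proof
  assume e: "(A - B) \<union> (B - A) = {x}"
  have "u \<in> B \<longleftrightarrow> u \<in> toggle x A" for u
  proof -
    have "u \<in> (A - B) \<union> (B - A) \<longleftrightarrow> u = x" unfolding e by simp
    then show ?thesis by (cases "u = x"; cases "u \<in> A"; cases "x \<in> A") (simp_all add: toggle_def)
  qed
  then show "B = toggle x A" by blast
next
  assume "B = toggle x A"
  then show "(A - B) \<union> (B - A) = {x}" by (cases "x \<in> A") (auto simp: toggle_def)
qed

text \<open>Both sides differ from \<open>Z\<close> in the same elements. As a return to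
  \<open>Z\<close> is excluded, these are exactly \<open>x\<close> and \<open>y\<close>.\<close>

lemma toggle_square:
  assumes "toggle a (toggle y Z) = toggle b (toggle x Z)" "x \<noteq> y" "toggle a (toggle y Z) \<noteq> Z"
  shows "a = x"
proof -
  have mem: "u \<in> toggle a (toggle y Z) \<longleftrightarrow> u \<in> toggle b (toggle x Z)" for u using assms(1) by simp
  have "a \<noteq> y" using assms(3) by auto
  then have "b = y" using mem[of y] assms(2) by (auto simp: toggle_def split: if_splits)
  then show ?thesis using mem[of x] assms(2) by (auto simp: toggle_def split: if_splits)
qed

text \<open>The edges at the empty set toggle distinct elements \<open>k i\<close>. In the image of
  a square opposite edges toggle the same element, by \<open>toggle_square\<close>; so, by induction
  on the size of \<open>S\<close>, direction \<open>i\<close> toggles \<open>k i\<close>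
  everywhere.\<close>

lemma hypercube_embedding:
  fixes f :: "nat set \<Rightarrow> 'a set"
  assumes inj: "inj_on f (Pow {..<n})"
    and adj: "\<And>S i. S \<subseteq> {..<n} \<Longrightarrow> i < n \<Longrightarrow> \<exists>x. f (toggle i S) = toggle x (f S)"
  shows "\<exists>k. inj_on k {..<n} \<and> (\<forall>S\<subseteq>{..<n}. f S = (f {} - k ` S) \<union> (k ` S - f {}))"
proof -
  have "\<forall>i. \<exists>x. i < n \<longrightarrow> f {i} = toggle x (f {})"
    using adj[of "{}"] by (simp add: toggle_def)
  then obtain k where k: "\<And>i. i < n \<Longrightarrow> f {i} = toggle (k i) (f {})" by metis
  have inj': "S = T" if "f S = f T" "S \<subseteq> {..<n}" "T \<subseteq> {..<n}" for S T
    using inj that by (auto dest: inj_onD)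
  have kinj: "inj_on k {..<n}"
  proof (rule inj_onI)
    fix i j assume "i \<in> {..<n}" "j \<in> {..<n}" "k i = k j"
    then have "{i} = {j}" using k by (intro inj') auto
    then show "i = j" by simp
  qed
  have step: "(F - k ` insert i S) \<union> (k ` insert i S - F) = toggle (k i) ((F - k ` S) \<union> (k ` S - F))"
    if "insert i S \<subseteq> {..<n}" "i \<notin> S" for i S F
  proof -
    have "k i \<notin> k ` S" using that kinj by (auto dest: inj_onD)
    then show ?thesis by (auto simp: toggle_def)
  qed
  have "f S = (f {} - k ` S) \<union> (k ` S - f {})" if "S \<subseteq> {..<n}" for S
    using that
  proof (induction "card S" arbitrary: S rule: less_induct)
    case less
    have fin: "finite S" using less.prems finite_subset by blast
    let ?g = "\<lambda>S. (f {} - k ` S) \<union> (k ` S - f {})"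
    show ?case
    proof (cases "S = {}")
      case False
      then obtain i where i: "i \<in> S" by blast
      show ?thesis
      proof (cases "S = {i}")
        case True
        then show ?thesis using k[of i] less.prems step[of i "{}" "f {}"] by simp
      next
        case False
        then obtain j where j: "j \<in> S" "j \<noteq> i" using i by blast
        define Z where "Z = S - {i, j}"
        have S: "S = insert i (insert j Z)" "i \<notin> insert j Z" "j \<notin> Z" "i \<notin> Z" "j \<notin> insert i Z"
          using i j by (auto simp: Z_def)
        have S': "S = insert j (insert i Z)" using S(1) by blast
        have sub: "Z \<subseteq> {..<n}" "insert i Z \<subseteq> {..<n}" "insert j Z \<subseteq> {..<n}" "i < n" "j < n"
          using less.prems S by auto
        have finZ: "finite Z" using fin by (simp add: Z_def)
        have card: "card Z < card S" "card (insert i Z) < card S" "card (insert j Z) < card S"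
          using finZ S(2-5) unfolding S(1) by simp_all
        have z: "f Z = ?g Z" using less.hyps[OF card(1) sub(1)] .
        have fi: "f (insert i Z) = toggle (k i) (f Z)"
          using less.hyps[OF card(2) sub(2)] step[OF sub(2) S(4)] z by simp
        have fj: "f (insert j Z) = toggle (k j) (f Z)"
          using less.hyps[OF card(3) sub(3)] step[OF sub(3) S(3)] z by simp
        have "toggle i (insert j Z) = S" "toggle j (insert i Z) = S"
          using S(2,5) unfolding S(1) by (auto simp: toggle_def)
        then obtain a b where a: "f S = toggle a (f (insert j Z))" and b: "f S = toggle b (f (insert i Z))"
          using adj[OF sub(3,4)] adj[OF sub(2,5)] by auto
        have "a = k i"
        proof (rule toggle_square)
          show "toggle a (toggle (k j) (f Z)) = toggle b (toggle (k i) (f Z))" using a b fi fj by simp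
          show "k i \<noteq> k j" using kinj j(2) sub(4,5) by (auto dest: inj_onD)
          have "f S \<noteq> f Z" using inj'[OF _ less.prems sub(1)] S by auto
          then show "toggle a (toggle (k j) (f Z)) \<noteq> f Z" using a fj by simp
        qed
        then have "f S = toggle (k i) (?g (insert j Z))"
          using a less.hyps[OF card(3) sub(3)] by simp
        then show ?thesis using step[of i "insert j Z" "f {}"] less.prems S(2) unfolding S(1) by simp
      qed
    qed simp
  qed
  then show ?thesis using kinj by (intro exI[of _ k] conjI allI impI)
qed

locale axis_data =
  fixes X :: "'v cubical" and t :: "'v \<Rightarrow> 'v" and \<gamma> :: "int \<Rightarrow> 'v" and H :: "int \<Rightarrow> 'v set" and l :: int
  assumes l0: "0 < l" and \<gamma>_verts: "\<gamma> n \<in> verts X" and A_pos_eq: "A_pos X t = range H"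
    and \<gamma>_mem: "\<gamma> m \<in> H n \<longleftrightarrow> n < m" and H_verts: "H n \<subseteq> verts X"
    and t_H: "t ` H n = H (n + l)" and t_bij: "bij_betw t (verts X) (verts X)"
    and nontrans: "\<not> transverse X (H n) (H (n + l))"
begin

text \<open>Larger indices belong to smaller half-spaces.\<close>

definition lq :: "int \<Rightarrow> int \<Rightarrow> bool" where "lq m n \<longleftrightarrow> H n \<subseteq> H m"

lemma H_subset_le: "H n \<subseteq> H m \<Longrightarrow> m \<le> n"
  using \<gamma>_mem[of "n + 1" n] \<gamma>_mem[of "n + 1" m] by auto

lemma H_inj: "H m = H n \<longleftrightarrow> m = n"
  using H_subset_le[of m n] H_subset_le[of n m] by auto

sublocale periodic_order lq l
proof unfold_locales
  show "lq m m" for m by (simp add: lq_def)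
  show "lq m k" if "lq m n" "lq n k" for m n k using that by (auto simp: lq_def)
  show "m \<le> n" if "lq m n" for m n using that H_subset_le by (simp add: lq_def)
  show "lq (m + l) (n + l) \<longleftrightarrow> lq m n" for m n
  proof
    assume *: "lq (m + l) (n + l)"
    have "x \<in> H m" if "x \<in> H n" for x
    proof -
      have "t x \<in> t ` H m" using * that unfolding lq_def t_H[symmetric] by blast
      then show ?thesis
        using inj_on_image_mem_iff[OF bij_betw_imp_inj_on[OF t_bij], of x "H m"] that H_verts by blast
    qed
    then show "lq m n" unfolding lq_def by blast
  qed (unfold lq_def t_H[symmetric], rule image_mono)
  show "0 < l" by (rule l0)
  show "lq m (m + l)" for m
  proof -
    \<comment> \<open>Axis vertices witness three of the four intersections, so non-transversality
      empties the fourth, which is the desired inclusion.\<close>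
    have "\<gamma> (m + l + 1) \<in> H m \<inter> H (m + l)" "\<gamma> (m + 1) \<in> H m \<inter> opp X (H (m + l))"
      "\<gamma> m \<in> opp X (H m) \<inter> opp X (H (m + l))"
      using l0 \<gamma>_mem \<gamma>_verts by (auto simp: opp_def)
    then have "opp X (H m) \<inter> H (m + l) = {}" using nontrans[of m] unfolding transverse_def by blast
    then show ?thesis using H_verts[of "m + l"] unfolding lq_def opp_def by blast
  qed
qed

abbreviation opH :: "int \<Rightarrow> 'v set" where "opH n \<equiv> opp X (H n)"

lemma opp_opH: "opp X (opH n) = H n"
  by (rule opp_opp) (rule H_verts)

lemma opH_inj: "opH m = opH n \<longleftrightarrow> m = n"
  using opp_opH H_inj by metis

lemma H_neq_opH: "H m \<noteq> opH n" "opH n \<noteq> H m"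
proof -
  have "\<gamma> (max m n + 1) \<in> H m" "\<gamma> (max m n + 1) \<in> H n" using \<gamma>_mem by auto
  then show "H m \<noteq> opH n" "opH n \<noteq> H m" by (auto simp: opp_def)
qed

lemma not_opH_subset_H: "\<not> opH n \<subseteq> H m"
proof -
  have "\<gamma> (min m n) \<in> opH n" "\<gamma> (min m n) \<notin> H m" using \<gamma>_mem \<gamma>_verts by (auto simp: opp_def)
  then show ?thesis by blast
qed

lemma not_H_subset_opH: "\<not> H m \<subseteq> opH n"
proof -
  have "\<gamma> (max m n + 1) \<in> H m" "\<gamma> (max m n + 1) \<in> H n" using \<gamma>_mem by auto
  then show ?thesis by (auto simp: opp_def)
qed

lemma opH_subset: "opH m \<subseteq> opH n \<longleftrightarrow> lq m n"
  using H_verts[of n] H_verts[of m] unfolding lq_def opp_def by blast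

lemma A_all_eq: "A_all X t = range H \<union> range opH"
  by (simp add: A_all_def A_neg_def A_pos_eq image_image)

text \<open>A choice of one side for each pair is coded by a set of integers: \<open>U\<close>
  collects the indices at which the positive side is taken.\<close>

definition vert :: "int set \<Rightarrow> 'v set set" where
  "vert U = H ` U \<union> opH ` (- U)"

lemma vert_mem [simp]: "H n \<in> vert U \<longleftrightarrow> n \<in> U" "opH n \<in> vert U \<longleftrightarrow> n \<notin> U"
  using H_neq_opH by (auto simp: vert_def H_inj opH_inj)

lemma vert_inj [simp]: "vert U = vert V \<longleftrightarrow> U = V"
  using vert_mem(1) by blast

text \<open>The index sets of the vertices. Since every orbit of \<open>t\<close> is a chain, the descending chain
  condition amounts to the two bounds.\<close>

definition good :: "int set \<Rightarrow> bool" where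
  "good U \<longleftrightarrow> (\<forall>m n. n \<in> U \<longrightarrow> lq m n \<longrightarrow> m \<in> U) \<and> (\<exists>M. \<forall>n\<in>U. n < M) \<and> (\<exists>N. \<forall>n<N. n \<in> U)"

lemma goodD: "good U \<Longrightarrow> n \<in> U \<Longrightarrow> lq m n \<Longrightarrow> m \<in> U"
  unfolding good_def by blast

lemma lq_strict: "lq m n \<Longrightarrow> m \<noteq> n \<Longrightarrow> H n \<subset> H m"
  using H_inj unfolding lq_def by blast

lemma mod_decomp: "n = n mod l + (n div l) * l" "n mod l \<in> {0..<l}"
  using l0 by simp_all

lemma sageev_good:
  assumes "\<sigma> \<in> sageev_verts X (A_all X t)"
  shows "\<exists>U. good U \<and> \<sigma> = vert U"
proof -
  have s: "\<sigma> \<subseteq> A_all X t" "\<And>K. K \<in> A_all X t \<Longrightarrow> (K \<in> \<sigma>) \<noteq> (opp X K \<in> \<sigma>)"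
    "\<And>K L. K \<in> \<sigma> \<Longrightarrow> L \<in> \<sigma> \<Longrightarrow> K \<inter> L \<noteq> {}"
    and dcc: "\<And>f :: nat \<Rightarrow> 'v set. \<exists>n. \<not> (f n \<in> \<sigma> \<and> f (Suc n) \<subset> f n)"
    using assms unfolding sageev_verts_def by simp_all
  define U where "U = {n. H n \<in> \<sigma>}"
  have op: "opH n \<in> \<sigma> \<longleftrightarrow> n \<notin> U" for n using s(2)[of "H n"] by (auto simp: U_def A_all_eq)
  have "\<sigma> = vert U" using s(1) op unfolding A_all_eq vert_def U_def by auto
  moreover have closed: "m \<in> U" if "n \<in> U" "lq m n" for m n
  proof (rule ccontr)
    assume "m \<notin> U"
    then have "H n \<inter> opH m \<noteq> {}" using s(3) op that(1) by (simp add: U_def)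
    then show False using that(2) by (auto simp: lq_def opp_def)
  qed
  moreover have "\<exists>M. \<forall>n\<in>U. n < M"
  proof -
    \<comment> \<open>Otherwise the half-spaces with index in the residue class of \<open>r\<close>
      would contain an infinite descending chain in \<sigma>.\<close>
    have "\<exists>k. r + k * l \<notin> U" for r
    proof (rule ccontr)
      assume n: "\<nexists>k. r + k * l \<notin> U"
      obtain k where "\<not> (H (r + int k * l) \<in> \<sigma> \<and> H (r + int (Suc k) * l) \<subset> H (r + int k * l))"
        using dcc[of "\<lambda>k. H (r + int k * l)"] by blast
      moreover have "H (r + int (Suc k) * l) \<subset> H (r + int k * l)"
        using lq_advance[of "int k" "int (Suc k)" r] l0 by (intro lq_strict) auto
      ultimately show False using n by (auto simp: U_def)
    qed
    then obtain k where k: "\<And>r. r + k r * l \<notin> U" by metis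
    have "n < Max ((\<lambda>r. r + k r * l) ` {0..<l})" if "n \<in> U" for n
    proof -
      let ?r = "n mod l" let ?q = "n div l"
      have "\<not> k ?r \<le> ?q"
      proof
        assume "k ?r \<le> ?q"
        then have "lq (?r + k ?r * l) (?r + ?q * l)" by (rule lq_advance)
        then show False using closed[of n] that mod_decomp(1)[of n] k by metis
      qed
      then have "?q * l < k ?r * l" using l0 by (intro mult_strict_right_mono) simp_all
      then have "n < ?r + k ?r * l" using mod_decomp(1)[of n] by linarith
      also have "\<dots> \<le> Max ((\<lambda>r. r + k r * l) ` {0..<l})" using mod_decomp(2) by (intro Max_ge) auto
      finally show ?thesis .
    qed
    then show ?thesis by blast
  qed
  moreover have "\<exists>N. \<forall>n<N. n \<in> U"
  proof -
    \<comment> \<open>Now the descending chain would consist of opposite half-spaces, with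
      decreasing indices.\<close>
    have "\<exists>k. r + k * l \<in> U" for r
    proof (rule ccontr)
      assume n: "\<nexists>k. r + k * l \<in> U"
      obtain k where "\<not> (opH (r - int k * l) \<in> \<sigma> \<and> opH (r - int (Suc k) * l) \<subset> opH (r - int k * l))"
        using dcc[of "\<lambda>k. opH (r - int k * l)"] by blast
      moreover have "opH (r - int (Suc k) * l) \<subseteq> opH (r - int k * l)"
        using lq_advance[of "- int (Suc k)" "- int k" r] unfolding opH_subset by (simp add: algebra_simps)
      moreover have "opH (r - int (Suc k) * l) \<noteq> opH (r - int k * l)" using l0 unfolding opH_inj by simp
      moreover have "opH (r - int k * l) \<in> \<sigma>" using n op by (metis add_uminus_conv_diff mult_minus_left)
      ultimately show False by blast
    qed
    then obtain k where k: "\<And>r. r + k r * l \<in> U" by metis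
    have "n \<in> U" if "n < Min ((\<lambda>r. r + k r * l) ` {0..<l})" for n
    proof -
      let ?r = "n mod l" let ?q = "n div l"
      note that
      also have "Min ((\<lambda>r. r + k r * l) ` {0..<l}) \<le> ?r + k ?r * l" using mod_decomp(2) by (intro Min_le) auto
      finally have "?q * l < k ?r * l" using mod_decomp(1)[of n] by linarith
      then have "?q \<le> k ?r" using l0 by (simp add: mult_less_cancel_right)
      then have "lq (?r + ?q * l) (?r + k ?r * l)" by (rule lq_advance)
      then show ?thesis using closed[OF k] mod_decomp(1)[of n] by metis
    qed
    then show ?thesis by blast
  qed
  ultimately show ?thesis unfolding good_def by blast
qed

lemma good_sageev:
  assumes "good U" shows "vert U \<in> sageev_verts X (A_all X t)"
proof -
  have "\<not> (\<exists>f :: nat \<Rightarrow> 'v set. \<forall>n. f n \<in> vert U \<and> f (Suc n) \<subset> f n)"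
  proof
    assume "\<exists>f :: nat \<Rightarrow> 'v set. \<forall>n. f n \<in> vert U \<and> f (Suc n) \<subset> f n"
    then obtain f :: "nat \<Rightarrow> 'v set" where f: "\<And>n. f n \<in> vert U" "\<And>n. f (Suc n) \<subset> f n" by blast
    have lt: "m < n \<Longrightarrow> f n \<subset> f m" for m n
      by (induction rule: less_Suc_induct) (use f(2) in auto)
    obtain M N where MN: "\<And>n. n \<in> U \<Longrightarrow> n < M" "\<And>n. n < N \<Longrightarrow> n \<in> U" using assms unfolding good_def by blast
    \<comment> \<open>Inclusion holds only between half-spaces of the same sign, and the bounds on
      \<open>U\<close> leave finitely many of them inside \<open>f 0\<close>.\<close>
    have "finite {K \<in> vert U. K \<subset> f 0}"
    proof -
      from f(1)[of 0] consider n where "f 0 = H n" | n where "f 0 = opH n" unfolding vert_def by blast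
      then show ?thesis
      proof cases
        case 1
        have "{K \<in> vert U. K \<subset> f 0} \<subseteq> H ` {n..M}"
        proof
          fix K assume "K \<in> {K \<in> vert U. K \<subset> f 0}"
          then have K: "K \<in> vert U" "K \<subseteq> H n" using 1 by auto
          then obtain m where m: "K = H m" "m \<in> U" using not_opH_subset_H unfolding vert_def by blast
          then have "n \<le> m" "m \<le> M" using K H_subset_le MN(1) by force+
          then show "K \<in> H ` {n..M}" using m by simp
        qed
        then show ?thesis by (rule finite_subset) simp
      next
        case 2
        have "{K \<in> vert U. K \<subset> f 0} \<subseteq> opH ` {N..n}"
        proof
          fix K assume "K \<in> {K \<in> vert U. K \<subset> f 0}"
          then have K: "K \<in> vert U" "K \<subseteq> opH n" using 2 by auto
          then obtain m where m: "K = opH m" "m \<notin> U" using not_H_subset_opH unfolding vert_def by blast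
          then have "lq m n" using K opH_subset by blast
          then have "m \<le> n" "N \<le> m" using lq_le m MN(2) by force+
          then show "K \<in> opH ` {N..n}" using m by simp
        qed
        then show ?thesis by (rule finite_subset) simp
      qed
    qed
    moreover have "(\<lambda>n. f (Suc n)) ` UNIV \<subseteq> {K \<in> vert U. K \<subset> f 0}"
      using f(1) lt[OF zero_less_Suc] by blast
    moreover have "inj (\<lambda>n. f (Suc n))"
    proof (rule injI)
      fix m n assume "f (Suc m) = f (Suc n)"
      then show "m = n" using lt[of "Suc m" "Suc n"] lt[of "Suc n" "Suc m"]
        by (metis Suc_less_eq linorder_neqE_nat psubset_eq)
    qed
    ultimately show False using inj_on_finite infinite_UNIV_nat by blast
  qed
  moreover have "K \<inter> L \<noteq> {}" if "K \<in> vert U" "L \<in> vert U" for K L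
  proof -
    have HH: "H m \<inter> H n \<noteq> {}" for m n using not_H_subset_opH[of m n] H_verts[of m] by (auto simp: opp_def)
    have oo: "opH m \<inter> opH n \<noteq> {}" for m n using not_opH_subset_H[of m n] by (auto simp: opp_def)
    have Ho: "H n \<inter> opH m \<noteq> {}" if "n \<in> U" "m \<notin> U" for m n
      using goodD[OF assms that(1), of m] that(2) H_verts[of n] unfolding lq_def opp_def by blast
    show ?thesis using that HH oo Ho unfolding vert_def by (auto simp: Int_commute)
  qed
  moreover have "(K \<in> vert U) \<noteq> (opp X K \<in> vert U)" if "K \<in> A_all X t" for K
    using that unfolding A_all_eq by (auto simp: opp_opH)
  moreover have "vert U \<subseteq> A_all X t" unfolding A_all_eq vert_def by blast
  ultimately show ?thesis unfolding sageev_verts_def by blast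
qed

lemma ess_verts: "verts (X_ess X t) = vert ` Collect good"
  using sageev_good good_sageev unfolding X_ess_def sageev_complex_def by auto

lemma sageev_adj_vert:
  assumes "good U" "good V"
  shows "sageev_adj X (A_all X t) (vert U) (vert V) \<longleftrightarrow> (\<exists>n. V = toggle n U)"
proof -
  have d: "(vert U - vert V) \<union> (vert V - vert U) = H ` ((U - V) \<union> (V - U)) \<union> opH ` ((U - V) \<union> (V - U))"
  proof (intro equalityI subsetI)
    fix K assume "K \<in> (vert U - vert V) \<union> (vert V - vert U)"
    then show "K \<in> H ` ((U - V) \<union> (V - U)) \<union> opH ` ((U - V) \<union> (V - U))"
      unfolding vert_def by blast
  next
    fix K assume "K \<in> H ` ((U - V) \<union> (V - U)) \<union> opH ` ((U - V) \<union> (V - U))"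
    then show "K \<in> (vert U - vert V) \<union> (vert V - vert U)" by auto
  qed
  have "(\<exists>K\<in>A_all X t. (vert U - vert V) \<union> (vert V - vert U) = {K, opp X K}) \<longleftrightarrow>
      (\<exists>n. H ` ((U - V) \<union> (V - U)) \<union> opH ` ((U - V) \<union> (V - U)) = {H n, opH n})"
    unfolding d A_all_eq by (auto simp: opp_opH insert_commute)
  also have "\<dots> \<longleftrightarrow> (\<exists>n. (U - V) \<union> (V - U) = {n})"
  proof (rule ex_cong1)
    fix n
    let ?D = "(U - V) \<union> (V - U)"
    have "m \<in> ?D \<longleftrightarrow> m = n" if e: "H ` ?D \<union> opH ` ?D = {H n, opH n}" for m
    proof -
      have "m \<in> ?D \<longleftrightarrow> H m \<in> H ` ?D \<union> opH ` ?D" using H_inj H_neq_opH by (auto simp: image_iff)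
      also have "\<dots> \<longleftrightarrow> m = n" unfolding e using H_inj H_neq_opH by auto
      finally show ?thesis .
    qed
    moreover have "H ` E \<union> opH ` E = {H n, opH n}" if "E = {n}" for E
      unfolding that by (simp add: insert_commute)
    ultimately show "H ` ?D \<union> opH ` ?D = {H n, opH n} \<longleftrightarrow> ?D = {n}"
      by (metis (no_types, lifting) equalityI insertCI singletonD subsetI)
  qed
  finally show ?thesis
    using good_sageev[OF assms(1)] good_sageev[OF assms(2)] unfolding sageev_adj_def sym_diff_toggle by simp
qed

end

lemma cube_dim_eq: "card C = 2 ^ n \<Longrightarrow> cube_dim C = n"
  unfolding cube_dim_def by (rule the_equality) simp_all

lemma card_Pow_image:
  assumes "finite B" "P \<inter> B = {}" shows "card ((\<lambda>T. P \<union> T) ` Pow B) = 2 ^ card B"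
proof -
  have "inj_on (\<lambda>T. P \<union> T) (Pow B)"
  proof (rule inj_onI)
    fix S T assume "S \<in> Pow B" "T \<in> Pow B" "P \<union> S = P \<union> T"
    then show "S = T" using assms(2) by blast
  qed
  then show ?thesis using assms(1) by (simp add: card_image card_Pow)
qed

text \<open>One cube described from an arbitrary corner \<open>P\<close> and from its lowest corner
  \<open>P - B\<close>.\<close>

lemma sym_diff_Pow:
  "(\<lambda>T. (P - T) \<union> (T - P)) ` Pow B = (\<lambda>T. (P - B) \<union> T) ` Pow B"
proof (intro equalityI subsetI)
  fix U assume "U \<in> (\<lambda>T. (P - T) \<union> (T - P)) ` Pow B"
  then obtain T where T: "T \<subseteq> B" "U = (P - T) \<union> (T - P)" by blast
  have "U = (P - B) \<union> (U \<inter> B)" using T by blast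
  then show "U \<in> (\<lambda>T. (P - B) \<union> T) ` Pow B" by (rule image_eqI) blast
next
  fix U assume "U \<in> (\<lambda>T. (P - B) \<union> T) ` Pow B"
  then obtain T where T: "T \<subseteq> B" "U = (P - B) \<union> T" by blast
  let ?S = "(P - U) \<union> (U - P)"
  have "U = (P - ?S) \<union> (?S - P)" by blast
  moreover have "?S \<subseteq> B" using T by blast
  ultimately show "U \<in> (\<lambda>T. (P - T) \<union> (T - P)) ` Pow B" by (intro image_eqI[of _ _ ?S]) simp_all
qed

lemma card_1_toggle:
  assumes "card ((S - T) \<union> (T - S)) = 1" obtains i where "T = toggle i S" "i \<in> S \<union> T"
proof -
  obtain i where i: "(S - T) \<union> (T - S) = {i}" using assms card_1_singletonE by blast
  then have "T = toggle i S" using sym_diff_toggle by metis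
  moreover have "i \<in> S \<union> T" using i by blast
  ultimately show ?thesis by (rule that)
qed

context axis_data
begin

text \<open>The cube with lowest vertex \<open>P\<close> whose edges are dual to the half-spaces
  with index in \<open>B\<close>, provided that \<open>is_face P B\<close> holds.\<close>

definition face :: "int set \<Rightarrow> int set \<Rightarrow> 'v set set set" where
  "face P B = vert ` (\<lambda>T. P \<union> T) ` Pow B"

lemma face_mem: "T \<subseteq> B \<Longrightarrow> vert (P \<union> T) \<in> face P B"
  unfolding face_def by blast

lemma faceE: assumes "\<sigma> \<in> face P B" obtains T where "T \<subseteq> B" "\<sigma> = vert (P \<union> T)"
  using assms unfolding face_def by blast

definition is_face :: "int set \<Rightarrow> int set \<Rightarrow> bool" where
  "is_face P B \<longleftrightarrow> finite B \<and> P \<inter> B = {} \<and> (\<forall>T\<subseteq>B. good (P \<union> T))"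

lemma is_faceD: "is_face P B \<Longrightarrow> T \<subseteq> B \<Longrightarrow> good (P \<union> T)"
  unfolding is_face_def by blast

lemma is_faceD': "is_face P B \<Longrightarrow> finite B" "is_face P B \<Longrightarrow> P \<inter> B = {}"
  unfolding is_face_def by blast+

lemma card_face: "is_face P B \<Longrightarrow> card (face P B) = 2 ^ card B"
proof -
  assume f: "is_face P B"
  have "inj_on vert U" for U by (simp add: inj_on_def)
  then have "card (face P B) = card ((\<lambda>T. P \<union> T) ` Pow B)" unfolding face_def by (rule card_image)
  also have "\<dots> = 2 ^ card B" using is_faceD'[OF f] by (rule card_Pow_image)
  finally show ?thesis .
qed

lemma cube_dim_face: "is_face P B \<Longrightarrow> cube_dim (face P B) = card B"
  using card_face by (rule cube_dim_eq)

lemma cubes_ess_iff: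
  "C \<in> cubes (X_ess X t) \<longleftrightarrow> C \<subseteq> vert ` Collect good \<and>
     (\<exists>(n::nat) f. bij_betw f (Pow {..<n}) C \<and>
        (\<forall>S\<in>Pow {..<n}. \<forall>T\<in>Pow {..<n}. card ((S - T) \<union> (T - S)) = 1 \<longrightarrow>
           sageev_adj X (A_all X t) (f S) (f T)))"
  using ess_verts unfolding X_ess_def sageev_complex_def by simp

lemma face_cube: assumes f: "is_face P B" shows "face P B \<in> cubes (X_ess X t)"
proof -
  note B = is_faceD'[OF f]
  obtain e where e: "bij_betw e {..<card B} B" using B(1) ex_bij_betw_nat_finite lessThan_atLeast0 by metis
  have sub: "e ` S \<subseteq> B" if "S \<in> Pow {..<card B}" for S using that e by (auto simp: bij_betw_def)
  let ?f = "\<lambda>S. vert (P \<union> e ` S)"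
  have "face P B \<subseteq> vert ` Collect good" using is_faceD[OF f] unfolding face_def by blast
  moreover have "bij_betw ?f (Pow {..<card B}) (face P B)"
  proof -
    have "bij_betw (\<lambda>S. e ` S) (Pow {..<card B}) (Pow B)" using e by (rule bij_betw_Pow)
    moreover have "bij_betw (\<lambda>T. vert (P \<union> T)) (Pow B) (face P B)"
    proof (rule bij_betw_imageI)
      show "inj_on (\<lambda>T. vert (P \<union> T)) (Pow B)"
      proof (rule inj_onI)
        fix S T assume "S \<in> Pow B" "T \<in> Pow B" "vert (P \<union> S) = vert (P \<union> T)"
        then have "P \<union> S = P \<union> T" by simp
        then show "S = T" using B(2) \<open>S \<in> Pow B\<close> \<open>T \<in> Pow B\<close> by blast
      qed
    qed (simp add: face_def image_image)
    ultimately show ?thesis using bij_betw_trans unfolding comp_def by blast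
  qed
  moreover have "sageev_adj X (A_all X t) (?f S) (?f T)"
    if ST: "S \<in> Pow {..<card B}" "T \<in> Pow {..<card B}" "card ((S - T) \<union> (T - S)) = 1" for S T
  proof -
    obtain i where i: "T = toggle i S" "i \<in> S \<union> T" using card_1_toggle[OF ST(3)] .
    have "i \<in> {..<card B}" using i(2) ST by blast
    then have eB: "e i \<in> B" using e by (auto simp: bij_betw_def)
    note ie = bij_betw_imp_inj_on[OF e]
    have eiS: "e i \<in> e ` S \<longleftrightarrow> i \<in> S"
      using inj_on_image_mem_iff[OF ie \<open>i \<in> {..<card B}\<close>, of S] ST(1) by blast
    have "P \<union> e ` T = toggle (e i) (P \<union> e ` S)"
    proof (cases "i \<in> S")
      case True
      have "e ` (S - {i}) = e ` S - e ` {i}"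
        using ST(1) \<open>i \<in> {..<card B}\<close> by (intro inj_on_image_set_diff[OF ie]) auto
      then have "e ` T = e ` S - {e i}" unfolding i(1) toggle_def using True by simp
      then show ?thesis using True eB B(2) unfolding toggle_def by auto
    next
      case False
      then have "e i \<notin> P \<union> e ` S" using eB B(2) eiS by blast
      then show ?thesis using False unfolding i(1) toggle_def by auto
    qed
    then show ?thesis
      using sageev_adj_vert[OF is_faceD[OF f sub[OF ST(1)]] is_faceD[OF f sub[OF ST(2)]]] by blast
  qed
  ultimately show ?thesis unfolding cubes_ess_iff by blast
qed

text \<open>A cube of the Sageev complex is given only as an embedded graph. Its edges toggle single
  indices, so by \<open>hypercube_embedding\<close> its vertices are \<open>F {}\<close> modified by
  the subsets of \<open>?B\<close>; passing to the lowest corner gives the normal form.\<close>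

lemma cube_face:
  assumes "C \<in> cubes (X_ess X t)" obtains P B where "is_face P B" "C = face P B"
proof -
  have C: "C \<subseteq> vert ` Collect good" and "\<exists>(n::nat) f. bij_betw f (Pow {..<n}) C \<and>
        (\<forall>S\<in>Pow {..<n}. \<forall>T\<in>Pow {..<n}. card ((S - T) \<union> (T - S)) = 1 \<longrightarrow>
           sageev_adj X (A_all X t) (f S) (f T))"
    using assms unfolding cubes_ess_iff by simp_all
  then obtain n :: nat and f where "bij_betw f (Pow {..<n}) C \<and>
        (\<forall>S\<in>Pow {..<n}. \<forall>T\<in>Pow {..<n}. card ((S - T) \<union> (T - S)) = 1 \<longrightarrow>
           sageev_adj X (A_all X t) (f S) (f T))" by (elim exE)
  note f = this[THEN conjunct1] this[THEN conjunct2, rule_format]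
  define F where "F S = {m. H m \<in> f S}" for S
  have F: "f S = vert (F S) \<and> good (F S)" if "S \<subseteq> {..<n}" for S
  proof -
    have "f S \<in> vert ` Collect good" using C f(1) that by (auto simp: bij_betw_def)
    then obtain U where "f S = vert U" "good U" by blast
    then show ?thesis by (simp add: F_def)
  qed
  have inj: "inj_on F (Pow {..<n})"
  proof (rule inj_onI)
    fix S T assume "S \<in> Pow {..<n}" "T \<in> Pow {..<n}" "F S = F T"
    then have "f S = f T" using F by auto
    then show "S = T" using f(1) \<open>S \<in> _\<close> \<open>T \<in> _\<close> by (auto simp: bij_betw_def dest: inj_onD)
  qed
  have adj: "\<exists>x. F (toggle i S) = toggle x (F S)" if S: "S \<subseteq> {..<n}" "i < n" for S i
  proof -
    have T: "toggle i S \<subseteq> {..<n}" using S by (simp add: toggle_subset)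
    have "(S - toggle i S) \<union> (toggle i S - S) = {i}" unfolding sym_diff_toggle ..
    then have "sageev_adj X (A_all X t) (f S) (f (toggle i S))" using f(2) S T by auto
    then show ?thesis using sageev_adj_vert[of "F S" "F (toggle i S)"] F S T by auto
  qed
  obtain k where "inj_on k {..<n} \<and> (\<forall>S\<subseteq>{..<n}. F S = (F {} - k ` S) \<union> (k ` S - F {}))"
    using hypercube_embedding[OF inj adj] by (rule exE)
  note k = this[THEN conjunct1] this[THEN conjunct2, rule_format]
  let ?B = "k ` {..<n}" let ?P = "F {} - ?B"
  have "F ` Pow {..<n} = (\<lambda>T. (F {} - T) \<union> (T - F {})) ` (\<lambda>S. k ` S) ` Pow {..<n}"
    unfolding image_image by (rule image_cong[OF HOL.refl], rule k(2)) simp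
  also have "(\<lambda>S. k ` S) ` Pow {..<n} = Pow ?B" by (rule image_Pow_surj) simp
  also have "(\<lambda>T. (F {} - T) \<union> (T - F {})) ` Pow ?B = (\<lambda>T. ?P \<union> T) ` Pow ?B" by (rule sym_diff_Pow)
  finally have FP: "F ` Pow {..<n} = (\<lambda>T. ?P \<union> T) ` Pow ?B" .
  have "C = f ` Pow {..<n}" using f(1) by (simp add: bij_betw_def)
  also have "\<dots> = vert ` F ` Pow {..<n}" unfolding image_image using F by (intro image_cong) auto
  finally have "C = face ?P ?B" unfolding FP face_def .
  moreover have "good (?P \<union> T)" if "T \<subseteq> ?B" for T
  proof -
    have "?P \<union> T \<in> F ` Pow {..<n}" unfolding FP using that by blast
    then show ?thesis using F by auto
  qed
  then have "is_face ?P ?B" unfolding is_face_def by auto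
  ultimately show ?thesis using that by blast
qed

lemma ess_adj:
  assumes "good U" "good V"
  shows "adj (X_ess X t) (vert U) (vert V) \<longleftrightarrow> (\<exists>n. V = toggle n U)"
proof
  assume "adj (X_ess X t) (vert U) (vert V)"
  then have C: "{vert U, vert V} \<in> cubes (X_ess X t)" "card {vert U, vert V} = 2"
    by (auto simp: adj_def edges_def)
  then obtain P B where f: "is_face P B" "{vert U, vert V} = face P B" using cube_face by metis
  have "2 ^ card B = (2::nat) ^ 1" using card_face[OF f(1)] f(2) C(2) by simp
  then have "card B = 1" using power_inject_exp[of "2::nat" "card B" 1] by simp
  then obtain b where b: "B = {b}" using card_1_singletonE by blast
  then have "b \<notin> P" using is_faceD'[OF f(1)] by blast
  then have tb: "P \<union> {b} = toggle b P" by (simp add: toggle_def)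
  have "{vert U, vert V} = {vert P, vert (P \<union> {b})}"
    unfolding f(2) face_def b by (simp add: Pow_insert insert_commute)
  then have "U = P \<and> V = toggle b P \<or> U = toggle b P \<and> V = P" using tb by (auto simp: doubleton_eq_iff)
  then show "\<exists>n. V = toggle n U" by (metis toggle_toggle)
next
  assume "\<exists>n. V = toggle n U"
  then obtain n where n: "V = toggle n U" by blast
  have f: "is_face (U - {n}) {n}"
  proof -
    have e: "{U, V} = {U - {n}, (U - {n}) \<union> {n}}" using n by (auto simp: toggle_def)
    have "good (U - {n} \<union> T)" if "T \<subseteq> {n}" for T
    proof -
      have "U - {n} \<union> T \<in> {U, V}" unfolding e using that by auto
      then show ?thesis using assms by auto
    qed
    then show ?thesis unfolding is_face_def by auto
  qed
  have "face (U - {n}) {n} = {vert (U - {n}), vert (U - {n} \<union> {n})}"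
    unfolding face_def by (simp add: Pow_insert insert_commute)
  also have "\<dots> = {vert U, vert V}" using n by (auto simp: toggle_def insert_absorb)
  finally have "{vert U, vert V} \<in> cubes (X_ess X t)" using face_cube[OF f] by simp
  moreover have "card {vert U, vert V} = 2" using n by simp
  ultimately show "adj (X_ess X t) (vert U) (vert V)" by (simp add: adj_def edges_def)
qed

text \<open>Adding a single \<open>n\<close> of \<open>B\<close> to \<open>P\<close> must give a
  down-closed set, so no other element of \<open>B\<close> lies under \<open>n\<close>.\<close>

lemma face_antichain: assumes "is_face P B" shows "is_antichain lq B"
  unfolding is_antichain_def
proof (intro ballI impI)
  fix m n assume mn: "m \<in> B" "n \<in> B" "lq m n"
  have "good (P \<union> {n})" using is_faceD[OF assms, of "{n}"] mn by blast
  then have "m \<in> P \<union> {n}" using goodD mn(3) by blast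
  then show "m = n" using is_faceD'(2)[OF assms] mn by blast
qed

text \<open>Antichains have at most \<open>l\<close> elements, so there is a maximum one,
  \<open>W\<close>. The indices that are not above \<open>W\<close>, together with any part of
  \<open>W\<close>, form a good set. This yields a cube of dimension \<open>card W\<close>, which is
  at most the dimension of the complex.\<close>

lemma dim_antichain:
  assumes d: "enat d = complex_dim (X_ess X t)" and S: "is_antichain lq S"
  shows "card S \<le> d"
proof -
  have "\<exists>W. is_antichain lq W \<and> (\<forall>S. is_antichain lq S \<longrightarrow> card S \<le> card W)"
    by (rule Lattices_Big.ex_has_greatest_nat[of "is_antichain lq" S card "Suc (nat l)"])
      (use S antichain_finite(2) in \<open>auto simp: less_Suc_eq_le\<close>)
  then obtain W where W: "is_antichain lq W" "\<And>S. is_antichain lq S \<Longrightarrow> card S \<le> card W" by blast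
  interpret max_antichain lq l W "card W" using W by unfold_locales auto
  have "is_face {n. \<not> below n} W"
    unfolding is_face_def
  proof (intro conjI allI impI)
    show "finite W" by (rule fin_A)
    show "{n. \<not> below n} \<inter> W = {}" using A_below by blast
    fix T assume T: "T \<subseteq> W"
    show "good ({n. \<not> below n} \<union> T)"
      unfolding good_def
    proof (intro conjI allI impI)
      fix m n assume n: "n \<in> {n. \<not> below n} \<union> T" "lq m n"
      show "m \<in> {n. \<not> below n} \<union> T"
      proof (cases "below m")
        case True
        then have "below n" using below_mono n(2) by blast
        then have nT: "n \<in> T" "n \<in> W" using n(1) T by auto
        obtain a where a: "a \<in> W" "lq a m" using True unfolding below_def by blast
        then have "a = n" using A_eq nT lq_trans n(2) by blast
        then have "m = n" using a n(2) lq_antisym by blast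
        then show ?thesis using nT by simp
      qed simp
    next
      have "n < Max W + 1" if "n \<in> {n. \<not> below n} \<union> T" for n
        using that below_Max[of n] Max_ge[OF fin_A, of n] T by force
      then show "\<exists>M. \<forall>n\<in>{n. \<not> below n} \<union> T. n < M" by blast
      show "\<exists>N. \<forall>n<N. n \<in> {n. \<not> below n} \<union> T" using not_below_Min by blast
    qed
  qed
  then have "face {n. \<not> below n} W \<in> cubes (X_ess X t)" "cube_dim (face {n. \<not> below n} W) = card W"
    using face_cube cube_dim_face by blast+
  then have "enat (card W) \<le> complex_dim (X_ess X t)"
    unfolding complex_dim_def by (metis SUP_upper)
  then have "card W \<le> d" using d by (metis enat_ord_simps(1))
  then show ?thesis using W(2)[OF S] by linarith
qed

lemma ess_halfspace_vert: "vert U \<in> ess_halfspace X t K \<longleftrightarrow> good U \<and> K \<in> vert U"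
  unfolding ess_halfspace_def ess_verts by auto

lemma dual_pos_face: assumes f: "is_face P B" shows "dual_pos X t (face P B) = H ` B"
proof (intro equalityI subsetI)
  fix K assume "K \<in> dual_pos X t (face P B)"
  then obtain n \<sigma> \<tau> where n: "K = H n" "\<sigma> \<in> face P B" "\<tau> \<in> face P B"
    "\<sigma> \<notin> ess_halfspace X t K" "\<tau> \<in> ess_halfspace X t K"
    unfolding dual_pos_def A_pos_eq by blast
  obtain S T where ST: "S \<subseteq> B" "\<sigma> = vert (P \<union> S)" "T \<subseteq> B" "\<tau> = vert (P \<union> T)"
    using n(2,3) by (metis faceE)
  then have "n \<notin> P \<union> S" "n \<in> P \<union> T"
    using n(4,5) is_faceD[OF f ST(1)] unfolding ST(2,4) n(1) ess_halfspace_vert vert_mem by blast+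
  then show "K \<in> H ` B" using n(1) ST by blast
next
  fix K assume "K \<in> H ` B"
  then obtain n where n: "K = H n" "n \<in> B" by blast
  have nP: "n \<notin> P" using n is_faceD'(2)[OF f] by blast
  have g: "good (P \<union> {})" "good (P \<union> {n})" using is_faceD[OF f, of "{}"] is_faceD[OF f, of "{n}"] n by blast+
  have "P \<union> {n} = toggle n (P \<union> {})" using nP by (simp add: toggle_def)
  then have "adj (X_ess X t) (vert (P \<union> {})) (vert (P \<union> {n}))" using ess_adj[OF g] by blast
  moreover have "vert (P \<union> {}) \<in> face P B" "vert (P \<union> {n}) \<in> face P B"
    using face_mem[of "{}" B P] face_mem[of "{n}" B P] n(2) by blast+
  moreover have "vert (P \<union> {}) \<notin> ess_halfspace X t K" "vert (P \<union> {n}) \<in> ess_halfspace X t K"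
    using g nP n(1) unfolding ess_halfspace_vert by simp_all
  ultimately show "K \<in> dual_pos X t (face P B)"
    unfolding dual_pos_def A_pos_eq using n(1) by blast
qed

lemma ess_interval_vert:
  assumes "good U" "good V"
  shows "ess_interval X t (vert U) (vert V) = H ` (V - U) \<union> opH ` (U - V)"
proof (intro equalityI subsetI)
  fix K assume "K \<in> ess_interval X t (vert U) (vert V)"
  then have K: "K \<in> A_all X t" "K \<in> vert V" "opp X K \<in> vert U"
    unfolding ess_interval_def ess_halfspace_vert by auto
  from K(1) consider n where "K = H n" | n where "K = opH n" unfolding A_all_eq by blast
  then show "K \<in> H ` (V - U) \<union> opH ` (U - V)"
    using K(2,3) by cases (auto simp: opp_opH)
next
  fix K assume "K \<in> H ` (V - U) \<union> opH ` (U - V)"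
  then consider n where "K = H n" "n \<in> V" "n \<notin> U" | n where "K = opH n" "n \<in> U" "n \<notin> V" by blast
  then show "K \<in> ess_interval X t (vert U) (vert V)"
    unfolding ess_interval_def ess_halfspace_vert A_all_eq using assms by cases (auto simp: opp_opH)
qed

text \<open>A corner that already contains some \<open>n\<close> of \<open>B\<close> lies in
  \<open>H n\<close>, so an interval that starts there misses \<open>H n\<close>; only the lowest
  corner sees all dual half-spaces.\<close>

lemma min_vertex_face: assumes f: "is_face P B" shows "min_vertex X t (face P B) = vert P"
  unfolding min_vertex_def dual_pos_face[OF f]
proof (rule the_equality)
  have g: "good P" "good (P \<union> B)" using is_faceD[OF f, of "{}"] is_faceD[OF f, of B] by simp_all
  have e: "(P \<union> B) - P = B" "P - (P \<union> B) = {}" using is_faceD'(2)[OF f] by blast+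
  have "H ` B = ess_interval X t (vert P) (vert (P \<union> B))"
    unfolding ess_interval_vert[OF g] by (simp only: e image_empty Un_empty_right)
  then show "vert P \<in> face P B \<and> (\<exists>z'\<in>face P B. H ` B = ess_interval X t (vert P) z')"
    using face_mem[of "{}" B P] face_mem[of B B P] by auto
next
  fix z assume "z \<in> face P B \<and> (\<exists>z'\<in>face P B. H ` B = ess_interval X t z z')"
  then obtain S T where ST: "S \<subseteq> B" "z = vert (P \<union> S)" "T \<subseteq> B"
    and e: "H ` B = ess_interval X t (vert (P \<union> S)) (vert (P \<union> T))"
    by (metis faceE)
  have i: "H ` B = H ` ((P \<union> T) - (P \<union> S)) \<union> opH ` ((P \<union> S) - (P \<union> T))"
    unfolding e by (rule ess_interval_vert) (use is_faceD[OF f] ST in auto)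
  have "S = {}"
  proof (rule ccontr)
    assume "S \<noteq> {}"
    then obtain n where n: "n \<in> S" by blast
    then have "H n \<in> H ` ((P \<union> T) - (P \<union> S)) \<union> opH ` ((P \<union> S) - (P \<union> T))" using i ST by blast
    then show False using n H_inj H_neq_opH by auto
  qed
  then show "z = vert P" using ST by simp
qed

lemma image_vert:
  assumes u: "bij_betw u (verts X) (verts X)" and s: "\<And>n. u ` H n = H (n + m)"
  shows "image_hs u (vert U) = vert ((\<lambda>n. n + m) ` U)"
proof -
  note inj = bij_betw_imp_inj_on[OF u] and im = bij_betw_imp_surj_on[OF u]
  have o: "u ` opH n = opH (n + m)" for n
  proof -
    have "u ` (verts X - H n) = u ` verts X - u ` H n"
      by (rule inj_on_image_set_diff[OF inj]) (use H_verts in auto)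
    then show ?thesis unfolding opp_def im s .
  qed
  have c: "- ((\<lambda>n. n + m) ` U) = (\<lambda>n. n + m) ` (- U)"
  proof (intro equalityI subsetI)
    fix x assume "x \<in> - ((\<lambda>n. n + m) ` U)"
    then have "x - m \<notin> U" using image_eqI[of x "\<lambda>n. n + m" "x - m" U] by auto
    then show "x \<in> (\<lambda>n. n + m) ` (- U)" by (intro image_eqI[of _ _ "x - m"]) simp_all
  qed auto
  show ?thesis unfolding image_hs_def vert_def c image_Un image_image s o ..
qed

end

section \<open>Coordinates on the essential complex\<close>

lemma int_threshold_step:
  fixes x y k :: int
  assumes "\<And>n. n < y \<longleftrightarrow> n < x \<or> n = k" "\<not> k < x"
  shows "k = x" "y = x + 1"
proof -
  have "k < y" using assms(1)[of k] by simp
  then have "k - 1 < x" using assms(1)[of "k - 1"] by simp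
  then show k: "k = x" using assms(2) by simp
  show "y = x + 1" using assms(1)[of "x + 1"] \<open>k < y\<close> k by auto
qed

lemma int_threshold_unique: "(\<And>n::int. n < x \<longleftrightarrow> n < y) \<Longrightarrow> x = y"
  by (metis linorder_neqE_linordered_idom less_irrefl)

locale ess_face = axis_data +
  fixes P B :: "int set" and d :: nat
  assumes face: "is_face P B" and card_B: "card B = d"
    and antichain_le: "\<And>S. is_antichain lq S \<Longrightarrow> card S \<le> d"
begin

sublocale max_antichain lq l B d
  using face_antichain[OF face] card_B antichain_le by unfold_locales

text \<open>An index that is not above \<open>B\<close> is under some \<open>b\<close> in
  \<open>B\<close>, since the antichain is maximum, and \<open>P\<close> with \<open>b\<close> added
  is down-closed. So a cube of full dimension is determined by its dual half-spaces.\<close>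

lemma P_eq: "P = {n. \<not> below n}"
proof (intro equalityI subsetI)
  fix n assume n: "n \<in> P"
  show "n \<in> {n. \<not> below n}"
  proof (rule CollectI, rule notI)
    assume "below n"
    then obtain b where b: "b \<in> B" "lq b n" unfolding below_def by blast
    have "good P" using is_faceD[OF face, of "{}"] by simp
    then have "b \<in> P" using goodD n b(2) by blast
    then show False using is_faceD'(2)[OF face] b by blast
  qed
next
  fix n assume "n \<in> {n. \<not> below n}"
  then have nb: "\<not> below n" by simp
  then obtain b where b: "b \<in> B" "lq n b" using not_belowD by blast
  have "good (P \<union> {b})" using is_faceD[OF face, of "{b}"] b by blast
  then have "n \<in> P \<union> {b}" using goodD b(2) by blast
  moreover have "n \<noteq> b" using nb A_below b by blast
  ultimately show "n \<in> P" by blast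
qed

lemma hull_closed_eq: "hull_closed X t (H ` B) = H ` Q"
proof -
  have i: "image_hs t (H ` B) = (\<lambda>b. H (b + l)) ` B" unfolding image_hs_def image_image t_H ..
  have "H n \<in> hull_closed X t (H ` B) \<longleftrightarrow> n \<in> Q" for n
  proof
    assume "H n \<in> hull_closed X t (H ` B)"
    then obtain K L where KL: "K \<in> H ` B \<union> (\<lambda>b. H (b + l)) ` B" "L \<in> H ` B \<union> (\<lambda>b. H (b + l)) ` B"
      "H n \<subseteq> K" "L \<subseteq> H n" unfolding hull_closed_def i by blast
    have "\<exists>a\<in>B. lq a n"
    proof -
      from KL(1) consider a where "a \<in> B" "K = H a" | a where "a \<in> B" "K = H (a + l)" by blast
      then show ?thesis
      proof cases
        case 2
        then have "lq a n" using KL(3) lq_trans[OF lq_adv[of a]] by (simp add: lq_def)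
        then show ?thesis using 2 by blast
      qed (use KL(3) in \<open>auto simp: lq_def\<close>)
    qed
    moreover have "\<exists>b\<in>B. lq n (b + l)"
    proof -
      from KL(2) consider b where "b \<in> B" "L = H b" | b where "b \<in> B" "L = H (b + l)" by blast
      then show ?thesis
      proof cases
        case 1
        then have "lq n b" using KL(4) by (simp add: lq_def)
        then have "lq n (b + l)" using lq_trans lq_adv by blast
        then show ?thesis using 1 by blast
      qed (use KL(4) in \<open>auto simp: lq_def\<close>)
    qed
    ultimately show "n \<in> Q" unfolding Q_def by blast
  next
    assume "n \<in> Q"
    then obtain a b where "a \<in> B" "b \<in> B" "lq a n" "lq n (b + l)" unfolding Q_def by blast
    then show "H n \<in> hull_closed X t (H ` B)"
      unfolding hull_closed_def i A_pos_eq lq_def by blast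
  qed
  moreover have "hull_closed X t (H ` B) \<subseteq> range H" unfolding hull_closed_def A_pos_eq by blast
  ultimately show ?thesis by blast
qed

lemma good_shift: assumes "good U" shows "good ((\<lambda>n. n + k * l) ` U)"
proof -
  have mem: "n \<in> (\<lambda>n. n + k * l) ` U \<longleftrightarrow> n - k * l \<in> U" for n
    by (auto intro: image_eqI[of _ _ "n - k * l"])
  obtain M N where MN: "\<forall>n\<in>U. n < M" "\<forall>n<N. n \<in> U" using assms unfolding good_def by blast
  show ?thesis
    unfolding good_def mem Ball_def
  proof (intro conjI allI impI)
    fix m n assume "n - k * l \<in> U" "lq m n"
    then show "m - k * l \<in> U" using goodD[OF assms, of "n - k * l" "m - k * l"] lq_shift[of m "- k" n] by simp
  next
    show "\<exists>M. \<forall>n. n - k * l \<in> U \<longrightarrow> n < M" using MN(1) by (intro exI[of _ "M + k * l"]) force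
    show "\<exists>N. \<forall>n<N. n - k * l \<in> U" using MN(2) by (intro exI[of _ "N + k * l"]) simp
  qed
qed

text \<open>Both sides are the half-spaces of layer 0: this is what remains of \<open>Q\<close>
  without its upper end, and it is also the difference between \<open>P\<close> and its
  translate.\<close>

lemma hull_half_open_eq:
  "hull_half_open X t (H ` B) = ess_interval X t (vert P) (image_hs t (vert P))"
proof -
  let ?V = "(\<lambda>n. n + l) ` P"
  have g: "good P" using is_faceD[OF face, of "{}"] by simp
  have g': "good ?V" using good_shift[OF g, of 1] by simp
  have V: "n \<in> ?V \<longleftrightarrow> \<not> below (n - l)" for n
    unfolding P_eq by (auto intro: image_eqI[of _ _ "n - l"])
  have bl: "below (n - l) \<Longrightarrow> below n" for n using below_mono lq_adv[of "n - l"] by auto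
  have e: "?V - P = {n. below n \<and> \<not> below (n - l)}" "P - ?V = {}"
    using V bl P_eq by auto
  have "ess_interval X t (vert P) (image_hs t (vert P)) = H ` {n. below n \<and> \<not> below (n - l)}"
    unfolding image_vert[OF t_bij t_H] ess_interval_vert[OF g g'] e by simp
  moreover have "hull_half_open X t (H ` B) = H ` {n. below n \<and> \<not> below (n - l)}"
  proof -
    have i: "image_hs t (H ` B) = H ` (\<lambda>b. b + l) ` B" unfolding image_hs_def image_image t_H ..
    have "Q - (\<lambda>b. b + l) ` B = {n. below n \<and> \<not> below (n - l)}"
    proof (intro equalityI subsetI)
      fix n assume n: "n \<in> Q - (\<lambda>b. b + l) ` B"
      then have "n - l \<notin> B" using image_eqI[of n "\<lambda>b. b + l" "n - l" B] by auto
      then have "lev n = 0" using Q_cases n by blast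
      then show "n \<in> {n. below n \<and> \<not> below (n - l)}" using is_lev_lev[of n] by (simp add: is_lev_def)
    next
      fix n assume n: "n \<in> {n. below n \<and> \<not> below (n - l)}"
      then have "lev n = 0" by (intro lev_eq) (simp add: is_lev_def)
      then have "n \<in> Q" by (rule lev_0_Q)
      moreover have "n \<notin> (\<lambda>b. b + l) ` B"
      proof
        assume "n \<in> (\<lambda>b. b + l) ` B"
        then obtain b where "b \<in> B" "n = b + l" by blast
        then show False using n A_below by simp
      qed
      ultimately show "n \<in> Q - (\<lambda>b. b + l) ` B" by blast
    qed
    moreover have "inj_on H UNIV" using H_inj by (auto intro: inj_onI)
    then have "H ` Q - H ` (\<lambda>b. b + l) ` B = H ` (Q - (\<lambda>b. b + l) ` B)" by (simp add: image_set_diff)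
    ultimately show ?thesis unfolding hull_half_open_def hull_closed_eq i by simp
  qed
  ultimately show ?thesis by simp
qed

end

locale coordinates = ess_face +
  fixes c :: "nat \<Rightarrow> int \<Rightarrow> int" and \<rho> :: "nat \<Rightarrow> nat" and s :: "nat \<Rightarrow> int"
  assumes c0: "i < d \<Longrightarrow> c i 0 \<in> B"
    and c_bij: "bij_betw (\<lambda>(i, n). c i n) ({..<d} \<times> UNIV) UNIV"
    and c_lq: "i < d \<Longrightarrow> lq (c i m) (c i n) \<longleftrightarrow> m \<le> n"
    and \<rho>_image: "\<rho> ` {..<d} = {..<d}"
    and c_shift: "i < d \<Longrightarrow> c i n + l = c (\<rho> i) (n + s i)"
    and c_sat: "m \<in> Q \<Longrightarrow> n \<in> Q \<Longrightarrow> m \<in> range (c 0) \<Longrightarrow> n \<in> range (c 0) \<Longrightarrow>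
      lq m x \<Longrightarrow> lq x n \<Longrightarrow> x \<noteq> m \<Longrightarrow> x \<noteq> n \<Longrightarrow>
      \<exists>y\<in>Q. y \<in> range (c 0) \<and> lq m y \<and> lq y n \<and> y \<noteq> m \<and> y \<noteq> n"
begin

definition rc :: "int \<Rightarrow> nat \<times> int" where
  "rc = the_inv_into ({..<d} \<times> UNIV) (\<lambda>(i, n). c i n)"

definition row :: "int \<Rightarrow> nat" where "row m = fst (rc m)"
definition col :: "int \<Rightarrow> int" where "col m = snd (rc m)"

lemma rc_c: "i < d \<Longrightarrow> rc (c i n) = (i, n)"
  using the_inv_into_f_f[OF bij_betw_imp_inj_on[OF c_bij], of "(i, n)"] by (simp add: rc_def)

lemma row_c [simp]: "i < d \<Longrightarrow> row (c i n) = i" and col_c [simp]: "i < d \<Longrightarrow> col (c i n) = n"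
  by (simp_all add: row_def col_def rc_c)

lemma cellE: obtains i n where "i < d" "m = c i n"
proof -
  have "m \<in> (\<lambda>(i, n). c i n) ` ({..<d} \<times> UNIV)" using c_bij by (simp add: bij_betw_def)
  then show ?thesis using that by auto
qed

lemma row_lt: "row m < d" and c_row_col: "c (row m) (col m) = m"
proof -
  obtain i n where "i < d" "m = c i n" by (rule cellE)
  then show "row m < d" "c (row m) (col m) = m" by simp_all
qed

lemma c_mono: "i < d \<Longrightarrow> strict_mono (c i)"
proof (rule strict_monoI)
  fix m n :: int assume i: "i < d" and "m < n"
  then have "c i m \<le> c i n" using c_lq[OF i, of m n] lq_le by simp
  moreover have "c i m \<noteq> c i n"
  proof
    assume "c i m = c i n"
    then have "col (c i m) = col (c i n)" by (rule arg_cong)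
    then show False using i \<open>m < n\<close> by simp
  qed
  ultimately show "c i m < c i n" by simp
qed

lemma B_eq: "B = (\<lambda>i. c i 0) ` {..<d}"
proof -
  have "inj_on (\<lambda>i. c i 0) {..<d}"
  proof (rule inj_onI)
    fix i j assume ij: "i \<in> {..<d}" "j \<in> {..<d}" "c i 0 = c j 0"
    have "row (c i 0) = row (c j 0)" by (rule arg_cong[OF ij(3)])
    then show "i = j" using ij(1,2) by simp
  qed
  then have "card ((\<lambda>i. c i 0) ` {..<d}) = d" by (simp add: card_image)
  moreover have "(\<lambda>i. c i 0) ` {..<d} \<subseteq> B" using c0 by auto
  ultimately show ?thesis using card_subset_eq[OF fin_A, of "(\<lambda>i. c i 0) ` {..<d}"] card_A by simp
qed

text \<open>A good set is down-closed and bounded, so it meets the chain \<open>c i\<close> in an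
  initial segment; the coordinate is the first position outside. The value 0 beyond \<open>d\<close>
  matches the vertices of \<open>int_cubing\<close>.\<close>

definition coord :: "int set \<Rightarrow> nat \<Rightarrow> int" where
  "coord U i = (if i < d then THE x. \<forall>n. c i n \<in> U \<longleftrightarrow> n < x else 0)"

lemma coord_eqI:
  assumes "i < d" "\<And>n. c i n \<in> U \<longleftrightarrow> n < x" shows "coord U i = x"
proof -
  have "(THE x. \<forall>n. c i n \<in> U \<longleftrightarrow> n < x) = x"
    using assms(2) by (intro the_equality) (auto intro: int_threshold_unique)
  then show ?thesis using assms(1) by (simp add: coord_def)
qed

lemma coord:
  assumes "good U" "i < d" shows "c i n \<in> U \<longleftrightarrow> n < coord U i"
proof -
  obtain M N where MN: "\<forall>n\<in>U. n < M" "\<forall>n<N. n \<in> U" using assms unfolding good_def by blast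
  \<comment> \<open>The chain increases by at least one per step, so at these two positions it has
    passed the bounds \<open>N\<close> and \<open>M\<close> of \<open>U\<close>.\<close>
  let ?b = "\<bar>c i 0\<bar> + \<bar>M\<bar> + \<bar>N\<bar> + 1"
  note sm = strict_mono_int_bounds[OF c_mono[OF assms(2)]]
  have "c i (- ?b) < N" using sm(2)[of "- ?b"] by linarith
  then have 1: "\<not> c i (- ?b) \<notin> U" using MN(2) by simp
  have "M \<le> c i ?b" using sm(1)[of ?b] by linarith
  then have 2: "c i ?b \<notin> U" using MN(1) by force
  have 3: "- ?b \<le> ?b" by linarith
  obtain m where m: "\<not> c i m \<notin> U" "c i (m + 1) \<notin> U"
    by (rule int_crossing[of _ _ "\<lambda>n. c i n \<notin> U", OF 3 1 2])
  have x: "c i k \<in> U \<longleftrightarrow> k < m + 1" for k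
  proof
    assume "c i k \<in> U"
    show "k < m + 1"
    proof (rule ccontr)
      assume "\<not> k < m + 1"
      then have "lq (c i (m + 1)) (c i k)" using c_lq assms(2) by simp
      then show False using goodD[OF assms(1) \<open>c i k \<in> U\<close>] m(2) by blast
    qed
  next
    assume "k < m + 1"
    then have "lq (c i k) (c i m)" using c_lq assms(2) by simp
    then show "c i k \<in> U" using goodD[OF assms(1)] m(1) by blast
  qed
  then have "coord U i = m + 1" using coord_eqI[OF assms(2)] by blast
  then show ?thesis using x by simp
qed

lemma coord_mem: "good U \<Longrightarrow> m \<in> U \<longleftrightarrow> col m < coord U (row m)"
  using coord[OF _ row_lt, of U m "col m"] c_row_col by simp

lemma coord_verts: "coord U \<in> verts (int_cubing d)"
  by (simp add: int_verts coord_def)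

lemma coord_inj: "good U \<Longrightarrow> good V \<Longrightarrow> coord U = coord V \<Longrightarrow> U = V"
  using coord_mem[of U] coord_mem[of V] by auto

text \<open>As both sets are good, the inserted index is the first one of its row outside
  \<open>U\<close>; the other rows do not notice it.\<close>

lemma coord_insert:
  assumes g: "good U" "good (insert n U)" and n: "n \<notin> U"
  shows "col n = coord U (row n)" "coord (insert n U) = (coord U)(row n := coord U (row n) + 1)"
proof -
  let ?i = "row n"
  have "k < coord (insert n U) ?i \<longleftrightarrow> k < coord U ?i \<or> k = col n" for k
  proof -
    have "c ?i k = n \<longleftrightarrow> k = col n" using c_row_col[of n] col_c[OF row_lt, of n k] by auto
    then show ?thesis using coord[OF g(1) row_lt, of n k] coord[OF g(2) row_lt, of n k] by auto
  qed
  moreover have "\<not> col n < coord U ?i" using coord_mem[OF g(1)] n by simp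
  ultimately have 1: "col n = coord U ?i" "coord (insert n U) ?i = coord U ?i + 1"
    by (rule int_threshold_step)+
  show "col n = coord U (row n)" by (rule 1)
  have "coord (insert n U) j = coord U j" if "j \<noteq> ?i" for j
  proof (cases "j < d")
    case True
    have "c j k \<noteq> n" for k using row_c[OF True, of k] that by auto
    then have "c j k \<in> insert n U \<longleftrightarrow> k < coord U j" for k using coord[OF g(1) True] by simp
    then show ?thesis using coord_eqI[OF True] by blast
  qed (simp add: coord_def)
  then show "coord (insert n U) = (coord U)(row n := coord U (row n) + 1)" using 1(2) by auto
qed

lemma coord_remove:
  assumes g: "good U" "good (U - {n})" and n: "n \<in> U"
  shows "col n = coord U (row n) - 1" "coord (U - {n}) = (coord U)(row n := coord U (row n) - 1)"
proof -
  have i: "insert n (U - {n}) = U" using n by blast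
  have "n \<notin> U - {n}" by simp
  note ci = coord_insert[OF g(2) _ this, unfolded i, OF g(1)]
  show "col n = coord U (row n) - 1" "coord (U - {n}) = (coord U)(row n := coord U (row n) - 1)"
    using ci by auto
qed

definition \<phi> :: "'a set set \<Rightarrow> nat \<Rightarrow> int" where
  "\<phi> \<sigma> = coord {n. H n \<in> \<sigma>}"

lemma \<phi>_vert [simp]: "\<phi> (vert U) = coord U"
  by (simp add: \<phi>_def)

lemma adj_vertE:
  assumes "adj (X_ess X t) \<sigma> \<tau>"
  obtains U V n where "\<sigma> = vert U" "\<tau> = vert V" "good U" "good V"
    "n \<notin> U \<and> V = insert n U \<or> n \<in> U \<and> V = U - {n}"
proof -
  have "{\<sigma>, \<tau>} \<in> cubes (X_ess X t)" using assms by (simp add: adj_def edges_def)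
  then have "{\<sigma>, \<tau>} \<subseteq> vert ` Collect good" unfolding cubes_ess_iff by (rule conjunct1)
  then obtain U V where UV: "\<sigma> = vert U" "\<tau> = vert V" "good U" "good V" by auto
  then obtain n where "V = toggle n U" using ess_adj[OF UV(3,4)] assms by auto
  then have "n \<notin> U \<and> V = insert n U \<or> n \<in> U \<and> V = U - {n}" by (simp add: toggle_def)
  then show ?thesis using that UV by blast
qed

lemma \<phi>_adj: assumes "adj (X_ess X t) \<sigma> \<tau>" shows "adj (int_cubing d) (\<phi> \<sigma>) (\<phi> \<tau>)"
proof -
  obtain U V n where UV: "\<sigma> = vert U" "\<tau> = vert V" "good U" "good V"
    "n \<notin> U \<and> V = insert n U \<or> n \<in> U \<and> V = U - {n}" using assms by (rule adj_vertE)
  from UV(5) have "coord V = (coord U)(row n := coord U (row n) + 1) \<or>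
      coord V = (coord U)(row n := coord U (row n) - 1)"
    using coord_insert(2)[of U n] coord_remove(2)[of U n] UV(3,4) by auto
  then show ?thesis unfolding int_adj UV(1,2) \<phi>_vert using coord_verts row_lt by blast
qed

lemma step_towards:
  assumes g: "good U" "good V" and "U \<noteq> V"
  obtains W where "good W" "adj (X_ess X t) (vert U) (vert W)"
    "Suc (l1 d (coord W) (coord V)) = l1 d (coord U) (coord V)"
proof -
  have l1: "Suc (l1 d (x(i := y)) (coord V)) = l1 d x (coord V)"
    if "i < d" "Suc (nat \<bar>y - coord V i\<bar>) = nat \<bar>x i - coord V i\<bar>" for x i y
  proof -
    have "l1 d z (coord V) = nat \<bar>z i - coord V i\<bar> + (\<Sum>j\<in>{..<d} - {i}. nat \<bar>z j - coord V j\<bar>)" for z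
      unfolding l1_def using that(1) by (simp add: sum.remove)
    from this[of x] this[of "x(i := y)"] show ?thesis using that(2) by simp
  qed
  obtain M N where U: "\<forall>n\<in>U. n < M" "\<forall>n<N. n \<in> U" using g(1) unfolding good_def by blast
  obtain M' N' where V: "\<forall>n\<in>V. n < M'" "\<forall>n<N'. n \<in> V" using g(2) unfolding good_def by blast
  show ?thesis
  proof (cases "V \<subseteq> U")
    case False
    have "V - U \<subseteq> {N..M'}" using U V by force
    then have fin: "finite (V - U)" by (rule finite_subset) simp
    define n where "n = Min (V - U)"
    have n: "n \<in> V - U" unfolding n_def using Min_in[OF fin] False by blast
    have min: "n \<le> m" if "m \<in> V - U" for m unfolding n_def using Min_le[OF fin that] .
    have W: "good (insert n U)"
      unfolding good_def
    proof (intro conjI allI impI)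
      fix m k assume k: "k \<in> insert n U" "lq m k"
      show "m \<in> insert n U"
      proof (cases "k = n")
        case True
        then have "m \<in> V" "m \<le> n" using goodD[OF g(2)] n k(2) lq_le by auto
        then show ?thesis using min[of m] by auto
      qed (use k goodD[OF g(1)] in auto)
    next
      show "\<exists>M. \<forall>n\<in>insert n U. n < M" using U(1) by (intro exI[of _ "max M (n + 1)"]) auto
      show "\<exists>N. \<forall>na<N. na \<in> insert n U" using U(2) by auto
    qed
    have nU: "n \<notin> U" using n by blast
    note ci = coord_insert[OF g(1) W nU]
    have "col n < coord V (row n)" using coord_mem[OF g(2)] n by simp
    then have "Suc (l1 d (coord (insert n U)) (coord V)) = l1 d (coord U) (coord V)"
      unfolding ci(2) using ci(1) by (intro l1[OF row_lt]) simp
    moreover have "insert n U = toggle n U" using nU by (simp add: toggle_def)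
    then have "adj (X_ess X t) (vert U) (vert (insert n U))" using ess_adj[OF g(1) W] by blast
    ultimately show ?thesis using that W by blast
  next
    case True
    have "U - V \<subseteq> {N'..M}" using U V by force
    then have fin: "finite (U - V)" by (rule finite_subset) simp
    define n where "n = Max (U - V)"
    have n: "n \<in> U - V" unfolding n_def using Max_in[OF fin] True \<open>U \<noteq> V\<close> by blast
    have max: "m \<le> n" if "m \<in> U - V" for m unfolding n_def using Max_ge[OF fin that] .
    have W: "good (U - {n})"
      unfolding good_def
    proof (intro conjI allI impI)
      fix m k assume k: "k \<in> U - {n}" "lq m k"
      have "m \<noteq> n"
      proof
        assume "m = n"
        then have "k \<notin> V" using goodD[OF g(2), of k n] k n by blast
        then have "k \<le> n" using max k by blast
        moreover have "n \<le> k" using lq_le k(2) \<open>m = n\<close> by blast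
        ultimately show False using k by simp
      qed
      then show "m \<in> U - {n}" using goodD[OF g(1), of k m] k by blast
    next
      show "\<exists>M. \<forall>k\<in>U - {n}. k < M" using U(1) by auto
      show "\<exists>N. \<forall>k<N. k \<in> U - {n}" using U(2) by (intro exI[of _ "min N n"]) auto
    qed
    have nU: "n \<in> U" using n by blast
    note ci = coord_remove[OF g(1) W nU]
    have "\<not> col n < coord V (row n)" using coord_mem[OF g(2)] n by simp
    then have "Suc (l1 d (coord (U - {n})) (coord V)) = l1 d (coord U) (coord V)"
      unfolding ci(2) using ci(1) by (intro l1[OF row_lt]) simp
    moreover have "U - {n} = toggle n U" using nU by (simp add: toggle_def)
    then have "adj (X_ess X t) (vert U) (vert (U - {n}))" using ess_adj[OF g(1) W] by blast
    ultimately show ?thesis using that W by blast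
  qed
qed

lemma ess_relpowp:
  "good U \<Longrightarrow> good V \<Longrightarrow> l1 d (coord U) (coord V) = k \<Longrightarrow> (adj (X_ess X t) ^^ k) (vert U) (vert V)"
proof (induction k arbitrary: U)
  case 0
  have "U = V"
  proof (rule ccontr)
    assume "U \<noteq> V"
    then obtain W where "Suc (l1 d (coord W) (coord V)) = l1 d (coord U) (coord V)"
      using step_towards[OF 0(1,2)] by blast
    then show False using 0 by simp
  qed
  then show ?case by simp
next
  case (Suc k)
  have "U \<noteq> V" using Suc.prems(3) by (auto simp: l1_def)
  then obtain W where W: "good W" "adj (X_ess X t) (vert U) (vert W)"
    "Suc (l1 d (coord W) (coord V)) = l1 d (coord U) (coord V)"
    using step_towards[OF Suc.prems(1,2)] by blast
  then have "(adj (X_ess X t) ^^ k) (vert W) (vert V)" using Suc by simp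
  then show ?case using W(2) by (intro relpowp_Suc_I2)
qed

lemma relpowp_\<phi>: "(adj (X_ess X t) ^^ k) \<sigma> \<tau> \<Longrightarrow> (adj (int_cubing d) ^^ k) (\<phi> \<sigma>) (\<phi> \<tau>)"
proof (induction k arbitrary: \<tau>)
  case (Suc k)
  then obtain \<upsilon> where "(adj (X_ess X t) ^^ k) \<sigma> \<upsilon>" "adj (X_ess X t) \<upsilon> \<tau>" by auto
  then show ?case using Suc.IH \<phi>_adj by auto
qed simp

text \<open>Both distances equal the \<open>l1\<close> distance of the coordinates. Repeated
  \<open>step_towards\<close> gives a path of this length in the essential complex, \<phi> carries
  it to the cubing, and there no path is shorter.\<close>

lemma \<phi>_isometric:
  assumes g: "good U" "good V"
  shows "cdist (int_cubing d) (\<phi> (vert U)) (\<phi> (vert V)) = cdist (X_ess X t) (vert U) (vert V)"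
proof -
  let ?N = "l1 d (coord U) (coord V)"
  have X: "(adj (X_ess X t) ^^ ?N) (vert U) (vert V)" using ess_relpowp[OF g] by simp
  have "cdist (X_ess X t) (vert U) (vert V) = ?N"
    unfolding cdist_def
  proof (rule Least_equality)
    show "(adj (X_ess X t) ^^ ?N) (vert U) (vert V)" by (rule X)
    fix k assume "(adj (X_ess X t) ^^ k) (vert U) (vert V)"
    from int_relpowp_l1[OF relpowp_\<phi>[OF this]] show "?N \<le> k" by simp
  qed
  moreover have "cdist (int_cubing d) (\<phi> (vert U)) (\<phi> (vert V)) = ?N"
    unfolding cdist_def
  proof (rule Least_equality)
    show "(adj (int_cubing d) ^^ ?N) (\<phi> (vert U)) (\<phi> (vert V))" by (rule relpowp_\<phi>[OF X])
    fix k assume "(adj (int_cubing d) ^^ k) (\<phi> (vert U)) (\<phi> (vert V))"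
    from int_relpowp_l1[OF this] show "?N \<le> k" by simp
  qed
  ultimately show ?thesis by simp
qed

text \<open>Each \<open>b\<close> in \<open>B'\<close> sits at the threshold of its row, so adding
  it raises this one coordinate by one. The threshold position also shows that different elements of
  \<open>B'\<close> lie in different rows.\<close>

lemma \<phi>_face:
  assumes f: "is_face P' B'"
  shows "\<phi> ` face P' B' = box (coord P') (row ` B')"
proof -
  let ?a = "coord P'"
  have g: "good P'" using is_faceD[OF f, of "{}"] by simp
  have col: "col b = ?a (row b)" if b: "b \<in> B'" for b
  proof -
    have "good (insert b P')" using is_faceD[OF f, of "{b}"] b by simp
    moreover have "b \<notin> P'" using is_faceD'(2)[OF f] b by blast
    ultimately show ?thesis using coord_insert(1)[OF g] by blast
  qed
  have T: "coord (P' \<union> T) i = (if i \<in> row ` T then ?a i + 1 else ?a i)" if T: "T \<subseteq> B'" for T i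
  proof (cases "i < d")
    case True
    have "c i n \<in> T \<longleftrightarrow> i \<in> row ` T \<and> n = ?a i" for n
    proof
      assume cT: "c i n \<in> T"
      then have "i \<in> row ` T" using row_c[OF True, of n] by (metis imageI)
      moreover have "n = ?a i" using col[of "c i n"] cT T True by auto
      ultimately show "i \<in> row ` T \<and> n = ?a i" ..
    next
      assume "i \<in> row ` T \<and> n = ?a i"
      then obtain b where b: "b \<in> T" "i = row b" "n = ?a i" by blast
      then have "b = c i n" using c_row_col[of b] col[of b] T by auto
      then show "c i n \<in> T" using b by simp
    qed
    then show ?thesis using coord[OF g True] by (intro coord_eqI[OF True]) auto
  next
    case False
    have "i \<notin> row ` T" using False row_lt by auto
    then show ?thesis using False by (simp add: coord_def)
  qed
  have im: "\<phi> ` face P' B' = (\<lambda>T. coord (P' \<union> T)) ` Pow B'" unfolding face_def image_image \<phi>_vert ..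
  show ?thesis unfolding im
  proof (intro equalityI subsetI)
    fix x assume "x \<in> (\<lambda>T. coord (P' \<union> T)) ` Pow B'"
    then obtain S where S: "S \<subseteq> B'" "x = coord (P' \<union> S)" by blast
    show "x \<in> box ?a (row ` B')" unfolding box_mem S(2) T[OF S(1)] using S(1) by auto
  next
    fix x assume x: "x \<in> box ?a (row ` B')"
    let ?T = "{b \<in> B'. x (row b) = ?a (row b) + 1}"
    have "x i = coord (P' \<union> ?T) i" for i
    proof -
      have "i \<in> row ` ?T \<longleftrightarrow> i \<in> row ` B' \<and> x i = ?a i + 1" by auto
      moreover have "x i = ?a i \<or> i \<in> row ` B' \<and> x i = ?a i + 1" using x by (simp add: box_mem)
      ultimately show ?thesis using T[of ?T i] by auto
    qed
    then have "x = coord (P' \<union> ?T)" by blast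
    then show "x \<in> (\<lambda>T. coord (P' \<union> T)) ` Pow B'" by (rule image_eqI) auto
  qed
qed

lemma \<phi>_cube: "C \<in> cubes (X_ess X t) \<Longrightarrow> \<phi> ` C \<in> cubes (int_cubing d)"
proof -
  assume "C \<in> cubes (X_ess X t)"
  then obtain P' B' where f: "is_face P' B'" "C = face P' B'" by (rule cube_face)
  have "row ` B' \<subseteq> {..<d}" using row_lt by auto
  then show ?thesis unfolding f(2) \<phi>_face[OF f(1)] int_cubes using coord_verts by blast
qed

text \<open>The elements of \<open>B\<close> are the entries at position 0 of the rows, so the
  lowest vertex has all coordinates 0 and every direction occurs.\<close>

lemma \<phi>_base: "\<phi> ` face P B = unit_cube d"
proof -
  have g: "good P" using is_faceD[OF face, of "{}"] by simp
  have "row ` B = {..<d}"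
  proof -
    have "row ` B = (\<lambda>i. row (c i 0)) ` {..<d}" unfolding B_eq image_image ..
    also have "\<dots> = id ` {..<d}" by (rule image_cong) simp_all
    finally show ?thesis by simp
  qed
  moreover have a: "coord P i = 0" for i
  proof (cases "i < d")
    case True
    have b: "c i 0 \<in> B" by (rule c0[OF True])
    have "good (insert (c i 0) P)" using is_faceD[OF face, of "{c i 0}"] b by simp
    moreover have "c i 0 \<notin> P" using is_faceD'(2)[OF face] b by blast
    ultimately show ?thesis using coord_insert(1)[OF g, of "c i 0"] True by simp
  qed (simp add: coord_def)
  moreover have "box (coord P) {..<d} = unit_cube d"
  proof (intro equalityI subsetI)
    fix x assume x: "x \<in> box (coord P) {..<d}"
    have h: "x i = 0 \<or> i < d \<and> x i = 1" for i using x a[of i] by (auto simp: box_mem dest: spec[of _ i])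
    show "x \<in> unit_cube d" unfolding unit_cube_def int_verts
    proof (intro CollectI conjI allI impI)
      show "x i = 0" if "d \<le> i" for i using h[of i] that by auto
      show "0 \<le> x i" "x i \<le> 1" for i using h[of i] by auto
    qed
  next
    fix x assume "x \<in> unit_cube d"
    then have x: "\<forall>i\<ge>d. x i = 0" "\<forall>i<d. 0 \<le> x i \<and> x i \<le> 1" unfolding unit_cube_def int_verts by auto
    have "x i = 0 \<or> i < d \<and> x i = 1" for i
    proof (cases "i < d")
      case True
      then have "0 \<le> x i" "x i \<le> 1" using x(2) by auto
      then show ?thesis using True by linarith
    qed (use x(1) in simp)
    then show "x \<in> box (coord P) {..<d}" unfolding box_mem a by auto
  qed
  ultimately show ?thesis using \<phi>_face[OF face] by simp
qed

lemma \<phi>_isometric_embedding: "isometric_embedding (X_ess X t) (int_cubing d) \<phi>"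
  unfolding isometric_embedding_def
proof (intro conjI ballI)
  show "\<phi> ` verts (X_ess X t) \<subseteq> verts (int_cubing d)" unfolding ess_verts using coord_verts by auto
  show "inj_on \<phi> (verts (X_ess X t))"
    unfolding ess_verts by (rule inj_onI) (auto dest: coord_inj)
  show "cdist (int_cubing d) (\<phi> x) (\<phi> y) = cdist (X_ess X t) x y"
    if "x \<in> verts (X_ess X t)" "y \<in> verts (X_ess X t)" for x y
    using that \<phi>_isometric unfolding ess_verts by auto
qed (rule \<phi>_cube)


text \<open>Index sets of two consecutive vertices of the axis, as \<open>\<gamma> m\<close> lies in
  \<open>H k\<close> exactly for \<open>k < m\<close>. They supply an edge dual to
  \<open>H m\<close>.\<close>

lemma axis_vertex: "good {k. k < m}" "good (insert m {k. k < m})"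
  unfolding good_def using lq_le by (auto intro: exI[of _ "m + 1"] dest: order_trans) force+

text \<open>By \<open>coord_mem\<close>, membership of \<open>m\<close> in \<open>U\<close> is the
  inequality that defines the coordinate half-space. So \<phi> respects the two sides, and the axis
  edge dual to \<open>H m\<close> pins down the induced half-space.\<close>

lemma ess_induced_H:
  "ess_induced X t d \<phi> (H m) = coord_halfspace d (row m) (col m)"
  "ess_induced X t d \<phi> (opH m) = opp (int_cubing d) (coord_halfspace d (row m) (col m))"
proof -
  let ?x = "vert {k. k < m}" and ?y = "vert (insert m {k. k < m})"
  let ?H = "coord_halfspace d (row m) (col m)"
  have a: "adj (X_ess X t) ?x ?y"
    using ess_adj[OF axis_vertex] by (auto simp: toggle_def intro!: exI[of _ m])
  have mem: "\<phi> (vert U) \<in> ?H \<longleftrightarrow> m \<in> U" if "good U" for U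
    unfolding coord_halfspace_eq using coord_verts coord_mem[OF that, of m] by simp
  have mem': "\<phi> (vert U) \<in> opp (int_cubing d) ?H \<longleftrightarrow> m \<notin> U" if "good U" for U
    unfolding opp_def using mem[OF that] coord_verts by simp
  have K: "vert U \<in> ess_halfspace X t (H m) \<longleftrightarrow> m \<in> U" "vert U \<in> ess_halfspace X t (opH m) \<longleftrightarrow> m \<notin> U"
    if "good U" for U using that unfolding ess_halfspace_vert by simp_all
  have sub: "\<sigma> \<in> ess_halfspace X t L \<Longrightarrow> \<exists>U. \<sigma> = vert U \<and> good U" for \<sigma> L
    unfolding ess_halfspace_def ess_verts by blast
  show "ess_induced X t d \<phi> (H m) = ?H"
    unfolding ess_induced_def
  proof (rule induced_map_eq[OF a _ _ \<phi>_adj[OF a] coord_halfspace_in(1)[OF row_lt]])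
    show "?x \<notin> ess_halfspace X t (H m)" "?y \<in> ess_halfspace X t (H m)"
      using K(1)[OF axis_vertex(1)] K(1)[OF axis_vertex(2)] by simp_all
    show "\<phi> x \<notin> ?H \<and> \<phi> y \<in> ?H"
      if xy: "adj (X_ess X t) x y" "x \<notin> ess_halfspace X t (H m)" "y \<in> ess_halfspace X t (H m)" for x y
    proof -
      obtain U V n where UV: "x = vert U" "y = vert V" "good U" "good V" using xy(1) by (rule adj_vertE)
      then show ?thesis using xy(2,3) mem K(1) by simp
    qed
    show "\<phi> ` ess_halfspace X t (H m) \<subseteq> ?H"
    proof (rule image_subsetI)
      fix \<sigma> assume s: "\<sigma> \<in> ess_halfspace X t (H m)"
      then obtain U where "\<sigma> = vert U" "good U" using sub by blast
      then show "\<phi> \<sigma> \<in> ?H" using s mem K(1) by simp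
    qed
  qed
  show "ess_induced X t d \<phi> (opH m) = opp (int_cubing d) ?H"
    unfolding ess_induced_def
  proof (rule induced_map_eq[OF adj_sym[OF a] _ _ \<phi>_adj[OF adj_sym[OF a]] coord_halfspace_in(2)[OF row_lt]])
    show "?y \<notin> ess_halfspace X t (opH m)" "?x \<in> ess_halfspace X t (opH m)"
      using K(2)[OF axis_vertex(1)] K(2)[OF axis_vertex(2)] by simp_all
    show "\<phi> x \<notin> opp (int_cubing d) ?H \<and> \<phi> y \<in> opp (int_cubing d) ?H"
      if xy: "adj (X_ess X t) x y" "x \<notin> ess_halfspace X t (opH m)" "y \<in> ess_halfspace X t (opH m)" for x y
    proof -
      obtain U V n where UV: "x = vert U" "y = vert V" "good U" "good V" using xy(1) by (rule adj_vertE)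
      then show ?thesis using xy(2,3) mem' K(2) by simp
    qed
    show "\<phi> ` ess_halfspace X t (opH m) \<subseteq> opp (int_cubing d) ?H"
    proof (rule image_subsetI)
      fix \<sigma> assume s: "\<sigma> \<in> ess_halfspace X t (opH m)"
      then obtain U where "\<sigma> = vert U" "good U" using sub by blast
      then show "\<phi> \<sigma> \<in> opp (int_cubing d) ?H" using s mem' K(2) by simp
    qed
  qed
qed

lemma ess_induced_pos: "ess_induced X t d \<phi> ` A_pos X t = int_halfspaces_pos d"
proof -
  have "ess_induced X t d \<phi> ` A_pos X t = range (\<lambda>m. coord_halfspace d (row m) (col m))"
    unfolding A_pos_eq image_image ess_induced_H ..
  also have "\<dots> = int_halfspaces_pos d"
    unfolding int_halfspaces_pos_def coord_halfspaces_def
  proof (intro equalityI subsetI)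
    fix K assume "K \<in> range (\<lambda>m. coord_halfspace d (row m) (col m))"
    then obtain m where "K = coord_halfspace d (row m) (col m)" by blast
    then show "K \<in> (\<Union>i<d. range (coord_halfspace d i))" using row_lt[of m] by blast
  next
    fix K assume "K \<in> (\<Union>i<d. range (coord_halfspace d i))"
    then obtain i n where "i < d" "K = coord_halfspace d i n" by blast
    then have "K = coord_halfspace d (row (c i n)) (col (c i n))" by simp
    then show "K \<in> range (\<lambda>m. coord_halfspace d (row m) (col m))" by (rule range_eqI)
  qed
  finally show ?thesis .
qed

lemma ess_induced_bij: "bij_betw (ess_induced X t d \<phi>) (A_all X t) (int_halfspaces d)"
proof (rule bij_betw_imageI)
  let ?f = "ess_induced X t d \<phi>"
  have HH: "m = n" if "coord_halfspace d (row m) (col m) = coord_halfspace d (row n) (col n)" for m n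
    using coord_halfspace_inj[OF row_lt row_lt that] c_row_col by metis
  have oo: "opp (int_cubing d) (opp (int_cubing d) (coord_halfspace d i n)) = coord_halfspace d i n" for i n
    by (rule opp_opp) (simp add: coord_halfspace_eq)
  show "inj_on ?f (A_all X t)"
  proof (rule inj_onI)
    fix K L assume KL: "K \<in> A_all X t" "L \<in> A_all X t" and e: "?f K = ?f L"
    have A: "\<exists>m. M = H m \<or> M = opH m" if "M \<in> A_all X t" for M
      using that unfolding A_all_eq by blast
    obtain m where m: "K = H m \<or> K = opH m" using A[OF KL(1)] by (rule exE)
    obtain n where n: "L = H n \<or> L = opH n" using A[OF KL(2)] by (rule exE)
    let ?h = "\<lambda>m. coord_halfspace d (row m) (col m)"
    note ne = coord_halfspace_neq_opp[OF row_lt[of m] row_lt[of n], of "col m" "col n"]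
      coord_halfspace_neq_opp[OF row_lt[of n] row_lt[of m], of "col n" "col m"]
    from m n show "K = L"
    proof (elim disjE)
      assume "K = H m" "L = H n"
      then show ?thesis using HH[of m n] e by (simp add: ess_induced_H)
    next
      assume 2: "K = opH m" "L = opH n"
      then have "opp (int_cubing d) (?h m) = opp (int_cubing d) (?h n)" using e by (simp add: ess_induced_H)
      then have "opp (int_cubing d) (opp (int_cubing d) (?h m)) = opp (int_cubing d) (opp (int_cubing d) (?h n))"
        by (rule arg_cong)
      then show ?thesis using HH[of m n] 2 unfolding oo by simp
    next
      assume "K = H m" "L = opH n"
      then show ?thesis using e ne(1) by (simp add: ess_induced_H)
    next
      assume "K = opH m" "L = H n"
      then show ?thesis using e[symmetric] ne(2) by (simp add: ess_induced_H)
    qed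
  qed
  have "?f ` A_neg X t = opp (int_cubing d) ` ?f ` A_pos X t"
    unfolding A_neg_def A_pos_eq image_image ess_induced_H ..
  then show "?f ` A_all X t = int_halfspaces d"
    unfolding A_all_def int_halfspaces_def int_halfspaces_neg_def image_Un ess_induced_pos by simp
qed

lemma d_pos: "0 < d"
  using row_lt[of 0] by simp

lemma H_subset: "H m \<subset> H n \<longleftrightarrow> lq n m \<and> m \<noteq> n"
  using H_inj[of m n] unfolding lq_def by auto

text \<open>A half-space strictly between two members is positive, because no positive half-space is
  contained in the opposite of one. Its index lies between theirs in the order, and saturation
  supplies a member of the chain strictly between them, so consecutive members leave no
  room.\<close>

lemma tight_chain:
  "tightly_nested_chain (A_all X t)
     {K \<in> hull_closed X t (H ` B). ess_induced X t d \<phi> K \<in> coord_halfspaces d 0}"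
proof -
  have r0: "m \<in> range (c 0) \<longleftrightarrow> row m = 0" for m
  proof
    assume "m \<in> range (c 0)"
    then show "row m = 0" using d_pos by auto
  next
    assume "row m = 0"
    then show "m \<in> range (c 0)" using c_row_col[of m] by (metis rangeI)
  qed
  have "ess_induced X t d \<phi> (H m) \<in> coord_halfspaces d 0 \<longleftrightarrow> row m = 0" for m
    unfolding ess_induced_H coord_halfspaces_def
    using coord_halfspace_inj[OF row_lt d_pos] by auto
  then have S: "{K \<in> hull_closed X t (H ` B). ess_induced X t d \<phi> K \<in> coord_halfspaces d 0}
      = H ` (Q \<inter> range (c 0))"
    unfolding hull_closed_eq using r0 by auto
  have cmp: "H m \<subset> H n \<or> H n \<subset> H m" if mn: "m \<in> range (c 0)" "n \<in> range (c 0)" "m \<noteq> n" for m n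
  proof -
    obtain a b where "m = c 0 a" "n = c 0 b" using mn by auto
    then show ?thesis using c_lq[OF d_pos, of a b] c_lq[OF d_pos, of b a] mn(3) unfolding H_subset by auto
  qed
  show ?thesis
    unfolding S tightly_nested_chain_def
  proof (intro conjI ballI impI)
    show "H ` (Q \<inter> range (c 0)) \<subseteq> A_all X t" unfolding A_all_eq by blast
  next
    fix K L assume KL: "K \<in> H ` (Q \<inter> range (c 0))" "L \<in> H ` (Q \<inter> range (c 0))" and ne: "K \<noteq> L"
    obtain m where "K = H m" "m \<in> Q \<inter> range (c 0)" using KL(1) by (rule imageE)
    moreover obtain n where "L = H n" "n \<in> Q \<inter> range (c 0)" using KL(2) by (rule imageE)
    ultimately have mn: "K = H m" "m \<in> range (c 0)" "L = H n" "n \<in> range (c 0)" by simp_all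
    show "nested K L" unfolding nested_def using cmp[OF mn(2,4)] ne unfolding mn(1,3) by auto
  next
    fix K L assume KL: "K \<in> H ` (Q \<inter> range (c 0))" "L \<in> H ` (Q \<inter> range (c 0))"
      and *: "K \<subset> L \<and> \<not> (\<exists>M\<in>H ` (Q \<inter> range (c 0)). K \<subset> M \<and> M \<subset> L)"
    obtain m where "K = H m" "m \<in> Q \<inter> range (c 0)" using KL(1) by (rule imageE)
    moreover obtain n where "L = H n" "n \<in> Q \<inter> range (c 0)" using KL(2) by (rule imageE)
    ultimately have mn: "K = H m" "m \<in> Q" "m \<in> range (c 0)" "L = H n" "n \<in> Q" "n \<in> range (c 0)"
      by simp_all
    have "\<not> (K \<subset> M \<and> M \<subset> L)" if M: "M \<in> A_all X t" for M
    proof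
      assume b: "K \<subset> M \<and> M \<subset> L"
      from M obtain x where "M = H x \<or> M = opH x" unfolding A_all_eq by blast
      then have x: "M = H x" using b not_H_subset_opH[of m x] mn(1) by auto
      have "lq n x" "lq x m" "x \<noteq> n" "x \<noteq> m" using b unfolding x mn H_subset by auto
      then obtain y where y: "y \<in> Q" "y \<in> range (c 0)" "lq n y" "lq y m" "y \<noteq> n" "y \<noteq> m"
        using c_sat[OF mn(5,2,6,3)] by blast
      then have "K \<subset> H y \<and> H y \<subset> L" unfolding mn H_subset by auto
      moreover have "H y \<in> H ` (Q \<inter> range (c 0))" using y(1,2) by (intro imageI IntI)
      ultimately show False using *[THEN conjunct2] by (elim notE) (rule bexI)
    qed
    moreover have KL': "K \<subset> L" using * by (rule conjunct1)
    moreover have "\<not> (L \<subset> M \<and> M \<subset> K)" for M using KL' by (meson psubset_trans less_irrefl)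
    ultimately show "tightly_nested (A_all X t) K L"
      unfolding tightly_nested_def nested_def by simp
  qed
qed

section \<open>The action on the integer cubing\<close>

lemma c_shift_row: "i < d \<Longrightarrow> \<exists>j b. j < d \<and> (\<forall>n. c i n + k * l = c j (n + b))"
proof (induction k arbitrary: i rule: int_induct[of _ 0])
  case base
  then show ?case by (intro exI[of _ i] exI[of _ 0]) simp
next
  case (step1 k)
  have r: "\<rho> i < d" using \<rho>_image step1.prems by blast
  then obtain j b where jb: "j < d" "\<forall>n. c (\<rho> i) n + k * l = c j (n + b)" using step1.IH by blast
  have "c i n + (k + 1) * l = c j (n + (s i + b))" for n
  proof -
    have "c i n + (k + 1) * l = (c i n + l) + k * l" by (simp add: algebra_simps)
    also have "\<dots> = c (\<rho> i) (n + s i) + k * l" by (simp only: c_shift[OF step1.prems])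
    also have "\<dots> = c j (n + s i + b)" using jb(2) by simp
    finally show ?thesis by (simp add: add.assoc)
  qed
  then show ?case using jb(1) by blast
next
  case (step2 k)
  have "i \<in> \<rho> ` {..<d}" using \<rho>_image step2.prems by simp
  then obtain i' where i': "i' < d" "i = \<rho> i'" by auto
  obtain j b where jb: "j < d" "\<forall>n. c i' n + k * l = c j (n + b)" using step2.IH[OF i'(1)] by blast
  have "c i n + (k - 1) * l = c j (n + (b - s i'))" for n
  proof -
    have "c i n = c i' (n - s i') + l" using c_shift[OF i'(1), of "n - s i'"] i'(2) by simp
    then have "c i n + (k - 1) * l = c i' (n - s i') + k * l" by (simp add: algebra_simps)
    then show ?thesis using jb(2) by (simp add: algebra_simps)
  qed
  then show ?case using jb(1) by blast
qed

text \<open>Any number of periods carries a row onto a row by a translation, so the target row and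
  the offset can be read off at position 0.\<close>

lemma row_col_shift:
  assumes "i < d"
  shows "row (c i n + k * l) = row (c i 0 + k * l)" "col (c i n + k * l) = n + col (c i 0 + k * l)"
proof -
  obtain j b where jb: "j < d" "\<And>n. c i n + k * l = c j (n + b)" using c_shift_row[OF assms] by blast
  show "row (c i n + k * l) = row (c i 0 + k * l)" "col (c i n + k * l) = n + col (c i 0 + k * l)"
    using jb by simp_all
qed

text \<open>The index set with the given coordinates. It is defined for all vertices of the cubing,
  also for those where it is not \<open>good\<close>, and so transfers the action on indices to the
  whole cubing.\<close>

definition lower :: "(nat \<Rightarrow> int) \<Rightarrow> int set" where "lower x = {m. col m < x (row m)}"

lemma lower_inj:
  assumes "x \<in> verts (int_cubing d)" "y \<in> verts (int_cubing d)" "lower x = lower y"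
  shows "x = y"
proof
  fix i
  show "x i = y i"
  proof (cases "i < d")
    case True
    have "n < x i \<longleftrightarrow> n < y i" for n
    proof -
      have "c i n \<in> lower x \<longleftrightarrow> c i n \<in> lower y" using assms(3) by simp
      then show ?thesis using True by (simp add: lower_def)
    qed
    then show ?thesis by (rule int_threshold_unique)
  qed (use assms in \<open>simp add: int_verts\<close>)
qed

lemma lower_coord: "good U \<Longrightarrow> lower (coord U) = U"
  unfolding lower_def using coord_mem by blast

text \<open>Chosen such that \<open>lower\<close> turns it into the shift by \<open>k * l\<close>.
  Row \<open>j\<close> of the result comes from the row of \<open>c j 0 - k * l\<close>, and
  subtracting the column of that index corrects for the different origins. The form
  \<open>+ - k * l\<close> fits \<open>row_col_shift\<close> at \<open>- k\<close>.\<close>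

definition \<Psi> :: "int \<Rightarrow> (nat \<Rightarrow> int) \<Rightarrow> nat \<Rightarrow> int" where
  "\<Psi> k x = (\<lambda>j. if j < d then x (row (c j 0 + - k * l)) - col (c j 0 + - k * l) else 0)"

lemma \<Psi>_verts: "\<Psi> k x \<in> verts (int_cubing d)"
  by (simp add: \<Psi>_def int_verts)

lemma lower_\<Psi>: "m \<in> lower (\<Psi> k x) \<longleftrightarrow> m + - k * l \<in> lower x"
proof -
  obtain j n where j: "j < d" "m = c j n" by (rule cellE)
  show ?thesis unfolding lower_def j(2) using row_col_shift[OF j(1), of n "- k"] j(1)
    by (auto simp: \<Psi>_def)
qed

text \<open>Shifts of index sets compose, and \<open>lower\<close> is injective; this replaces a
  computation with the permutations and offsets of the rows.\<close>

lemma \<Psi>_add: "x \<in> verts (int_cubing d) \<Longrightarrow> \<Psi> (j + k) x = \<Psi> j (\<Psi> k x)"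
proof (rule lower_inj[OF \<Psi>_verts \<Psi>_verts])
  have "m \<in> lower (\<Psi> (j + k) x) \<longleftrightarrow> m \<in> lower (\<Psi> j (\<Psi> k x))" for m
    unfolding lower_\<Psi> by (simp add: algebra_simps)
  then show "lower (\<Psi> (j + k) x) = lower (\<Psi> j (\<Psi> k x))" by blast
qed

lemma \<Psi>_0: "x \<in> verts (int_cubing d) \<Longrightarrow> \<Psi> 0 x = x"
proof (rule lower_inj[OF \<Psi>_verts])
  show "lower (\<Psi> 0 x) = lower x" using lower_\<Psi>[of _ 0 x] by auto
qed

lemma \<Psi>_box_subset:
  assumes "a \<in> verts (int_cubing d)"
  shows "\<Psi> k ` box a S \<subseteq> box (\<Psi> k a) {j. j < d \<and> row (c j 0 + - k * l) \<in> S}"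
proof (rule image_subsetI)
  fix x assume x: "x \<in> box a S"
  show "\<Psi> k x \<in> box (\<Psi> k a) {j. j < d \<and> row (c j 0 + - k * l) \<in> S}"
    unfolding box_mem
  proof
    fix j
    have "x i = a i \<or> i \<in> S \<and> x i = a i + 1" for i using x by (simp add: box_mem)
    from this[of "row (c j 0 + - k * l)"]
    show "\<Psi> k x j = \<Psi> k a j \<or> j \<in> {j. j < d \<and> row (c j 0 + - k * l) \<in> S} \<and> \<Psi> k x j = \<Psi> k a j + 1"
      by (auto simp: \<Psi>_def)
  qed
qed

lemma row_shift_inverse: "i < d \<Longrightarrow> row (c (row (c i 0 + k * l)) 0 + - k * l) = i"
proof -
  assume i: "i < d"
  let ?m = "c i 0 + k * l"
  have "row (c (row ?m) 0 + - k * l) = row (c (row ?m) (col ?m) + - k * l)"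
    using row_col_shift(1)[OF row_lt, of ?m "col ?m" "- k"] by simp
  also have "\<dots> = i" using i by (simp add: c_row_col)
  finally show ?thesis .
qed

lemma box_verts: "a \<in> verts (int_cubing d) \<Longrightarrow> S \<subseteq> {..<d} \<Longrightarrow> box a S \<subseteq> verts (int_cubing d)"
  unfolding int_verts by (auto simp: box_mem) (metis add.left_neutral lessThan_iff linorder_not_less subsetD)

text \<open>One inclusion can be read off the formula for \<Psi>; the other one is the same
  inclusion for the inverse map \<open>\<Psi> (- k)\<close>.\<close>

lemma \<Psi>_cube:
  assumes "C \<in> cubes (int_cubing d)" shows "\<Psi> k ` C \<in> cubes (int_cubing d)"
proof -
  obtain a S where C: "C = box a S" "a \<in> verts (int_cubing d)" "S \<subseteq> {..<d}"
    using assms unfolding int_cubes by blast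
  let ?S = "{j. j < d \<and> row (c j 0 + - k * l) \<in> S}"
  have "box (\<Psi> k a) ?S \<subseteq> \<Psi> k ` box a S"
  proof
    fix y assume y: "y \<in> box (\<Psi> k a) ?S"
    have yv: "y \<in> verts (int_cubing d)" using box_verts[OF \<Psi>_verts, of ?S k a] y by blast
    have "\<Psi> (- k) y \<in> box (\<Psi> (- k) (\<Psi> k a)) {j. j < d \<and> row (c j 0 + - (- k) * l) \<in> ?S}"
      using \<Psi>_box_subset[OF \<Psi>_verts[of k a], of "- k" ?S] y by blast
    moreover have "\<Psi> (- k) (\<Psi> k a) = a" using \<Psi>_add[OF C(2), of "- k" k] \<Psi>_0[OF C(2)] by simp
    moreover have "{j. j < d \<and> row (c j 0 + - (- k) * l) \<in> ?S} \<subseteq> S"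
      using row_shift_inverse[of _ k] by auto
    ultimately have "\<Psi> (- k) y \<in> box a S" by (auto simp: box_mem)
    moreover have "y = \<Psi> k (\<Psi> (- k) y)" using \<Psi>_add[OF yv, of k "- k"] \<Psi>_0[OF yv] by simp
    ultimately show "y \<in> \<Psi> k ` box a S" by blast
  qed
  then have "\<Psi> k ` C = box (\<Psi> k a) ?S" using \<Psi>_box_subset[OF C(2), of k S] C(1) by blast
  then show ?thesis unfolding int_cubes using \<Psi>_verts[of k a] by blast
qed

lemma \<Psi>_equivariant:
  assumes g: "good U" and u: "bij_betw u (verts X) (verts X)" "\<And>n. u ` H n = H (n + k * l)"
  shows "\<phi> (image_hs u (vert U)) = \<Psi> k (\<phi> (vert U))"
proof -
  let ?V = "(\<lambda>n. n + k * l) ` U"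
  have gV: "good ?V" by (rule good_shift[OF g])
  have "coord ?V = \<Psi> k (coord U)"
  proof (rule lower_inj[OF coord_verts \<Psi>_verts])
    have "m \<in> ?V \<longleftrightarrow> m + - k * l \<in> U" for m by (auto intro: image_eqI[of _ _ "m - k * l"])
    then show "lower (coord ?V) = lower (\<Psi> k (coord U))"
      using lower_\<Psi>[of _ k "coord U"] unfolding lower_coord[OF gV] lower_coord[OF g] by blast
  qed
  then show ?thesis unfolding image_vert[OF u] \<phi>_vert .
qed

text \<open>\<sigma> counts the periods by which a group element shifts, and its additivity becomes
  the action law through \<open>\<Psi>_add\<close>. The maps are restricted to the vertices because
  \<open>Bij\<close> consists of extensional functions.\<close>

lemma \<Psi>_action:
  assumes G: "group K" and \<sigma>: "\<And>h h'. h \<in> carrier K \<Longrightarrow> h' \<in> carrier K \<Longrightarrow> \<sigma> (h \<otimes>\<^bsub>K\<^esub> h') = \<sigma> h + \<sigma> h'"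
  shows "cubical_action K (int_cubing d) (\<lambda>h. restrict (\<Psi> (\<sigma> h)) (verts (int_cubing d)))"
proof -
  let ?V = "verts (int_cubing d)" let ?\<psi> = "\<lambda>h. restrict (\<Psi> (\<sigma> h)) ?V"
  have bij: "bij_betw (\<Psi> k) ?V ?V" for k
  proof (rule bij_betw_byWitness[of _ "\<Psi> (- k)"])
    show "\<forall>a\<in>?V. \<Psi> (- k) (\<Psi> k a) = a" using \<Psi>_add[of _ "- k" k] \<Psi>_0 by simp
    show "\<forall>a\<in>?V. \<Psi> k (\<Psi> (- k) a) = a" using \<Psi>_add[of _ k "- k"] \<Psi>_0 by simp
  qed (use \<Psi>_verts in auto)
  have Bij: "?\<psi> h \<in> Bij ?V" for h
    unfolding Bij_def using bij[of "\<sigma> h"] by (simp add: bij_betw_restrict_eq)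
  have "group_hom K (BijGroup ?V) ?\<psi>"
  proof (intro group_hom.intro group_hom_axioms.intro G group_BijGroup homI)
    show "?\<psi> h \<in> carrier (BijGroup ?V)" for h using Bij by (simp add: BijGroup_def)
    fix h h' assume h: "h \<in> carrier K" "h' \<in> carrier K"
    have "?\<psi> (h \<otimes>\<^bsub>K\<^esub> h') = compose ?V (?\<psi> h) (?\<psi> h')"
    proof
      fix x
      show "?\<psi> (h \<otimes>\<^bsub>K\<^esub> h') x = compose ?V (?\<psi> h) (?\<psi> h') x"
        using \<Psi>_add[of x "\<sigma> h" "\<sigma> h'"] \<Psi>_verts \<sigma>[OF h] by (simp add: compose_def)
    qed
    then show "?\<psi> (h \<otimes>\<^bsub>K\<^esub> h') = ?\<psi> h \<otimes>\<^bsub>BijGroup ?V\<^esub> ?\<psi> h'"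
      using Bij by (simp add: BijGroup_def)
  qed
  moreover have "?\<psi> h ` C \<in> cubes (int_cubing d)" if C: "C \<in> cubes (int_cubing d)" for h C
  proof -
    obtain a S where aS: "C = box a S" "a \<in> ?V" "S \<subseteq> {..<d}" using C unfolding int_cubes by blast
    then have "C \<subseteq> ?V" using box_verts by simp
    then have "?\<psi> h ` C = \<Psi> (\<sigma> h) ` C" by (intro image_cong) auto
    then show ?thesis using \<Psi>_cube[OF C] by simp
  qed
  ultimately show ?thesis unfolding cubical_action_def group_action_def by blast
qed

end

section \<open>Powers of the generator, and the case without axes\<close>

lemma action_auto_pair:
  assumes "cubical_action G X act" "g \<in> carrier G"
  shows "auto_pair X (act g) (act (inv\<^bsub>G\<^esub> g))"
proof -
  interpret group_action G "verts X" act using assms(1) by (simp add: cubical_action_def)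
  interpret group G using group_hom by (simp add: group_hom_def)
  have c: "act h ` C \<in> cubes X" if "h \<in> carrier G" "C \<in> cubes X" for h C
    using assms(1) that by (simp add: cubical_action_def)
  have i: "inv\<^bsub>G\<^esub> g \<in> carrier G" using assms(2) by simp
  have e: "act h (act h' x) = x" if "x \<in> verts X" "h \<in> carrier G" "h' \<in> carrier G" "h \<otimes>\<^bsub>G\<^esub> h' = \<one>\<^bsub>G\<^esub>" for x h h'
  proof -
    have "act h (act h' x) = act (h \<otimes>\<^bsub>G\<^esub> h') x" using composition_rule[OF that(1-3)] by (simp only:)
    also have "\<dots> = (\<lambda>x\<in>verts X. x) x" unfolding that(4) id_eq_one ..
    finally show ?thesis using that(1) by simp
  qed
  show ?thesis
    unfolding auto_pair_def
  proof (intro conjI ballI)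
    fix x assume x: "x \<in> verts X"
    show "act g x \<in> verts X" "act (inv\<^bsub>G\<^esub> g) x \<in> verts X"
      using element_image x assms(2) i by blast+
    show "act g (act (inv\<^bsub>G\<^esub> g) x) = x" "act (inv\<^bsub>G\<^esub> g) (act g x) = x"
      using e x assms(2) i by simp_all
  qed (use c assms(2) i in auto)
qed

lemma auto_pair_bij: "auto_pair X t s \<Longrightarrow> bij_betw t (verts X) (verts X)"
  unfolding auto_pair_def by (rule bij_betw_byWitness[of _ s]) auto

lemma int_pow_shift:
  assumes act: "group_action G (verts X) act" and g: "g \<in> carrier G"
    and H: "\<And>n. H n \<subseteq> verts X" "\<And>n :: int. act g ` H n = H (n + l)"
  shows "act (g [^]\<^bsub>G\<^esub> (k :: int)) ` H n = H (n + k * l)"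
proof -
  interpret group_action G "verts X" act by (rule act)
  interpret group G using group_hom by (simp add: group_hom_def)
  have step: "act (g [^]\<^bsub>G\<^esub> (k + 1)) ` H n = act (g [^]\<^bsub>G\<^esub> k) ` H (n + l)" for k :: int and n
  proof -
    have p: "g [^]\<^bsub>G\<^esub> (k + 1) = g [^]\<^bsub>G\<^esub> k \<otimes>\<^bsub>G\<^esub> g" using g by (simp add: int_pow_mult)
    have "act (g [^]\<^bsub>G\<^esub> (k + 1)) ` H n = (\<lambda>x. act (g [^]\<^bsub>G\<^esub> k) (act g x)) ` H n"
      unfolding p using g H(1)[of n] composition_rule[of _ "g [^]\<^bsub>G\<^esub> k" g]
      by (intro image_cong) auto
    then show ?thesis by (simp add: image_image[symmetric] H(2))
  qed
  show ?thesis
  proof (induction k arbitrary: n rule: int_induct[of _ 0])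
    case base
    have "act \<one>\<^bsub>G\<^esub> ` H n = (\<lambda>x. x) ` H n"
      unfolding id_eq_one[symmetric] using H(1)[of n] by (intro image_cong) auto
    then show ?case by simp
  next
    case (step1 i)
    then show ?case using step[of i n] by (simp add: algebra_simps)
  next
    case (step2 i)
    have "act (g [^]\<^bsub>G\<^esub> (i - 1)) ` H (n - l + l) = act (g [^]\<^bsub>G\<^esub> i) ` H (n - l)"
      using step[of "i - 1" "n - l"] by simp
    then show ?case using step2(2)[of "n - l"] by (simp add: algebra_simps)
  qed
qed

lemma int_cubing_0: "verts (int_cubing 0) = {\<lambda>i. 0}" "cubes (int_cubing 0) = {{\<lambda>i. 0}}"
proof -
  show v: "verts (int_cubing 0) = {\<lambda>i. 0}" by (auto simp: int_verts)
  show "cubes (int_cubing 0) = {{\<lambda>i. 0}}" unfolding int_cubes v by (auto simp: box_empty)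
qed

lemma cdist_self: "cdist X x x = 0"
  unfolding cdist_def by (rule Least_equality) simp_all

lemma ess_empty:
  assumes "A_pos X t = {}"
  shows "A_all X t = {}" "verts (X_ess X t) = {{}}" "cubes (X_ess X t) = {{{}}}"
proof -
  show A: "A_all X t = {}" using assms by (simp add: A_all_def A_neg_def)
  have v: "sageev_verts X {} = {{}}" by (auto simp: sageev_verts_def)
  show "verts (X_ess X t) = {{}}" unfolding X_ess_def sageev_complex_def A v by simp
  show "cubes (X_ess X t) = {{{}}}"
  proof (intro equalityI subsetI)
    fix C assume "C \<in> cubes (X_ess X t)"
    then obtain n :: nat and f where "C \<subseteq> {{}}" "bij_betw f (Pow {..<n}) C"
      unfolding X_ess_def sageev_complex_def A v by auto
    then have "C \<subseteq> {{}}" "C \<noteq> {}" by (auto simp: bij_betw_def)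
    then show "C \<in> {{{}}}" by auto
  next
    fix C :: "'a set set set" assume C: "C \<in> {{{}}}"
    have "bij_betw (\<lambda>_. {}) (Pow {..<0::nat}) C" using C by (simp add: bij_betw_def)
    then show "C \<in> cubes (X_ess X t)"
      unfolding X_ess_def sageev_complex_def A v using C
      by (auto intro!: exI[of _ "0::nat"] exI[of _ "\<lambda>_. {}"])
  qed
qed

text \<open>Without positive half-spaces the essential complex has the empty set as its only vertex.
  Hence \<open>d\<close> is 0, the cubing is a point with the trivial action, and both hulls are
  empty.\<close>

lemma trivial_case:
  fixes X :: "'v cubical"
  assumes K: "group K" and e: "A_pos X t = {}" and C: "C \<in> cubes (X_ess X t)" and d: "cube_dim C = d"
  shows "\<exists>(\<psi> :: 'g \<Rightarrow> (nat \<Rightarrow> int) \<Rightarrow> (nat \<Rightarrow> int)) (\<phi> :: 'v set set \<Rightarrow> (nat \<Rightarrow> int)).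
    cubical_action K (int_cubing d) \<psi> \<and>
    isometric_embedding (X_ess X t) (int_cubing d) \<phi> \<and>
    (\<forall>h\<in>carrier K. \<forall>\<sigma>\<in>verts (X_ess X t). \<phi> (image_hs (act h) \<sigma>) = \<psi> h (\<phi> \<sigma>)) \<and>
    \<phi> ` C = unit_cube d \<and>
    bij_betw (ess_induced X t d \<phi>) (A_all X t) (int_halfspaces d) \<and>
    ess_induced X t d \<phi> ` A_pos X t = int_halfspaces_pos d \<and>
    tightly_nested_chain (A_all X t)
      {K \<in> hull_closed X t A. ess_induced X t d \<phi> K \<in> coord_halfspaces d 0} \<and>
    hull_half_open X t A = ess_interval X t (min_vertex X t C) (image_hs t (min_vertex X t C))"
proof -
  note E = ess_empty[OF e]
  have CC: "C = {{}}" using C E(3) by simp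
  have d0: "d = 0" using cube_dim_eq[of C 0] d CC by simp
  let ?V = "verts (int_cubing 0)"
  let ?\<psi> = "\<lambda>_ :: 'g. restrict (\<lambda>x. x) ?V" and ?\<phi> = "\<lambda>_ :: 'v set set. \<lambda>_ :: nat. 0 :: int"
  have "group_hom K (BijGroup ?V) ?\<psi>"
  proof (intro group_hom.intro group_hom_axioms.intro K group_BijGroup homI)
    have b: "(\<lambda>x\<in>?V. x) \<in> Bij ?V" using id_Bij[of ?V] by simp
    then show "(\<lambda>x\<in>?V. x) \<in> carrier (BijGroup ?V)" by (simp add: BijGroup_def)
    show "(\<lambda>x\<in>?V. x) = (\<lambda>x\<in>?V. x) \<otimes>\<^bsub>BijGroup ?V\<^esub> (\<lambda>x\<in>?V. x)"
      using b by (auto simp: BijGroup_def compose_def fun_eq_iff)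
  qed
  then have 1: "cubical_action K (int_cubing d) ?\<psi>"
    unfolding cubical_action_def group_action_def d0 int_cubing_0 by simp
  have 2: "isometric_embedding (X_ess X t) (int_cubing d) ?\<phi>"
    unfolding isometric_embedding_def E d0 int_cubing_0 by (simp add: cdist_self)
  have 3: "int_halfspaces_pos d = {}" "int_halfspaces d = {}"
    by (simp_all add: d0 int_halfspaces_def int_halfspaces_neg_def int_halfspaces_pos_def)
  have 4: "hull_closed X t A = {}" by (simp add: hull_closed_def e)
  have 5: "unit_cube d = {\<lambda>_. 0}" unfolding unit_cube_def d0 int_cubing_0 by auto
  show ?thesis
  proof (intro exI conjI)
    show "cubical_action K (int_cubing d) ?\<psi>" by (rule 1)
    show "isometric_embedding (X_ess X t) (int_cubing d) ?\<phi>" by (rule 2)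
    show "\<forall>h\<in>carrier K. \<forall>\<sigma>\<in>verts (X_ess X t). ?\<phi> (image_hs (act h) \<sigma>) = ?\<psi> h (?\<phi> \<sigma>)"
      unfolding int_cubing_0 by simp
    show "?\<phi> ` C = unit_cube d" unfolding CC 5 by simp
    show "bij_betw (ess_induced X t d ?\<phi>) (A_all X t) (int_halfspaces d)" unfolding E 3 by (simp add: bij_betw_def)
    show "ess_induced X t d ?\<phi> ` A_pos X t = int_halfspaces_pos d" unfolding e 3 by simp
    show "tightly_nested_chain (A_all X t) {K \<in> hull_closed X t A. ess_induced X t d ?\<phi> K \<in> coord_halfspaces d 0}"
      unfolding 4 by (simp add: tightly_nested_chain_def)
    show "hull_half_open X t A = ess_interval X t (min_vertex X t C) (image_hs t (min_vertex X t C))"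
      unfolding hull_half_open_def 4 ess_interval_def E by simp
  qed
qed

theorem proposition5p4:
  fixes G :: "('g, 'b) monoid_scheme"
    and X :: "'v cubical"
    and act :: "'g \<Rightarrow> 'v \<Rightarrow> 'v"
    and g :: 'g
    and C :: "'v set set set"
    and A :: "'v set set"
    and d :: nat
  assumes "CAT0_cube_complex X"
    and "cubical_action G X act"
    and "without_inversion G X act"
    and "g \<in> carrier G"
    and "hyperbolic X (act g)"
    and "non_transverse_on_ess X (act g)"
    and "enat d = complex_dim (X_ess X (act g))"
    and "C \<in> cubes (X_ess X (act g))"
    and "cube_dim C = d"
    and "A = dual_pos X (act g) C"
  shows "\<exists>(\<psi> :: 'g \<Rightarrow> (nat \<Rightarrow> int) \<Rightarrow> (nat \<Rightarrow> int)) (\<phi> :: 'v set set \<Rightarrow> (nat \<Rightarrow> int)).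
    cubical_action (subgroup_generated G {g}) (int_cubing d) \<psi> \<and>
    isometric_embedding (X_ess X (act g)) (int_cubing d) \<phi> \<and>
    (\<forall>h\<in>carrier (subgroup_generated G {g}). \<forall>\<sigma>\<in>verts (X_ess X (act g)).
       \<phi> (image_hs (act h) \<sigma>) = \<psi> h (\<phi> \<sigma>)) \<and>
    \<phi> ` C = unit_cube d \<and>
    bij_betw (ess_induced X (act g) d \<phi>) (A_all X (act g)) (int_halfspaces d) \<and>
    ess_induced X (act g) d \<phi> ` A_pos X (act g) = int_halfspaces_pos d \<and>
    tightly_nested_chain (A_all X (act g))
      {K \<in> hull_closed X (act g) A. ess_induced X (act g) d \<phi> K \<in> coord_halfspaces d 0} \<and>
    hull_half_open X (act g) A =
      ess_interval X (act g) (min_vertex X (act g) C)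
        (image_hs (act g) (min_vertex X (act g) C))"
proof -
  let ?K = "subgroup_generated G {g}" and ?t = "act g"
  have act: "group_action G (verts X) act" using assms(2) by (simp add: cubical_action_def)
  then interpret group G by (simp add: group_action_def group_hom_def)
  have K: "group ?K" by (rule group_subgroup_generated)
  show ?thesis
  proof (cases "A_pos X ?t = {}")
    case True
    show ?thesis by (rule trivial_case[OF K True assms(8,9)])
  next
    case False
    interpret cat0 X by (rule cat0.intro) (rule assms(1))
    have ap: "auto_pair X ?t (act (inv\<^bsub>G\<^esub> g))" by (rule action_auto_pair[OF assms(2,4)])
    obtain \<gamma> :: "int \<Rightarrow> 'v" and H l where l: "0 < l" and ax: "\<And>n. \<gamma> n \<in> verts X" "A_pos X ?t = range H"
      "\<And>m n. \<gamma> m \<in> H n \<longleftrightarrow> n < m" "\<And>n. H n \<subseteq> verts X" "\<And>n. ?t ` H n = H (n + l)"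
      using axis_family[OF ap assms(5) False] by metis
    have nt: "\<not> transverse X (H n) (H (n + l))" for n
      using assms(6) ax(2) unfolding non_transverse_on_ess_def A_all_def ax(5)[symmetric] by blast
    interpret axis_data X ?t \<gamma> H l
      using l ax auto_pair_bij[OF ap] nt by unfold_locales simp_all
    obtain P B where f: "is_face P B" "C = face P B" using assms(8) by (rule cube_face)
    have cB: "card B = d" using cube_dim_face[OF f(1)] f(2) assms(9) by simp
    interpret ess_face X ?t \<gamma> H l P B d
      using f(1) cB dim_antichain[OF assms(7)] by unfold_locales
    show ?thesis
    proof (rule chain_decomposition)
      fix c :: "nat \<Rightarrow> int \<Rightarrow> int" and \<rho> :: "nat \<Rightarrow> nat" and s :: "nat \<Rightarrow> int"
      assume c: "\<And>i. i < d \<Longrightarrow> c i 0 \<in> B"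
        "bij_betw (\<lambda>(i, n). c i n) ({..<d} \<times> UNIV) UNIV"
        "\<And>i m n. i < d \<Longrightarrow> lq (c i m) (c i n) \<longleftrightarrow> m \<le> n"
        "\<rho> ` {..<d} = {..<d}" "\<And>i n. i < d \<Longrightarrow> c i n + l = c (\<rho> i) (n + s i)"
        "\<And>m n x. m \<in> Q \<Longrightarrow> n \<in> Q \<Longrightarrow> m \<in> range (c 0) \<Longrightarrow> n \<in> range (c 0) \<Longrightarrow>
          lq m x \<Longrightarrow> lq x n \<Longrightarrow> x \<noteq> m \<Longrightarrow> x \<noteq> n \<Longrightarrow>
          \<exists>y\<in>Q. y \<in> range (c 0) \<and> lq m y \<and> lq y n \<and> y \<noteq> m \<and> y \<noteq> n"
      interpret coordinates X ?t \<gamma> H l P B d c \<rho> s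
        by unfold_locales (fact c)+
      have AB: "A = H ` B" unfolding assms(10) f(2) by (rule dual_pos_face[OF f(1)])
      have mv: "min_vertex X ?t C = vert P" unfolding f(2) by (rule min_vertex_face[OF f(1)])
      have sub: "carrier ?K \<subseteq> carrier G" by (rule carrier_subgroup_generated_subset)
      have pow: "\<exists>k. \<forall>n. act h ` H n = H (n + k * l)" if h: "h \<in> carrier ?K" for h
      proof -
        obtain k :: int where k: "h = g [^]\<^bsub>G\<^esub> k"
          using h unfolding carrier_subgroup_generated_by_singleton[OF assms(4)] by (rule imageE)
        have "act h ` H n = H (n + k * l)" for n
          unfolding k by (rule int_pow_shift[OF act assms(4), where H = H]) (fact ax(4) ax(5))+
        then show ?thesis by blast
      qed
      \<comment> \<open>The number of periods by which \<open>h\<close> shifts. It is unique since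
        different indices have different half-spaces, which gives additivity below.\<close>
      define \<sigma> where "\<sigma> h = (SOME k. \<forall>n. act h ` H n = H (n + k * l))" for h
      have \<sigma>: "act h ` H n = H (n + \<sigma> h * l)" if "h \<in> carrier ?K" for h n
        using someI_ex[OF pow[OF that]] unfolding \<sigma>_def by (rule spec)
      have add: "\<sigma> (h \<otimes>\<^bsub>?K\<^esub> h') = \<sigma> h + \<sigma> h'" if h: "h \<in> carrier ?K" "h' \<in> carrier ?K" for h h'
      proof -
        have hh: "h \<otimes>\<^bsub>?K\<^esub> h' \<in> carrier ?K" using h by (rule monoid.m_closed[OF group.is_monoid[OF K]])
        \<comment> \<open>The image of the single half-space \<open>H 0\<close> already reveals the
          shift.\<close>
        have "act (h \<otimes>\<^bsub>G\<^esub> h') ` H 0 = (\<lambda>x. act h (act h' x)) ` H 0"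
        proof (rule image_cong[OF HOL.refl])
          fix x assume "x \<in> H 0"
          then show "act (h \<otimes>\<^bsub>G\<^esub> h') x = act h (act h' x)"
            using group_action.composition_rule[OF act subsetD[OF H_verts] subsetD[OF sub h(1)]
                subsetD[OF sub h(2)]] by blast
        qed
        also have "\<dots> = act h ` act h' ` H 0" by (simp add: image_image)
        finally have "H (\<sigma> (h \<otimes>\<^bsub>?K\<^esub> h') * l) = H (\<sigma> h' * l + \<sigma> h * l)"
          using \<sigma>[OF h(2), of 0] \<sigma>[OF h(1)] \<sigma>[OF hh, of 0] by simp
        then have "\<sigma> (h \<otimes>\<^bsub>?K\<^esub> h') * l = (\<sigma> h + \<sigma> h') * l" unfolding H_inj by (simp add: algebra_simps)
        then show ?thesis using l by simp
      qed
      show ?thesis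
      proof (intro exI conjI)
        show "cubical_action ?K (int_cubing d) (\<lambda>h. restrict (\<Psi> (\<sigma> h)) (verts (int_cubing d)))"
          by (rule \<Psi>_action[OF K add])
        show "isometric_embedding (X_ess X ?t) (int_cubing d) \<phi>" by (rule \<phi>_isometric_embedding)
        show "\<forall>h\<in>carrier ?K. \<forall>\<upsilon>\<in>verts (X_ess X ?t).
            \<phi> (image_hs (act h) \<upsilon>) = restrict (\<Psi> (\<sigma> h)) (verts (int_cubing d)) (\<phi> \<upsilon>)"
        proof (intro ballI)
          fix h \<upsilon> assume h: "h \<in> carrier ?K" and "\<upsilon> \<in> verts (X_ess X ?t)"
          then obtain U where U: "\<upsilon> = vert U" "good U" unfolding ess_verts by blast
          have "h \<in> carrier G" using h sub by blast
          then have "bij_betw (act h) (verts X) (verts X)"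
            by (rule auto_pair_bij[OF action_auto_pair[OF assms(2)]])
          from \<Psi>_equivariant[OF U(2) this \<sigma>[OF h]]
          show "\<phi> (image_hs (act h) \<upsilon>) = restrict (\<Psi> (\<sigma> h)) (verts (int_cubing d)) (\<phi> \<upsilon>)"
            unfolding U(1) using coord_verts by simp
        qed
        show "\<phi> ` C = unit_cube d" unfolding f(2) by (rule \<phi>_base)
        show "bij_betw (ess_induced X ?t d \<phi>) (A_all X ?t) (int_halfspaces d)" by (rule ess_induced_bij)
        show "ess_induced X ?t d \<phi> ` A_pos X ?t = int_halfspaces_pos d" by (rule ess_induced_pos)
        show "tightly_nested_chain (A_all X ?t)
            {K \<in> hull_closed X ?t A. ess_induced X ?t d \<phi> K \<in> coord_halfspaces d 0}"
          unfolding AB by (rule tight_chain)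
        show "hull_half_open X ?t A =
            ess_interval X ?t (min_vertex X ?t C) (image_hs ?t (min_vertex X ?t C))"
          unfolding AB mv by (rule hull_half_open_eq)
      qed
    qed
  qed
qed

end
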